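(* Let $\mathcal{X}$ and $\mathcal{A}$ be finite sets, $\mathcal{H}_B$ a finite-dimensional Hilbert space, and let $\{\hat\rho_B^{a,x}\}_{a\in\mathcal{A},x\in\mathcal{X}}$ be an assemblage. Then the intrinsic steerability $S(\overline{A};B)_{\hat\rho}$ (defined in the context) has the following three properties. (i) (Vanishing on unsteerable assemblages.) If the assemblage has a local-hidden-state model, i.e. there exist a finite set $\Lambda$, a probability distribution $p_\Lambda$ on it, conditional distributions $p_{\overline{A}|X\Lambda}(a|x,\lambda)$, and density operators $\rho_B^\lambda$ such that $\hat\rho_B^{a,x}=\sum_\lambda p_\Lambda(\lambda)p_{\overline{A}|X\Lambda}(a|x,\lambda)\rho_B^\lambda$ for all $a,x$, then $S(\overline{A};B)_{\hat\rho}=0$. (ii) (Monotonicity on average under deterministic 1W-LOCC.) Let $\{\mathcal{K}_z\}_{z\in\mathcal{Z}}$ be a quantum instrument on $B$ (completely positive maps from operators on $\mathcal{H}_B$ to operators on $\mathcal{H}_{B_f}$ whose sum is trace preserving), let $p(x|x_f,z)$ and $p(a_f|x_f,x,a,z)$ be conditional probability distributions (with $x_f$ in a finite set $\mathcal{X}_f$ and $a_f$ in a finite set $\mathcal{A}_f$), let $\rho_B:=\sum_a\hat\rho_B^{a,x}$ (independent of $x$) and $p(z):=\operatorname{Tr}(\mathcal{K}_z(\rho_B))$. For each $z$ with $p(z)>0$ define the assemblage $\hat\rho_z:=\{\hat\rho^{a_f,x_f}_{B_f,z}\}_{a_f,x_f}$ with $$\hat\rho^{a_f,x_f}_{B_f,z}:=\sum_{a,x}p(a_f|x_f,x,a,z)\,p(x|x_f,z)\,\mathcal{K}_z(\hat\rho_B^{a,x})/p(z).$$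 Then $\sum_{z:\,p(z)>0}p(z)\,S(\overline{A}_f;B_f)_{\hat\rho_z}\le S(\overline{A};B)_{\hat\rho}$. (iii) (Convexity.) If $\{\hat\rho_B^{a,x}\}_{a,x}$ and $\{\hat\sigma_B^{a,x}\}_{a,x}$ are assemblages with the same index sets and Bob space, $\lambda\in[0,1]$, and $\hat\tau_B^{a,x}:=\lambda\hat\rho_B^{a,x}+(1-\lambda)\hat\sigma_B^{a,x}$, then $S(\overline{A};B)_{\hat\tau}\le\lambda S(\overline{A};B)_{\hat\rho}+(1-\lambda)S(\overline{A};B)_{\hat\sigma}$.
   Context: An assemblage with input set $\mathcal{X}$, output set $\mathcal{A}$ (finite sets) and Bob system $B$ (finite-dimensional Hilbert space $\mathcal{H}_B$) is a family of positive semidefinite operators $\{\hat\rho_B^{a,x}\}_{a\in\mathcal{A},x\in\mathcal{X}}$ on $\mathcal{H}_B$ such that $\sum_a\hat\rho_B^{a,x}$ is a density operator independent of $x$ (no-signaling). For a tripartite state $\sigma_{KLM}$, $I(K;L|M)_\sigma:=H(KM)_\sigma+H(LM)_\sigma-H(KLM)_\sigma-H(M)_\sigma$ with $H(G)_\omega=-\operatorname{Tr}(\omega_G\log_2\omega_G)$. Intrinsic steerability: given a finite set $\mathcal{Y}$, a quantum instrument $\{\mathcal{K}_y\}_{y\in\mathcal{Y}}$ (completely positive maps from operators on $\mathcal{H}_B$ to operators on some finite-dimensional $\mathcal{H}_{B'}$ with $\sum_y\mathcal{K}_y$ trace preserving) and a conditional distribution $p_{X|Y}$, a non-signaling extension is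 a state $$\rho_{X\overline{A}B'EY}=\sum_{x,a,y}p_{X|Y}(x|y)|x\rangle\langle x|_X\otimes|a\rangle\langle a|_{\overline{A}}\otimes\hat\rho^{a,x,y}_{B'E}\otimes|y\rangle\langle y|_Y,$$ where $E$ is an arbitrary finite-dimensional system, $\{|x\rangle\},\{|a\rangle\},\{|y\rangle\}$ are orthonormal bases, each $\hat\rho^{a,x,y}_{B'E}\ge0$, $\operatorname{Tr}_E\hat\rho^{a,x,y}_{B'E}=\mathcal{K}_y(\hat\rho_B^{a,x})$, and $\sum_a\hat\rho^{a,x,y}_{B'E}=\sum_a\hat\rho^{a,x',y}_{B'E}$ for all $x,x',y$. Then $S(\overline{A};B)_{\hat\rho}:=\sup_{\{p_{X|Y},\{\mathcal{K}_y\}_y\}}\inf_{\rho_{X\overline{A}B'EY}}I(X\overline{A};B'|EY)_\rho$, the supremum over all finite $\mathcal{Y}$, instruments and channels $p_{X|Y}$, the infimum over all such non-signaling extensions. *)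

theory Defs
  imports "Jordan_Normal_Form.Char_Poly" "Jordan_Normal_Form.Conjugate"
begin

text \<open>A system of dimension d is the Hilbert space C^d; operators are
  d x d complex matrices (type complex mat, carrier carrier_mat d d).
  Finite index sets are represented as initial segments {0..<n} of nat.\<close>

definition mtrace :: "complex mat \<Rightarrow> complex" where
  "mtrace M = (\<Sum>i<dim_row M. M $$ (i, i))"

definition psd :: "nat \<Rightarrow> complex mat \<Rightarrow> bool" where
  "psd d M \<longleftrightarrow> M \<in> carrier_mat d d \<and>
     (\<forall>v \<in> carrier_vec d. Im (conjugate v \<bullet> (M *\<^sub>v v)) = 0 \<and> Re (conjugate v \<bullet> (M *\<^sub>v v)) \<ge> 0)"

definition density :: "nat \<Rightarrow> complex mat \<Rightarrow> bool" where
  "density d M \<longleftrightarrow> psd d M \<and> mtrace M = 1"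

definition msum :: "nat \<Rightarrow> nat \<Rightarrow> (nat \<Rightarrow> complex mat) \<Rightarrow> complex mat" where
  "msum d n f = mat d d (\<lambda>(i, j). \<Sum>k<n. f k $$ (i, j))"

definition kron :: "complex mat \<Rightarrow> complex mat \<Rightarrow> complex mat" where
  "kron A B = mat (dim_row A * dim_row B) (dim_col A * dim_col B)
     (\<lambda>(i, j). A $$ (i div dim_row B, j div dim_col B) * B $$ (i mod dim_row B, j mod dim_col B))"

definition proj :: "nat \<Rightarrow> nat \<Rightarrow> complex mat" where
  "proj n i = mat n n (\<lambda>(j, k). if j = i \<and> k = i then 1 else 0)"

definition ptrace_mid :: "nat \<Rightarrow> nat \<Rightarrow> nat \<Rightarrow> complex mat \<Rightarrow> complex mat" where
  "ptrace_mid d1 d2 d3 M = mat (d1 * d3) (d1 * d3)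
     (\<lambda>(i, j). \<Sum>k<d2. M $$ (((i div d3) * d2 + k) * d3 + i mod d3,
                              ((j div d3) * d2 + k) * d3 + j mod d3))"

text \<open>von Neumann entropy (base 2): -Tr(w log2 w) = - sum of lambda log2 lambda over
  the eigenvalues lambda of w counted with algebraic multiplicity (the roots of the
  characteristic polynomial); 0 log 0 = 0 holds automatically since log 2 0 = 0.\<close>
definition entropy :: "complex mat \<Rightarrow> real" where
  "entropy M = - sum_mset (image_mset (\<lambda>l. Re l * log 2 (Re l)) (proots (char_poly M)))"

definition cmi :: "nat \<Rightarrow> nat \<Rightarrow> nat \<Rightarrow> complex mat \<Rightarrow> real" where
  "cmi dK dL dM \<rho> =
     entropy (ptrace_mid dK dL dM \<rho>)            \<comment> \<open>H(KM)\<close>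
   + entropy (ptrace_mid 1 dK (dL * dM) \<rho>)      \<comment> \<open>H(LM)\<close>
   - entropy \<rho>                                 \<comment> \<open>H(KLM)\<close>
   - entropy (ptrace_mid 1 (dK * dL) dM \<rho>)"

definition lin_map :: "nat \<Rightarrow> nat \<Rightarrow> (complex mat \<Rightarrow> complex mat) \<Rightarrow> bool" where
  "lin_map d d' \<Phi> \<longleftrightarrow>
     (\<forall>M \<in> carrier_mat d d. \<Phi> M \<in> carrier_mat d' d') \<and>
     (\<forall>M \<in> carrier_mat d d. \<forall>N \<in> carrier_mat d d. \<Phi> (M + N) = \<Phi> M + \<Phi> N) \<and>
     (\<forall>M \<in> carrier_mat d d. \<forall>c. \<Phi> (c \<cdot>\<^sub>m M) = c \<cdot>\<^sub>m \<Phi> M)"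

text \<open>(id_n (x) Phi) applied to an (n*d) x (n*d) matrix, acting blockwise.\<close>
definition ampl :: "nat \<Rightarrow> nat \<Rightarrow> nat \<Rightarrow> (complex mat \<Rightarrow> complex mat) \<Rightarrow> complex mat \<Rightarrow> complex mat" where
  "ampl n d d' \<Phi> M = mat (n * d') (n * d')
     (\<lambda>(i, j). \<Phi> (mat d d (\<lambda>(k, l). M $$ ((i div d') * d + k, (j div d') * d + l)))
                  $$ (i mod d', j mod d'))"

definition cp_map :: "nat \<Rightarrow> nat \<Rightarrow> (complex mat \<Rightarrow> complex mat) \<Rightarrow> bool" where
  "cp_map d d' \<Phi> \<longleftrightarrow> lin_map d d' \<Phi> \<and>
     (\<forall>n M. psd (n * d) M \<longrightarrow> psd (n * d') (ampl n d d' \<Phi> M))"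

definition instrument :: "nat \<Rightarrow> nat \<Rightarrow> nat \<Rightarrow> (nat \<Rightarrow> complex mat \<Rightarrow> complex mat) \<Rightarrow> bool" where
  "instrument nY d d' K \<longleftrightarrow> (\<forall>y<nY. cp_map d d' (K y)) \<and>
     (\<forall>M \<in> carrier_mat d d. mtrace (msum d' nY (\<lambda>y. K y M)) = mtrace M)"

definition cond_dist :: "nat \<Rightarrow> nat \<Rightarrow> (nat \<Rightarrow> nat \<Rightarrow> real) \<Rightarrow> bool" where
  "cond_dist nX nY p \<longleftrightarrow> (\<forall>y<nY. (\<forall>x<nX. 0 \<le> p x y) \<and> (\<Sum>x<nX. p x y) = 1)"

definition assemblage :: "nat \<Rightarrow> nat \<Rightarrow> nat \<Rightarrow> (nat \<Rightarrow> nat \<Rightarrow> complex mat) \<Rightarrow> bool" where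
  "assemblage nA nX dB \<rho> \<longleftrightarrow> 0 < nX \<and>
     (\<forall>a<nA. \<forall>x<nX. psd dB (\<rho> a x)) \<and>
     (\<exists>\<sigma>. density dB \<sigma> \<and> (\<forall>x<nX. msum dB nA (\<lambda>a. \<rho> a x) = \<sigma>))"

definition ns_ext :: "nat \<Rightarrow> nat \<Rightarrow> nat \<Rightarrow> (nat \<Rightarrow> nat \<Rightarrow> complex mat) \<Rightarrow> nat \<Rightarrow> nat \<Rightarrow>
    (nat \<Rightarrow> complex mat \<Rightarrow> complex mat) \<Rightarrow> (nat \<Rightarrow> nat \<Rightarrow> nat \<Rightarrow> complex mat) \<Rightarrow> bool" where
  "ns_ext nA nX nY \<rho> dB' dE K ext \<longleftrightarrow> 0 < dE \<and>
     (\<forall>a<nA. \<forall>x<nX. \<forall>y<nY. psd (dB' * dE) (ext a x y) \<and>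
         ptrace_mid dB' dE 1 (ext a x y) = K y (\<rho> a x)) \<and>
     (\<forall>x<nX. \<forall>x'<nX. \<forall>y<nY.
         msum (dB' * dE) nA (\<lambda>a. ext a x y) = msum (dB' * dE) nA (\<lambda>a. ext a x' y))"

definition ext_state :: "nat \<Rightarrow> nat \<Rightarrow> nat \<Rightarrow> nat \<Rightarrow> nat \<Rightarrow> (nat \<Rightarrow> nat \<Rightarrow> real) \<Rightarrow>
    (nat \<Rightarrow> nat \<Rightarrow> nat \<Rightarrow> complex mat) \<Rightarrow> complex mat" where
  "ext_state nA nX nY dB' dE p ext =
     (let D = nX * nA * dB' * dE * nY in
      msum D nX (\<lambda>x. msum D nA (\<lambda>a. msum D nY (\<lambda>y.
        complex_of_real (p x y) \<cdot>\<^sub>m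
          kron (kron (kron (proj nX x) (proj nA a)) (ext a x y)) (proj nY y)))))"

definition steerability :: "nat \<Rightarrow> nat \<Rightarrow> nat \<Rightarrow> (nat \<Rightarrow> nat \<Rightarrow> complex mat) \<Rightarrow> real" where
  "steerability nA nX dB \<rho> =
     Sup {Inf {cmi (nX * nA) dB' (dE * nY) (ext_state nA nX nY dB' dE p ext)
                | dE ext. ns_ext nA nX nY \<rho> dB' dE K ext}
          | nY dB' K p. instrument nY dB dB' K \<and> cond_dist nX nY p}"

end

theory Submission
  imports Defs
begin

text \<open>For an extension that is classical on \<open>X A\<close> and \<open>Y\<close>, the conditional mutual information
  is the sum over \<open>y\<close> of \<open>F(\<Sum> p\<^sub>k A\<^sub>k) - \<Sum> F(p\<^sub>k A\<^sub>k)\<close>, where \<open>F(A) = H(A) - H(tr\<^sub>B A)\<close> is the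
  conditional entropy of \<open>B'\<close> given \<open>E\<close>, extended homogeneously to unnormalised operators. All three
  claims follow from superadditivity of \<open>F\<close>, i.e. strong subadditivity. It is derived from joint
  convexity of the relative entropy, for which the logarithm is written as an integral over \<open>s\<close> of
  quadratic forms \<open>\<langle>A - B, (L\<^sub>A + s R\<^sub>B)\<^sup>-\<^sup>1 (A - B)\<rangle>\<close>, each of which is a supremum of functions
  linear in \<open>(A, B)\<close>.

  An unsteerable assemblage has an extension with the hidden variable in \<open>E\<close>, for which \<open>F\<close> is
  additive. For convexity the extensions are put side by side on a direct sum of their \<open>E\<close> systems.
  For monotonicity the near-optimal strategies of the conditional assemblages are combined into one
  strategy for the original one; every extension for it yields extensions for all of them, and
  coarse-graining \<open>X A\<close> can only decrease the conditional mutual information.\<close>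

subsection \<open>The spectral theorem\<close>

text \<open>\<open>Sup\<close> and \<open>Inf\<close> range over reals, so they carry information
  only on nonempty bounded sets: strong subadditivity bounds every value below by 0, and the
  extension with trivial \<open>E\<close> shows nonemptiness and the bound
  \<open>log 2 (real (nX * nA))\<close>, uniform in Bob's output dimension. Operators are functions
  on index sets, so a tensor product is a product of sets, a restriction a smaller set, and a direct
  sum of \<open>E\<close> systems an injective labelling; the links to matrices are
  \<open>entropy_eq_entropy_on\<close> and \<open>ext_cmis_eq\<close>. Joint convexity becomes
  superadditivity of F through the choice \<open>1 \<otimes> tr B\<close> for the second argument of
  the relative entropy: it is linear in \<open>B\<close>, and the relative entropy is then -F up to
  the factor \<open>ln 2\<close> and a multiple of the trace. The integral over \<open>s\<close> is
  handled by comparing antiderivatives at 0 and at infinity. Monotonicity rests on no-signalling: as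
  the sum over \<open>a\<close> does not depend on \<open>x\<close>, drawing \<open>x\<close> from
  different distributions for different \<open>xf\<close> leaves the sum over \<open>af\<close>
  unchanged, so post-processing an extension gives an extension.\<close>

definition ip :: "'i set \<Rightarrow> ('i \<Rightarrow> complex) \<Rightarrow> ('i \<Rightarrow> complex) \<Rightarrow> complex" where
  "ip I u v = (\<Sum>x\<in>I. cnj (u x) * v x)"

definition orthonormal :: "'i set \<Rightarrow> 'j set \<Rightarrow> ('j \<Rightarrow> 'i \<Rightarrow> complex) \<Rightarrow> bool" where
  "orthonormal I J v \<longleftrightarrow> (\<forall>i\<in>J. \<forall>j\<in>J. ip I (v i) (v j) = (if i = j then 1 else 0))"

definition complete_on :: "'i set \<Rightarrow> 'j set \<Rightarrow> ('j \<Rightarrow> 'i \<Rightarrow> complex) \<Rightarrow> bool" where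
  "complete_on I J v \<longleftrightarrow>
     (\<forall>x\<in>I. \<forall>y\<in>I. (\<Sum>j\<in>J. v j x * cnj (v j y)) = (if x = y then 1 else 0))"

text \<open>The orthonormal family may be incomplete, so that block embeddings and zero padding do not
  require a basis of the kernel.\<close>
definition spectral :: "'i set \<Rightarrow> 'j set \<Rightarrow> ('j \<Rightarrow> real) \<Rightarrow> ('j \<Rightarrow> 'i \<Rightarrow> complex) \<Rightarrow>
    ('i \<Rightarrow> 'i \<Rightarrow> complex) \<Rightarrow> bool" where
  "spectral I J \<mu> v A \<longleftrightarrow> finite J \<and> orthonormal I J v \<and>
     (\<forall>x\<in>I. \<forall>y\<in>I. A x y = (\<Sum>j\<in>J. of_real (\<mu> j) * v j x * cnj (v j y)))"

text \<open>Only the summed index is restricted to \<open>I\<close>; the outer indices range over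
  whole types, so associativity is an equation between functions and can be used for plain
  rewriting.\<close>

definition op_mult :: "'i set \<Rightarrow> ('a \<Rightarrow> 'i \<Rightarrow> complex) \<Rightarrow> ('i \<Rightarrow> 'b \<Rightarrow> complex) \<Rightarrow> 'a \<Rightarrow> 'b \<Rightarrow> complex" where
  "op_mult I A B x y = (\<Sum>z\<in>I. A x z * B z y)"

lemma op_mult_assoc: "op_mult J (op_mult I A B) C = op_mult I A (op_mult J B C)"
  unfolding op_mult_def
  by (intro ext) (simp add: sum_distrib_left sum_distrib_right mult.assoc, subst sum.swap, rule refl)

lemma op_mult_id_left:
  assumes "finite I" "x \<in> I" "\<And>y. y \<in> I \<Longrightarrow> E x y = (if x = y then 1 else 0)"
  shows "op_mult I E A x z = A x z"
proof -
  have "op_mult I E A x z = (\<Sum>y\<in>I. if x = y then A y z else 0)"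
    unfolding op_mult_def using assms by (intro sum.cong) auto
  then show ?thesis using assms by simp
qed

lemma op_mult_id_right:
  assumes "finite I" "x \<in> I" "\<And>y. y \<in> I \<Longrightarrow> E y x = (if y = x then 1 else 0)"
  shows "op_mult I A E z x = A z x"
proof -
  have "op_mult I A E z x = (\<Sum>y\<in>I. if y = x then A z y else 0)"
    unfolding op_mult_def using assms by (intro sum.cong) auto
  then show ?thesis using assms by simp
qed

lemma op_mult_cong:
  assumes "\<And>y. y \<in> I \<Longrightarrow> A x y = A' x y" "\<And>y. y \<in> I \<Longrightarrow> B y z = B' y z"
  shows "op_mult I A B x z = op_mult I A' B' x z"
  unfolding op_mult_def using assms by (intro sum.cong) auto

text \<open>An enumeration of \<open>S\<close> turns \<open>A\<close> into a matrix of positive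
  dimension, whose characteristic polynomial has a complex root.\<close>

lemma eigenvector_exists:
  fixes A :: "'i \<Rightarrow> 'i \<Rightarrow> complex"
  assumes fin: "finite S" and ne: "S \<noteq> {}"
  shows "\<exists>l u. (\<exists>x\<in>S. u x \<noteq> 0) \<and> (\<forall>x\<in>S. (\<Sum>y\<in>S. A x y * u y) = l * u x)"
proof -
  define n where "n = card S"
  have n: "n > 0" using fin ne by (simp add: n_def card_gt_0_iff)
  obtain e where e: "bij_betw e {0..<n} S"
    using ex_bij_betw_nat_finite[OF fin] n_def by auto
  define M where "M = mat n n (\<lambda>(i,j). A (e i) (e j))"
  have M: "M \<in> carrier_mat n n" by (simp add: M_def)
  have "degree (char_poly M) = n" using degree_monic_char_poly[OF M] by simp
  then have "\<not> constant (poly (char_poly M))" using n by (simp add: constant_degree)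
  then obtain l where "poly (char_poly M) l = 0"
    using fundamental_theorem_of_algebra by blast
  then have "eigenvalue M l" using eigenvalue_root_char_poly[OF M] by simp
  then obtain w where w: "w \<in> carrier_vec n" "w \<noteq> 0\<^sub>v n" "M *\<^sub>v w = l \<cdot>\<^sub>v w"
    unfolding eigenvalue_def eigenvector_def using M by auto
  define f where "f = the_inv_into {0..<n} e"
  have fe: "f (e i) = i" if "i < n" for i
    unfolding f_def using e that by (simp add: bij_betw_def the_inv_into_f_f)
  define u where "u x = w $ f x" for x
  have nz: "\<exists>x\<in>S. u x \<noteq> 0"
  proof (rule ccontr)
    assume c: "\<not> ?thesis"
    have "w $ i = 0" if "i < n" for i
      using c e fe[OF that] that unfolding u_def bij_betw_def by force
    then have "w = 0\<^sub>v n" using w(1) by (intro eq_vecI) auto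
    then show False using w by simp
  qed
  have "(\<Sum>y\<in>S. A x y * u y) = l * u x" if "x \<in> S" for x
  proof -
    from that e obtain i where i: "i < n" "x = e i" unfolding bij_betw_def by auto
    have "(\<Sum>y\<in>S. A x y * u y) = (\<Sum>j\<in>{0..<n}. A x (e j) * u (e j))"
      using sum.reindex_bij_betw[OF e, of "\<lambda>y. A x y * u y"] by simp
    also have "\<dots> = (M *\<^sub>v w) $ i"
      using i w(1) by (simp add: M_def scalar_prod_def u_def fe)
    also have "\<dots> = l * u x" using i w by (simp add: u_def fe)
    finally show ?thesis .
  qed
  then show ?thesis using nz by blast
qed

lemma ip_self: "ip I u u = of_real (\<Sum>x\<in>I. (cmod (u x))\<^sup>2)"
  unfolding ip_def by (simp add: complex_norm_square mult.commute del: of_real_power)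

text \<open>The phase is chosen so that the vector is far from the basis vector it is to be
  reflected to.\<close>
lemma unit_eigenvector_exists:
  fixes A :: "'i \<Rightarrow> 'i \<Rightarrow> complex"
  assumes fin: "finite S" and i0: "i0 \<in> S"
  shows "\<exists>l u r. r \<le> 0 \<and> u i0 = of_real r \<and> ip S u u = 1 \<and>
    (\<forall>x\<in>S. (\<Sum>y\<in>S. A x y * u y) = l * u x)"
proof -
  obtain l u where u: "\<exists>x\<in>S. u x \<noteq> 0" "\<forall>x\<in>S. (\<Sum>y\<in>S. A x y * u y) = l * u x"
    using eigenvector_exists[OF fin, of A] i0 by blast
  define N where "N = (\<Sum>x\<in>S. (cmod (u x))\<^sup>2)"
  have N: "N > 0" unfolding N_def using u(1) fin by (auto intro!: sum_pos2)
  \<comment> \<open>Multiplication by \<open>ph\<close> turns \<open>u i0\<close> into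
    \<open>- cmod (u i0)\<close>; if \<open>u i0 = 0\<close>, any phase does.\<close>
  define ph where "ph = (if u i0 = 0 then 1 else - cnj (u i0) / of_real (cmod (u i0)))"
  have ph: "cmod ph = 1" by (simp add: ph_def norm_divide)
  define c where "c = ph / of_real (sqrt N)"
  define w where "w x = c * u x" for x
  have cc: "cnj c * c = 1 / of_real N"
  proof -
    have "cnj c * c = of_real ((cmod c)\<^sup>2)"
      by (simp add: complex_norm_square mult.commute del: of_real_power)
    also have "(cmod c)\<^sup>2 = 1 / N" using N ph by (simp add: c_def norm_divide power_divide)
    finally show ?thesis by simp
  qed
  have "ip S w w = cnj c * c * ip S u u"
    unfolding ip_def w_def by (simp add: sum_distrib_left mult_ac)
  also have "\<dots> = 1" unfolding cc ip_self N_def[symmetric] using N by simp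
  finally have 1: "ip S w w = 1" .
  have "w i0 = of_real (- (cmod (u i0) / sqrt N))"
  proof (cases "u i0 = 0")
    case False
    have "cnj (u i0) * u i0 = of_real (cmod (u i0)) * of_real (cmod (u i0))"
      by (metis complex_norm_square mult.commute power2_eq_square of_real_mult)
    then show ?thesis using False by (simp add: w_def c_def ph_def field_simps)
  qed (simp add: w_def)
  moreover have "- (cmod (u i0) / sqrt N) \<le> 0" using N by simp
  moreover have "(\<Sum>y\<in>S. A x y * w y) = l * w x" if "x \<in> S" for x
  proof -
    have "(\<Sum>y\<in>S. A x y * w y) = c * (\<Sum>y\<in>S. A x y * u y)"
      unfolding w_def by (simp add: sum_distrib_left mult_ac)
    then show ?thesis using u(2) that by (simp add: w_def)
  qed
  ultimately show ?thesis using 1 by blast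
qed

text \<open>The Householder reflection \<open>1 - 2 w w* / |w|^2\<close> in
  \<open>w = e - u\<close>, with \<open>e\<close> the basis vector at \<open>i0\<close>. Because
  \<open>u i0 = r\<close> is real, \<open>|w|^2 = 2 (1 - r)\<close>, and \<open>r \<le> 0\<close>
  keeps the denominator away from zero. Being Hermitian and an involution it is unitary, and so
  replaces the completion of \<open>u\<close> to an orthonormal basis.\<close>

lemma reflection_exists:
  fixes u :: "'i \<Rightarrow> complex"
  assumes fin: "finite S" and i0: "i0 \<in> S" and r: "r \<le> 0" "u i0 = of_real r" and n: "ip S u u = 1"
  shows "\<exists>R. (\<forall>x\<in>S. R x i0 = u x) \<and> (\<forall>x y. R y x = cnj (R x y)) \<and>
    (\<forall>x\<in>S. \<forall>z\<in>S. op_mult S R R x z = (if x = z then 1 else 0))"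
proof -
  define w where "w x = (if x = i0 then 1 else 0) - u x" for x
  define R where "R x y = (if x = y then 1 else 0) - w x * cnj (w y) / of_real (1 - r)" for x y
  have ww: "ip S w w = 2 * of_real (1 - r)"
  proof -
    have "ip S w w = (\<Sum>x\<in>S. (if x = i0 then (1 - cnj (u x)) * (1 - u x) - cnj (u x) * u x else 0)
        + cnj (u x) * u x)"
      unfolding ip_def w_def by (intro sum.cong) (auto simp: algebra_simps)
    also have "\<dots> = ((1 - cnj (u i0)) * (1 - u i0) - cnj (u i0) * u i0) + ip S u u"
      unfolding ip_def sum.distrib using fin i0 by simp
    finally show ?thesis using n r by (simp add: algebra_simps)
  qed
  have "R x i0 = u x" if "x \<in> S" for x
    using r by (simp add: R_def w_def field_simps)
  moreover have "R y x = cnj (R x y)" for x y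
    by (simp add: R_def mult.commute)
  moreover have "op_mult S R R x z = (if x = z then 1 else 0)" if xz: "x \<in> S" "z \<in> S" for x z
  proof -
    let ?c = "complex_of_real (1 - r)"
    have c0: "?c \<noteq> 0" using r(1) by (simp del: of_real_diff)
    have "op_mult S R R x z = (\<Sum>y\<in>S. (if x = y then R y z else 0) - w x * (cnj (w y) * R y z) / ?c)"
      unfolding op_mult_def R_def[of x] by (intro sum.cong) (auto simp: algebra_simps)
    also have "\<dots> = R x z - w x * (\<Sum>y\<in>S. cnj (w y) * R y z) / ?c"
      using fin xz by (simp add: sum_subtractf sum_distrib_left sum_divide_distrib)
    also have "(\<Sum>y\<in>S. cnj (w y) * R y z)
        = (\<Sum>y\<in>S. (if y = z then cnj (w y) else 0) - (cnj (w y) * w y) * (cnj (w z) / ?c))"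
      unfolding R_def by (intro sum.cong) (auto simp: algebra_simps)
    also have "\<dots> = cnj (w z) - ip S w w * (cnj (w z) / ?c)"
      unfolding ip_def sum_subtractf sum_distrib_right using fin xz by simp
    also have "\<dots> = - cnj (w z)" unfolding ww using c0 by (simp del: of_real_diff)
    finally show ?thesis by (simp add: R_def[of x z])
  qed
  ultimately show ?thesis by blast
qed

text \<open>Deflation: conjugation by the reflection moves an eigenvector to the basis vector at
  \<open>i0\<close>, and Hermiticity then splits \<open>B = R A R\<close> into the entry
  \<open>l\<close> and a Hermitian block on \<open>I\<close>, to which the induction hypothesis
  applies. The eigenvectors of \<open>A\<close> are the images under \<open>R\<close> of those of
  \<open>B\<close>.\<close>

lemma spectral_theorem:
  fixes A :: "'i \<Rightarrow> 'i \<Rightarrow> complex"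
  assumes "finite I" "\<And>x y. x \<in> I \<Longrightarrow> y \<in> I \<Longrightarrow> A y x = cnj (A x y)"
  shows "\<exists>\<mu> v. spectral I I \<mu> v A \<and> complete_on I I v"
  using assms
proof (induction I arbitrary: A rule: finite_induct)
  case empty
  show ?case by (auto simp: spectral_def complete_on_def orthonormal_def)
next
  case (insert i0 I)
  let ?S = "insert i0 I"
  have finS: "finite ?S" using insert by simp
  obtain l u r where u: "r \<le> 0" "u i0 = complex_of_real r" "ip ?S u u = 1"
    and eig: "\<And>x. x\<in>?S \<Longrightarrow> (\<Sum>y\<in>?S. A x y * u y) = l * u x"
    using unit_eigenvector_exists[OF finS, of i0 A] by blast
  obtain R where R: "\<And>x. x\<in>?S \<Longrightarrow> R x i0 = u x" "\<And>x y. R y x = cnj (R x y)"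
    and RR: "\<And>x z. x\<in>?S \<Longrightarrow> z\<in>?S \<Longrightarrow> op_mult ?S R R x z = (if x = z then 1 else 0)"
    using reflection_exists[OF finS _ u(1) u(2) u(3)] by blast
  define B where "B = op_mult ?S R (op_mult ?S A R)"
  have Bh: "B y x = cnj (B x y)" if "x \<in> ?S" "y \<in> ?S" for x y
  proof -
    have "cnj (B x y) = (\<Sum>p\<in>?S. \<Sum>q\<in>?S. R y q * A q p * R p x)"
      unfolding B_def op_mult_def cnj_sum complex_cnj_mult R(2)[symmetric] sum_distrib_left
      by (intro sum.cong refl, subst insert(4)[symmetric]) (auto simp: mult_ac)
    also have "\<dots> = B y x"
      unfolding B_def op_mult_def sum_distrib_left by (subst sum.swap) (simp add: mult_ac)
    finally show ?thesis by simp
  qed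
  have Bi0: "B x i0 = (if x = i0 then l else 0)" if "x \<in> ?S" for x
  proof -
    have "op_mult ?S A R p i0 = l * R p i0" if "p \<in> ?S" for p
    proof -
      have "op_mult ?S A R p i0 = (\<Sum>y\<in>?S. A p y * u y)"
        unfolding op_mult_def using R(1) by (intro sum.cong) auto
      then show ?thesis using eig[OF that] R(1)[OF that] by simp
    qed
    then have "B x i0 = (\<Sum>p\<in>?S. R x p * (l * R p i0))"
      unfolding B_def op_mult_def[of _ R] by (intro sum.cong) auto
    also have "\<dots> = l * op_mult ?S R R x i0"
      unfolding op_mult_def sum_distrib_left by (intro sum.cong) auto
    finally show ?thesis using RR[OF that, of i0] by simp
  qed
  have lreal: "l = of_real (Re l)"
    using Bh[of i0 i0] Bi0[of i0] by (simp add: complex_eq_iff)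
  obtain \<mu> v where dec: "spectral I I \<mu> v B" and com: "complete_on I I v"
    using insert(3)[of B] Bh by blast
  define \<mu>' where "\<mu>' j = (if j = i0 then Re l else \<mu> j)" for j
  define v' where "v' j x = (if j = i0 then (if x = i0 then 1 else 0)
      else if x = i0 then 0 else v j x)" for j x
  have v'i: "v' j x = v j x" if "j \<in> I" "x \<in> I" for j x
    using that insert(2) by (auto simp: v'_def)
  have v'0: "v' i0 x = (if x = i0 then 1 else 0)" "v' j i0 = (if j = i0 then 1 else 0)" for x j
    by (auto simp: v'_def)
  have orth': "(\<Sum>x\<in>?S. cnj (v' i x) * v' j x) = (if i = j then 1 else 0)"
    if ij: "i \<in> ?S" "j \<in> ?S" for i j
  proof -
    have "(\<Sum>x\<in>I. cnj (v' i x) * v' j x) = (\<Sum>x\<in>I. cnj (v i x) * v j x)" if "i \<in> I" "j \<in> I"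
      using that v'i by (intro sum.cong) auto
    also have "\<dots> = (if i = j then 1 else 0)" if "i \<in> I" "j \<in> I"
      using dec that unfolding spectral_def orthonormal_def ip_def by blast
    finally have a: "i \<in> I \<Longrightarrow> j \<in> I \<Longrightarrow> (\<Sum>x\<in>I. cnj (v' i x) * v' j x) = (if i = j then 1 else 0)" .
    have b: "(\<Sum>x\<in>I. cnj (v' i x) * v' j x) = 0" if "i = i0 \<or> j = i0"
      using that insert(2) by (intro sum.neutral) (auto simp: v'_def)
    show ?thesis using ij insert(1,2) a b by (auto simp: v'0)
  qed
  have com': "(\<Sum>j\<in>?S. v' j x * cnj (v' j y)) = (if x = y then 1 else 0)"
    if xy: "x \<in> ?S" "y \<in> ?S" for x y
  proof -
    have "(\<Sum>j\<in>I. v' j x * cnj (v' j y)) = (\<Sum>j\<in>I. v j x * cnj (v j y))" if "x \<in> I" "y \<in> I"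
      using that v'i by (intro sum.cong) auto
    also have "\<dots> = (if x = y then 1 else 0)" if "x \<in> I" "y \<in> I"
      using com that unfolding complete_on_def by blast
    finally have a: "x \<in> I \<Longrightarrow> y \<in> I \<Longrightarrow> (\<Sum>j\<in>I. v' j x * cnj (v' j y)) = (if x = y then 1 else 0)" .
    have b: "(\<Sum>j\<in>I. v' j x * cnj (v' j y)) = 0" if "x = i0 \<or> y = i0"
      using that insert(2) by (intro sum.neutral) (auto simp: v'_def)
    show ?thesis using xy insert(1,2) a b by (auto simp: v'0)
  qed
  have dec': "B x y = (\<Sum>j\<in>?S. of_real (\<mu>' j) * v' j x * cnj (v' j y))"
    if xy: "x \<in> ?S" "y \<in> ?S" for x y
  proof -
    have "(\<Sum>j\<in>I. of_real (\<mu>' j) * v' j x * cnj (v' j y)) = (\<Sum>j\<in>I. of_real (\<mu> j) * v j x * cnj (v j y))"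
      if "x \<in> I" "y \<in> I"
      using that insert(2) by (intro sum.cong) (auto simp: v'i \<mu>'_def)
    also have "\<dots> = B x y" if "x \<in> I" "y \<in> I"
      using dec that unfolding spectral_def by simp
    finally have a: "x \<in> I \<Longrightarrow> y \<in> I \<Longrightarrow>
      (\<Sum>j\<in>I. of_real (\<mu>' j) * v' j x * cnj (v' j y)) = B x y" .
    have b: "(\<Sum>j\<in>I. of_real (\<mu>' j) * v' j x * cnj (v' j y)) = 0" if "x = i0 \<or> y = i0"
      using that insert(2) by (intro sum.neutral) (auto simp: v'_def)
    have c: "B i0 y = (if y = i0 then l else 0)"
      using Bh[OF xy(2), of i0] Bi0[OF xy(2)] lreal by (auto simp: complex_eq_iff)
    show ?thesis using xy insert(1,2) a b c Bi0[OF xy(1)] lreal by (auto simp: v'0 \<mu>'_def)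
  qed
  define V where "V x j = v' j x" for x j
  define W where "W = op_mult ?S R V"
  have cW: "cnj (W x j) = (\<Sum>p\<in>?S. cnj (v' j p) * R p x)" for x j
    unfolding W_def op_mult_def V_def cnj_sum complex_cnj_mult R(2)[symmetric]
    by (simp add: mult.commute)
  have "ip ?S (\<lambda>x. W x i) (\<lambda>x. W x j) = (if i = j then 1 else 0)" if ij: "i \<in> ?S" "j \<in> ?S" for i j
  proof -
    have "ip ?S (\<lambda>x. W x i) (\<lambda>x. W x j) = op_mult ?S (op_mult ?S (\<lambda>_ p. cnj (v' i p)) R) (op_mult ?S R V) i j"
      unfolding ip_def cW unfolding op_mult_def W_def by simp
    also have "\<dots> = op_mult ?S (\<lambda>_ p. cnj (v' i p)) (op_mult ?S (op_mult ?S R R) V) i j"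
      by (simp only: op_mult_assoc)
    also have "\<dots> = op_mult ?S (\<lambda>_ p. cnj (v' i p)) V i j"
      using finS RR by (intro op_mult_cong) (auto intro!: op_mult_id_left)
    also have "\<dots> = (if i = j then 1 else 0)" using orth'[OF ij] by (simp add: op_mult_def V_def)
    finally show ?thesis .
  qed
  \<comment> \<open>Stated for arbitrary weights \<open>c\<close>: the eigenvalues give the
    decomposition of \<open>A\<close>, constant weight 1 gives completeness.\<close>
  moreover have "(\<Sum>j\<in>?S. c j * W x j * cnj (W y j)) =
      op_mult ?S R (op_mult ?S (\<lambda>p q. \<Sum>j\<in>?S. c j * v' j p * cnj (v' j q)) R) x y" for c x y
  proof -
    have "(\<Sum>j\<in>?S. c j * W x j * cnj (W y j)) =
      op_mult ?S (op_mult ?S R V) (op_mult ?S (\<lambda>j q. c j * cnj (v' j q)) R) x y"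
      unfolding cW op_mult_def[of _ "op_mult ?S R V"] op_mult_def[of ?S "\<lambda>j q. c j * cnj (v' j q)"]
      by (simp add: W_def sum_distrib_left mult_ac)
    also have "\<dots> = op_mult ?S R (op_mult ?S (op_mult ?S V (\<lambda>j q. c j * cnj (v' j q))) R) x y"
      by (simp only: op_mult_assoc)
    also have "op_mult ?S V (\<lambda>j q. c j * cnj (v' j q)) = (\<lambda>p q. \<Sum>j\<in>?S. c j * v' j p * cnj (v' j q))"
      unfolding op_mult_def V_def by (simp add: mult_ac)
    finally show ?thesis .
  qed
  note WW = this
  have "A x y = (\<Sum>j\<in>?S. of_real (\<mu>' j) * W x j * cnj (W y j))" if xy: "x \<in> ?S" "y \<in> ?S" for x y
  proof -
    have "A x y = op_mult ?S (op_mult ?S R R) A x y" using finS RR xy by (intro op_mult_id_left[symmetric]) auto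
    also have "\<dots> = op_mult ?S (op_mult ?S (op_mult ?S R R) A) (op_mult ?S R R) x y"
      using finS RR xy by (intro op_mult_id_right[symmetric]) auto
    also have "\<dots> = op_mult ?S R (op_mult ?S B R) x y" unfolding B_def by (simp only: op_mult_assoc)
    also have "\<dots> = op_mult ?S R (op_mult ?S (\<lambda>p q. \<Sum>j\<in>?S. of_real (\<mu>' j) * v' j p * cnj (v' j q)) R) x y"
      by (intro op_mult_cong refl dec')
    finally show ?thesis unfolding WW .
  qed
  moreover have "(\<Sum>j\<in>?S. W x j * cnj (W y j)) = (if x = y then 1 else 0)"
    if xy: "x \<in> ?S" "y \<in> ?S" for x y
  proof -
    have "(\<Sum>j\<in>?S. W x j * cnj (W y j)) =
        op_mult ?S R (op_mult ?S (\<lambda>p q. \<Sum>j\<in>?S. v' j p * cnj (v' j q)) R) x y"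
      using WW[of "\<lambda>_. 1" x y] by simp
    also have "\<dots> = op_mult ?S R R x y" using finS com' by (intro op_mult_cong refl op_mult_id_left)
    finally show ?thesis using RR[OF xy] by simp
  qed
  ultimately show ?case
    unfolding spectral_def orthonormal_def complete_on_def
    by (intro exI[of _ \<mu>'] exI[of _ "\<lambda>j x. W x j"]) (use finS in blast)
qed

subsection \<open>Von Neumann entropy\<close>

definition sesq :: "'i set \<Rightarrow> ('i \<Rightarrow> 'i \<Rightarrow> complex) \<Rightarrow> ('i \<Rightarrow> complex) \<Rightarrow> ('i \<Rightarrow> complex) \<Rightarrow> complex" where
  "sesq I A u w = (\<Sum>x\<in>I. \<Sum>y\<in>I. cnj (u x) * A x y * w y)"

text \<open>The order on complex numbers makes \<open>0 \<le> z\<close> include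
  \<open>Im z = 0\<close>; this is the source of Hermiticity in
  \<open>psd_on_hermitian\<close>.\<close>

definition psd_on :: "'i set \<Rightarrow> ('i \<Rightarrow> 'i \<Rightarrow> complex) \<Rightarrow> bool" where
  "psd_on I A \<longleftrightarrow> (\<forall>u. 0 \<le> sesq I A u u)"

definition trace_on :: "'i set \<Rightarrow> ('i \<Rightarrow> 'i \<Rightarrow> complex) \<Rightarrow> real" where
  "trace_on I A = Re (\<Sum>x\<in>I. A x x)"

definition eta :: "real \<Rightarrow> real" where
  "eta t = - (t * log 2 t)"

lemma eta_0 [simp]: "eta 0 = 0"
  by (simp add: eta_def)

lemma cnj_ip: "cnj (ip I u v) = ip I v u"
  unfolding ip_def by (simp add: mult.commute)

lemma sesq_cong:
  assumes "\<And>x y. x \<in> I \<Longrightarrow> y \<in> I \<Longrightarrow> A x y = B x y"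
  shows "sesq I A u w = sesq I B u w"
  unfolding sesq_def using assms by (intro sum.cong) auto

lemma psd_on_cong:
  assumes "\<And>x y. x \<in> I \<Longrightarrow> y \<in> I \<Longrightarrow> A x y = B x y"
  shows "psd_on I A \<longleftrightarrow> psd_on I B"
proof -
  have "sesq I A u u = sesq I B u u" for u by (rule sesq_cong) (rule assms)
  then show ?thesis unfolding psd_on_def by simp
qed

lemma spectral_cong:
  assumes "\<And>x y. x \<in> I \<Longrightarrow> y \<in> I \<Longrightarrow> A x y = B x y"
  shows "spectral I J \<mu> v A \<longleftrightarrow> spectral I J \<mu> v B"
  unfolding spectral_def using assms by simp

lemma sesq_spectral:
  assumes "spectral I J \<mu> v A"
  shows "sesq I A u w = (\<Sum>j\<in>J. of_real (\<mu> j) * ip I u (v j) * ip I (v j) w)"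
proof -
  have "sesq I A u w = (\<Sum>x\<in>I. \<Sum>y\<in>I. \<Sum>j\<in>J. of_real (\<mu> j) * (cnj (u x) * v j x) * (cnj (v j y) * w y))"
    unfolding sesq_def using assms unfolding spectral_def
    by (intro sum.cong refl) (auto simp: sum_distrib_left sum_distrib_right mult_ac intro!: sum.cong)
  also have "\<dots> = (\<Sum>x\<in>I. \<Sum>j\<in>J. \<Sum>y\<in>I. of_real (\<mu> j) * (cnj (u x) * v j x) * (cnj (v j y) * w y))"
    by (subst (2) sum.swap) simp
  also have "\<dots> = (\<Sum>j\<in>J. \<Sum>x\<in>I. \<Sum>y\<in>I. of_real (\<mu> j) * (cnj (u x) * v j x) * (cnj (v j y) * w y))"
    by (rule sum.swap)
  finally show ?thesis unfolding ip_def by (simp add: sum_distrib_left sum_distrib_right mult_ac)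
qed

lemma ip_mult_cnj: "ip I u v * ip I v u = of_real ((cmod (ip I u v))\<^sup>2)"
  by (metis cnj_ip complex_norm_square of_real_power)

lemma quad_spectral:
  assumes "spectral I J \<mu> v A"
  shows "sesq I A u u = of_real (\<Sum>j\<in>J. \<mu> j * (cmod (ip I u (v j)))\<^sup>2)"
  unfolding sesq_spectral[OF assms] by (simp add: mult.assoc ip_mult_cnj del: of_real_power)

lemma quad_eigenvector:
  assumes d: "spectral I J \<mu> v A" and j: "j \<in> J"
  shows "sesq I A (v j) (v j) = of_real (\<mu> j)"
proof -
  have "sesq I A (v j) (v j) = of_real (\<Sum>i\<in>J. if i = j then \<mu> i else 0)"
    unfolding quad_spectral[OF d] using d j unfolding spectral_def orthonormal_def
    by (intro arg_cong[where f = of_real] sum.cong refl) auto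
  then show ?thesis using d j unfolding spectral_def by simp
qed

lemma psd_on_of_spectral:
  assumes "spectral I J \<mu> v A" "\<And>j. j \<in> J \<Longrightarrow> 0 \<le> \<mu> j"
  shows "psd_on I A"
  unfolding psd_on_def quad_spectral[OF assms(1)]
  using assms(2) by (auto simp: less_eq_complex_def intro!: sum_nonneg)

lemma hermitian_of_spectral:
  assumes "spectral I J \<mu> v A" "x \<in> I" "y \<in> I"
  shows "A y x = cnj (A x y)"
  using assms unfolding spectral_def by (simp add: mult_ac)

text \<open>Polarisation: the form is real on the vectors \<open>c e_x + d e_y\<close>, and the four
  choices of \<open>(c, d)\<close> at the end determine the off-diagonal entries.\<close>

lemma psd_on_hermitian:
  assumes fin: "finite I" and p: "psd_on I A" and x: "x \<in> I" and y: "y \<in> I"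
  shows "A y x = cnj (A x y)"
proof -
  have *: "0 \<le> cnj c * (A x x * c + A x y * d) + cnj d * (A y x * c + A y y * d)" for c d
  proof -
    \<comment> \<open>As a sum of two terms the test vector also covers
      \<open>x = y\<close>.\<close>
    define u where "u z = (if z = x then c else 0) + (if z = y then d else 0)" for z
    have "sesq I A u u = (\<Sum>p\<in>I. cnj (u p) * (\<Sum>q\<in>I. (if q = x then A p q * c else 0) + (if q = y then A p q * d else 0)))"
      unfolding sesq_def sum_distrib_left by (intro sum.cong refl) (auto simp: u_def algebra_simps)
    also have "\<dots> = (\<Sum>p\<in>I. cnj (u p) * (A p x * c + A p y * d))"
      using fin x y by (simp add: sum.distrib)
    also have "\<dots> = (\<Sum>p\<in>I. (if p = x then cnj c * (A p x * c + A p y * d) else 0)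
        + (if p = y then cnj d * (A p x * c + A p y * d) else 0))"
      by (intro sum.cong refl) (auto simp: u_def algebra_simps)
    also have "\<dots> = cnj c * (A x x * c + A x y * d) + cnj d * (A y x * c + A y y * d)"
      using fin x y by (simp add: sum.distrib)
    finally show ?thesis using p unfolding psd_on_def by metis
  qed
  show ?thesis
    using *[of 1 0] *[of 0 1] *[of 1 1] *[of 1 \<i>] by (simp add: less_eq_complex_def complex_eq_iff)
qed

lemma psd_on_spectral:
  assumes fin: "finite I" and p: "psd_on I A"
  shows "\<exists>\<mu> v. spectral I I \<mu> v A \<and> complete_on I I v \<and> (\<forall>j\<in>I. 0 \<le> \<mu> j)"
proof -
  obtain \<mu> v where d: "spectral I I \<mu> v A" and c: "complete_on I I v"
    using spectral_theorem[OF fin, of A] psd_on_hermitian[OF fin p] by blast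
  have "0 \<le> \<mu> j" if j: "j \<in> I" for j
    using p quad_eigenvector[OF d j] unfolding psd_on_def
    by (metis less_eq_complex_def Re_complex_of_real zero_complex.sel(1))
  then show ?thesis using d c by blast
qed

text \<open>Evaluating \<open>sesq I A (w k) (v j)\<close> in both decompositions gives
  \<open>\<mu> j * ip = \<nu> k * ip\<close>, so eigenvectors to different eigenvalues are
  orthogonal. An eigenvector with nonzero eigenvalue has norm 1 also in terms of the other family,
  although that family may be incomplete.\<close>

lemma spectral_overlap:
  assumes 1: "spectral I J \<mu> v A" and 2: "spectral I K \<nu> w A" and j: "j \<in> J"
  shows "k \<in> K \<Longrightarrow> ip I (w k) (v j) \<noteq> 0 \<Longrightarrow> \<mu> j = \<nu> k"
    and "\<mu> j \<noteq> 0 \<Longrightarrow> (\<Sum>k\<in>K. (cmod (ip I (v j) (w k)))\<^sup>2) = 1"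
proof -
  have oj: "ip I (v i) (v j) = (if i = j then 1 else 0)" if "i \<in> J" for i
    using 1 that j unfolding spectral_def orthonormal_def by blast
  have ok: "ip I (w k) (w i) = (if i = k then 1 else 0)" if "i \<in> K" "k \<in> K" for i k
    using 2 that unfolding spectral_def orthonormal_def by auto
  have fin: "finite J" "finite K" using 1 2 unfolding spectral_def by auto
  have Av: "sesq I A u (v j) = of_real (\<mu> j) * ip I u (v j)" for u
  proof -
    have "sesq I A u (v j) = (\<Sum>i\<in>J. if i = j then of_real (\<mu> i) * ip I u (v i) else 0)"
      unfolding sesq_spectral[OF 1] using oj by (intro sum.cong refl) simp
    then show ?thesis using fin j by simp
  qed
  have eq: "\<mu> j = \<nu> k" if k: "k \<in> K" and "ip I (w k) (v j) \<noteq> 0" for k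
  proof -
    have "sesq I A (w k) (v j) = (\<Sum>i\<in>K. if i = k then of_real (\<nu> i) * ip I (w i) (v j) else 0)"
      unfolding sesq_spectral[OF 2] using ok k by (intro sum.cong refl) simp
    also have "\<dots> = of_real (\<nu> k) * ip I (w k) (v j)" using fin k by simp
    finally show ?thesis using Av[of "w k"] that(2) by simp
  qed
  then show "k \<in> K \<Longrightarrow> ip I (w k) (v j) \<noteq> 0 \<Longrightarrow> \<mu> j = \<nu> k" by blast
  have "of_real (\<mu> j) = sesq I A (v j) (v j)" using Av[of "v j"] oj[OF j] by simp
  also have "\<dots> = of_real (\<Sum>k\<in>K. \<nu> k * (cmod (ip I (v j) (w k)))\<^sup>2)"
    by (rule quad_spectral[OF 2])
  also have "(\<Sum>k\<in>K. \<nu> k * (cmod (ip I (v j) (w k)))\<^sup>2) = (\<Sum>k\<in>K. \<mu> j * (cmod (ip I (v j) (w k)))\<^sup>2)"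
    using eq cnj_ip[of I "v j"] by (intro sum.cong refl) (metis complex_mod_cnj mult_eq_0_iff norm_eq_zero power_zero_numeral)
  also have "\<dots> = \<mu> j * (\<Sum>k\<in>K. (cmod (ip I (v j) (w k)))\<^sup>2)" by (simp add: sum_distrib_left)
  finally show "\<mu> j \<noteq> 0 \<Longrightarrow> (\<Sum>k\<in>K. (cmod (ip I (v j) (w k)))\<^sup>2) = 1"
    by (simp only: of_real_eq_iff) simp
qed

text \<open>The squared overlaps \<open>W\<close> vanish unless the two eigenvalues agree, and their
  row and column sums are 1 wherever the eigenvalue is nonzero; so both sides equal the doubly
  indexed sum. The condition \<open>f 0 = 0\<close> absorbs the kernel, of which the two families
  may contain different parts.\<close>

lemma spectral_unique:
  fixes f :: "real \<Rightarrow> real"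
  assumes 1: "spectral I J \<mu> v A" and 2: "spectral I K \<nu> w A" and f: "f 0 = 0"
  shows "(\<Sum>j\<in>J. f (\<mu> j)) = (\<Sum>k\<in>K. f (\<nu> k))"
proof -
  define W where "W j k = (cmod (ip I (v j) (w k)))\<^sup>2" for j k
  have W': "W j k = (cmod (ip I (w k) (v j)))\<^sup>2" for j k
    unfolding W_def by (metis cnj_ip complex_mod_cnj)
  have "(\<Sum>j\<in>J. f (\<mu> j)) = (\<Sum>j\<in>J. \<Sum>k\<in>K. W j k * f (\<mu> j))"
    using spectral_overlap(2)[OF 1 2] f unfolding W_def sum_distrib_right[symmetric]
    by (intro sum.cong refl) (metis mult_1 mult_zero_right)
  also have "\<dots> = (\<Sum>j\<in>J. \<Sum>k\<in>K. W j k * f (\<nu> k))"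
    using spectral_overlap(1)[OF 1 2] by (intro sum.cong refl) (metis W' mult_zero_left norm_zero power_zero_numeral)
  also have "\<dots> = (\<Sum>k\<in>K. \<Sum>j\<in>J. W j k * f (\<nu> k))" by (rule sum.swap)
  also have "\<dots> = (\<Sum>k\<in>K. f (\<nu> k))"
    using spectral_overlap(2)[OF 2 1] f unfolding W' sum_distrib_right[symmetric]
    by (intro sum.cong refl) (metis mult_1 mult_zero_right)
  finally show ?thesis .
qed

text \<open>A choice among the eigendecompositions indexed by \<open>I\<close>; by
  \<open>entropy_on_eq\<close> every decomposition, also an incomplete one, gives the same
  value.\<close>

definition entropy_on :: "'i set \<Rightarrow> ('i \<Rightarrow> 'i \<Rightarrow> complex) \<Rightarrow> real" where
  "entropy_on I A = (SOME h. \<exists>\<mu> v. spectral I I \<mu> v A \<and> h = (\<Sum>j\<in>I. eta (\<mu> j)))"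

lemma entropy_on_cong:
  assumes "\<And>x y. x \<in> I \<Longrightarrow> y \<in> I \<Longrightarrow> A x y = B x y"
  shows "entropy_on I A = entropy_on I B"
proof -
  have "spectral I I \<mu> v A = spectral I I \<mu> v B" for \<mu> v by (rule spectral_cong) (rule assms)
  then show ?thesis unfolding entropy_on_def by simp
qed

lemma entropy_on_eq:
  assumes fin: "finite I" and d: "spectral I J \<mu> v A"
  shows "entropy_on I A = (\<Sum>j\<in>J. eta (\<mu> j))"
proof -
  have "\<exists>h \<mu> v. spectral I I \<mu> v A \<and> h = (\<Sum>j\<in>I. eta (\<mu> j))"
    using spectral_theorem[OF fin, of A] hermitian_of_spectral[OF d] by blast
  then have "\<exists>\<mu> v. spectral I I \<mu> v A \<and> entropy_on I A = (\<Sum>j\<in>I. eta (\<mu> j))"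
    unfolding entropy_on_def by (rule someI_ex)
  then obtain \<nu> w where "spectral I I \<nu> w A" "entropy_on I A = (\<Sum>j\<in>I. eta (\<nu> j))" by blast
  then show ?thesis using spectral_unique[OF d, of I \<nu> w eta] by simp
qed

lemma trace_on_eq:
  assumes "spectral I J \<mu> v A"
  shows "trace_on I A = (\<Sum>j\<in>J. \<mu> j)"
proof -
  have "(\<Sum>x\<in>I. A x x) = (\<Sum>x\<in>I. \<Sum>j\<in>J. of_real (\<mu> j) * v j x * cnj (v j x))"
    using assms unfolding spectral_def by simp
  also have "\<dots> = (\<Sum>j\<in>J. of_real (\<mu> j) * ip I (v j) (v j))"
    unfolding ip_def by (subst sum.swap) (simp add: sum_distrib_left mult_ac)
  also have "\<dots> = (\<Sum>j\<in>J. of_real (\<mu> j))"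
    using assms unfolding spectral_def orthonormal_def by simp
  finally show ?thesis unfolding trace_on_def by simp
qed

lemma trace_on_nonneg:
  assumes "finite I" "psd_on I A"
  shows "0 \<le> trace_on I A"
proof -
  obtain \<mu> v where "spectral I I \<mu> v A" "\<forall>j\<in>I. 0 \<le> \<mu> j" using psd_on_spectral[OF assms] by blast
  then show ?thesis using trace_on_eq by (metis sum_nonneg)
qed

lemma eta_mult: "0 \<le> c \<Longrightarrow> 0 \<le> t \<Longrightarrow> eta (c * t) = c * eta t + eta c * t"
  unfolding eta_def by (cases "c = 0 \<or> t = 0") (auto simp: log_mult algebra_simps)

lemma psd_on_scale:
  assumes "psd_on I A" "0 \<le> c"
  shows "psd_on I (\<lambda>x y. of_real c * A x y)"
proof -
  have "sesq I (\<lambda>x y. of_real c * A x y) u u = of_real c * sesq I A u u" for u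
    unfolding sesq_def by (simp add: sum_distrib_left mult_ac)
  then show ?thesis using assms unfolding psd_on_def by (simp add: less_eq_complex_def)
qed

lemma entropy_on_scale:
  assumes fin: "finite I" and p: "psd_on I A" and c: "0 \<le> c"
  shows "entropy_on I (\<lambda>x y. of_real c * A x y) = c * entropy_on I A + eta c * trace_on I A"
proof -
  obtain \<mu> v where d: "spectral I I \<mu> v A" and pos: "\<forall>j\<in>I. 0 \<le> \<mu> j"
    using psd_on_spectral[OF fin p] by blast
  have "spectral I I (\<lambda>j. c * \<mu> j) v (\<lambda>x y. of_real c * A x y)"
    using d unfolding spectral_def by (simp add: sum_distrib_left mult_ac)
  then have "entropy_on I (\<lambda>x y. of_real c * A x y) = (\<Sum>j\<in>I. eta (c * \<mu> j))" by (rule entropy_on_eq[OF fin])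
  also have "\<dots> = (\<Sum>j\<in>I. c * eta (\<mu> j) + eta c * \<mu> j)"
    using pos c by (intro sum.cong refl eta_mult) auto
  finally show ?thesis unfolding entropy_on_eq[OF fin d] trace_on_eq[OF d] by (simp add: sum.distrib sum_distrib_left)
qed

section \<open>Sums, restrictions and block decompositions of positive operators\<close>

lemma sesq_sum: "sesq I (\<lambda>x y. \<Sum>k\<in>K. A k x y) u w = (\<Sum>k\<in>K. sesq I (A k) u w)"
proof -
  have "sesq I (\<lambda>x y. \<Sum>k\<in>K. A k x y) u w = (\<Sum>x\<in>I. \<Sum>y\<in>I. \<Sum>k\<in>K. cnj (u x) * A k x y * w y)"
    unfolding sesq_def by (simp add: sum_distrib_left sum_distrib_right)
  also have "\<dots> = (\<Sum>x\<in>I. \<Sum>k\<in>K. \<Sum>y\<in>I. cnj (u x) * A k x y * w y)"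
    by (subst (2) sum.swap) simp
  finally show ?thesis unfolding sesq_def by (subst (asm) sum.swap)
qed

lemma psd_on_sum: "(\<And>k. k \<in> K \<Longrightarrow> psd_on I (A k)) \<Longrightarrow> psd_on I (\<lambda>x y. \<Sum>k\<in>K. A k x y)"
  unfolding psd_on_def sesq_sum by (simp add: sum_nonneg)

text \<open>\<open>A\<close> is tested on the push-forward \<open>w\<close> of \<open>u\<close>
  along \<open>g\<close>, which adds the values of \<open>u\<close> with the same image. Both
  restriction to a subset and change of index type are instances.\<close>

lemma psd_on_reindex:
  assumes fin: "finite I" "finite J" and p: "psd_on I A" and g: "\<And>j. j \<in> J \<Longrightarrow> g j \<in> I"
  shows "psd_on J (\<lambda>x y. A (g x) (g y))"
  unfolding psd_on_def
proof
  fix u :: "_ \<Rightarrow> complex"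
  define w where "w x = (\<Sum>j\<in>J. if g j = x then u j else 0)" for x
  have *: "(\<Sum>x\<in>I. f x * (\<Sum>j\<in>J. if g j = x then h j else 0)) = (\<Sum>j\<in>J. f (g j) * h j)"
    for f :: "_ \<Rightarrow> complex" and h
  proof -
    have "(\<Sum>x\<in>I. f x * (\<Sum>j\<in>J. if g j = x then h j else 0))
        = (\<Sum>x\<in>I. \<Sum>j\<in>J. if g j = x then f (g j) * h j else 0)"
      unfolding sum_distrib_left by (intro sum.cong refl) auto
    also have "\<dots> = (\<Sum>j\<in>J. \<Sum>x\<in>I. if g j = x then f (g j) * h j else 0)" by (rule sum.swap)
    also have "\<dots> = (\<Sum>j\<in>J. f (g j) * h j)" using fin g by (intro sum.cong refl) simp
    finally show ?thesis .
  qed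
  have cw: "cnj (w x) = (\<Sum>j\<in>J. if g j = x then cnj (u j) else 0)" for x
    unfolding w_def cnj_sum by (intro sum.cong refl) auto
  have "sesq I A w w = (\<Sum>x\<in>I. (\<Sum>y\<in>I. A x y * w y) * cnj (w x))"
    unfolding sesq_def by (simp add: sum_distrib_left sum_distrib_right mult_ac)
  also have "\<dots> = (\<Sum>j\<in>J. (\<Sum>y\<in>I. A (g j) y * w y) * cnj (u j))"
    unfolding cw by (rule *)
  also have "\<dots> = (\<Sum>j\<in>J. (\<Sum>i\<in>J. A (g j) (g i) * u i) * cnj (u j))"
    unfolding w_def by (subst *) (rule refl)
  also have "\<dots> = sesq J (\<lambda>x y. A (g x) (g y)) u u"
    unfolding sesq_def by (simp add: sum_distrib_left sum_distrib_right mult_ac)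
  finally show "0 \<le> sesq J (\<lambda>x y. A (g x) (g y)) u u" using p unfolding psd_on_def by metis
qed

text \<open>The eigenvectors of the blocks, extended by zero along \<open>\<phi>\<close>, form an
  orthonormal family with the eigenvalues of all blocks. It is complete only if
  \<open>\<phi>\<close> reaches all of \<open>I\<close>; missed indices lie in the kernel of
  \<open>B\<close> and contribute \<open>eta 0 = 0\<close>.\<close>

lemma block_spectral:
  fixes \<phi> :: "'t \<Rightarrow> 's \<Rightarrow> 'i"
  assumes fin: "finite I" "finite T" "\<And>t. t \<in> T \<Longrightarrow> finite (S t)"
    and p: "\<And>t. t \<in> T \<Longrightarrow> psd_on (S t) (A t)"
    and into: "\<And>t s. t \<in> T \<Longrightarrow> s \<in> S t \<Longrightarrow> \<phi> t s \<in> I"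
    and inj: "\<And>t s t' s'. t \<in> T \<Longrightarrow> s \<in> S t \<Longrightarrow> t' \<in> T \<Longrightarrow> s' \<in> S t' \<Longrightarrow> \<phi> t s = \<phi> t' s' \<Longrightarrow> t = t' \<and> s = s'"
    and entries: "\<And>t s t' s'. t \<in> T \<Longrightarrow> s \<in> S t \<Longrightarrow> t' \<in> T \<Longrightarrow> s' \<in> S t' \<Longrightarrow>
      B (\<phi> t s) (\<phi> t' s') = (if t = t' then A t s s' else 0)"
    and supp: "\<And>x y. x \<in> I \<Longrightarrow> y \<in> I \<Longrightarrow> B x y \<noteq> 0 \<Longrightarrow>
      (\<exists>t\<in>T. \<exists>s\<in>S t. x = \<phi> t s) \<and> (\<exists>t\<in>T. \<exists>s\<in>S t. y = \<phi> t s)"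
  shows "psd_on I B \<and> entropy_on I B = (\<Sum>t\<in>T. entropy_on (S t) (A t))"
proof -
  have "\<forall>t\<in>T. \<exists>\<mu> v. spectral (S t) (S t) \<mu> v (A t) \<and> (\<forall>j\<in>S t. 0 \<le> \<mu> j)"
  proof
    fix t assume t: "t \<in> T"
    show "\<exists>\<mu> v. spectral (S t) (S t) \<mu> v (A t) \<and> (\<forall>j\<in>S t. 0 \<le> \<mu> j)"
      using psd_on_spectral[OF fin(3)[OF t] p[OF t]] by blast
  qed
  from bchoice[OF this] obtain \<mu> where
    "\<forall>t\<in>T. \<exists>v. spectral (S t) (S t) (\<mu> t) v (A t) \<and> (\<forall>j\<in>S t. 0 \<le> \<mu> t j)" by blast
  from bchoice[OF this] obtain v where
    "\<forall>t\<in>T. spectral (S t) (S t) (\<mu> t) (v t) (A t) \<and> (\<forall>j\<in>S t. 0 \<le> \<mu> t j)" by blast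
  then have d: "\<And>t. t \<in> T \<Longrightarrow> spectral (S t) (S t) (\<mu> t) (v t) (A t)"
    and pos: "\<And>t j. t \<in> T \<Longrightarrow> j \<in> S t \<Longrightarrow> 0 \<le> \<mu> t j" by auto
  define P where "P = Sigma T S"
  have finP: "finite P" using fin unfolding P_def by auto
  define \<psi> where "\<psi> = (\<lambda>(t, s). \<phi> t s)"
  have injP: "inj_on \<psi> P" unfolding inj_on_def P_def \<psi>_def using inj by auto
  \<comment> \<open>At most one term of this sum is nonzero; the sum stands for an inverse of the
    injection \<open>\<psi>\<close> and is 0 off its image.\<close>
  define V where "V q x = (\<Sum>r\<in>P. if \<psi> r = x \<and> fst r = fst q then v (fst q) (snd q) (snd r) else 0)" for q x
  have V1: "V (t, j) (\<phi> t' s) = (if t = t' then v t j s else 0)" if "t' \<in> T" "s \<in> S t'" for t j t' s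
  proof -
    have "V (t, j) (\<phi> t' s) = (\<Sum>r\<in>P. if r = (t', s) then (if t = t' then v t j s else 0) else 0)"
      unfolding V_def using that inj by (intro sum.cong refl) (auto simp: P_def \<psi>_def)
    then show ?thesis using that finP by (simp add: P_def)
  qed
  have V0: "V q x = 0" if "\<not> (\<exists>t\<in>T. \<exists>s\<in>S t. x = \<phi> t s)" for q x
    unfolding V_def using that by (intro sum.neutral) (auto simp: P_def \<psi>_def)
  have Isum: "(\<Sum>x\<in>I. f x) = (\<Sum>t\<in>T. \<Sum>s\<in>S t. f (\<phi> t s))"
    if "\<And>x. x \<in> I \<Longrightarrow> \<not> (\<exists>t\<in>T. \<exists>s\<in>S t. x = \<phi> t s) \<Longrightarrow> f x = 0" for f :: "'i \<Rightarrow> complex"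
  proof -
    have "(\<Sum>x\<in>I. f x) = (\<Sum>x\<in>\<psi> ` P. f x)"
    proof (rule sum.mono_neutral_right)
      show "\<psi> ` P \<subseteq> I" using into by (auto simp: P_def \<psi>_def)
      show "\<forall>x\<in>I - \<psi> ` P. f x = 0" using that by (auto simp: P_def \<psi>_def image_iff)
    qed (use fin in simp)
    also have "\<dots> = (\<Sum>r\<in>P. f (\<psi> r))" using injP by (simp add: sum.reindex)
    also have "\<dots> = (\<Sum>t\<in>T. \<Sum>s\<in>S t. f (\<phi> t s))"
      unfolding P_def using fin by (subst sum.Sigma) (auto simp: \<psi>_def intro!: sum.cong)
    finally show ?thesis .
  qed
  have "ip I (V q) (V r) = (if q = r then 1 else 0)" if q: "q \<in> P" and r: "r \<in> P" for q r
  proof -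
    obtain t j where tj: "q = (t, j)" "t \<in> T" "j \<in> S t" using q unfolding P_def by auto
    obtain t' j' where tj': "r = (t', j')" "t' \<in> T" "j' \<in> S t'" using r unfolding P_def by auto
    have "ip I (V q) (V r) = (\<Sum>t0\<in>T. \<Sum>s\<in>S t0. cnj (V q (\<phi> t0 s)) * V r (\<phi> t0 s))"
      unfolding ip_def using V0 by (intro Isum) simp
    also have "\<dots> = (\<Sum>t0\<in>T. if t0 = t then (\<Sum>s\<in>S t. cnj (V q (\<phi> t s)) * V r (\<phi> t s)) else 0)"
      using V1 tj by (intro sum.cong refl) (auto intro!: sum.neutral)
    also have "\<dots> = (\<Sum>s\<in>S t. cnj (V q (\<phi> t s)) * V r (\<phi> t s))"
      using fin tj by simp
    also have "\<dots> = (\<Sum>s\<in>S t. if t = t' then cnj (v t j s) * v t j' s else 0)"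
      unfolding tj(1) tj'(1) using V1 tj(2) by (intro sum.cong refl) simp
    also have "\<dots> = (if t = t' then ip (S t) (v t j) (v t j') else 0)"
      by (simp add: ip_def)
    also have "\<dots> = (if q = r then 1 else 0)"
      using d[OF tj(2)] tj tj' unfolding spectral_def orthonormal_def by auto
    finally show ?thesis .
  qed
  moreover have "B x y = (\<Sum>q\<in>P. of_real (\<mu> (fst q) (snd q)) * V q x * cnj (V q y))" if xy: "x \<in> I" "y \<in> I" for x y
  proof (cases "(\<exists>t\<in>T. \<exists>s\<in>S t. x = \<phi> t s) \<and> (\<exists>t\<in>T. \<exists>s\<in>S t. y = \<phi> t s)")
    case True
    then obtain t s t' s' where a: "t \<in> T" "s \<in> S t" "x = \<phi> t s" "t' \<in> T" "s' \<in> S t'" "y = \<phi> t' s'" by blast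
    have "(\<Sum>q\<in>P. of_real (\<mu> (fst q) (snd q)) * V q x * cnj (V q y))
       = (\<Sum>t0\<in>T. \<Sum>j\<in>S t0. of_real (\<mu> t0 j) * V (t0, j) x * cnj (V (t0, j) y))"
      unfolding P_def using fin by (subst sum.Sigma) (auto simp: case_prod_beta)
    also have "\<dots> = (\<Sum>t0\<in>T. if t0 = t then (\<Sum>j\<in>S t. if t = t' then of_real (\<mu> t j) * v t j s * cnj (v t j s') else 0) else 0)"
      unfolding a(3,6) using V1 a by (intro sum.cong refl) (cases "t = t'"; auto)
    also have "\<dots> = (if t = t' then A t s s' else 0)"
      using fin a d[OF a(1)] unfolding spectral_def by (cases "t = t'") auto
    finally show ?thesis using entries a by simp
  next
    case False
    then have "B x y = 0" using supp xy by blast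
    moreover have "V q x = 0 \<or> V q y = 0" for q using False V0 by blast
    ultimately show ?thesis by (metis (no_types, lifting) complex_cnj_zero mult_zero_left mult_zero_right sum.neutral)
  qed
  ultimately have dB: "spectral I P (\<lambda>q. \<mu> (fst q) (snd q)) V B"
    unfolding spectral_def orthonormal_def using finP by blast
  have "entropy_on I B = (\<Sum>q\<in>P. eta (\<mu> (fst q) (snd q)))" by (rule entropy_on_eq[OF fin(1) dB])
  also have "\<dots> = (\<Sum>t\<in>T. \<Sum>j\<in>S t. eta (\<mu> t j))"
    unfolding P_def using fin by (subst sum.Sigma) (auto simp: case_prod_beta)
  also have "\<dots> = (\<Sum>t\<in>T. entropy_on (S t) (A t))"
    using entropy_on_eq[OF fin(3) d] by (intro sum.cong refl) simp
  finally show ?thesis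
    using psd_on_of_spectral[OF dB] pos by (auto simp: P_def)
qed

lemmas psd_on_block = block_spectral[THEN conjunct1]
lemmas entropy_on_block = block_spectral[THEN conjunct2]

section \<open>Comparison with positivity and entropy of matrices\<close>

lemma psd_iff_psd_on:
  "psd d M \<longleftrightarrow> M \<in> carrier_mat d d \<and> psd_on {..<d} (\<lambda>i j. M $$ (i, j))"
proof (cases "M \<in> carrier_mat d d")
  case M: True
  have q: "conjugate v \<bullet> (M *\<^sub>v v) = sesq {..<d} (\<lambda>i j. M $$ (i, j)) (\<lambda>i. v $ i) (\<lambda>i. v $ i)"
    if "v \<in> carrier_vec d" for v
    using that M unfolding sesq_def scalar_prod_def lessThan_atLeast0
    by (intro sum.cong) (auto simp: scalar_prod_def sum_distrib_left mult_ac intro!: sum.cong)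
  have v: "\<exists>v\<in>carrier_vec d. \<forall>i<d. v $ i = u i" for u :: "nat \<Rightarrow> complex"
    by (intro bexI[of _ "vec d u"]) auto
  have s: "sesq {..<d} (\<lambda>i j. M $$ (i, j)) u u = sesq {..<d} (\<lambda>i j. M $$ (i, j)) w w"
    if "\<forall>i<d. w i = u i" for u w
    unfolding sesq_def using that by (intro sum.cong) auto
  have "psd d M \<longleftrightarrow> (\<forall>v\<in>carrier_vec d. 0 \<le> conjugate v \<bullet> (M *\<^sub>v v))"
    unfolding psd_def using M by (auto simp: less_eq_complex_def)
  also have "\<dots> \<longleftrightarrow> psd_on {..<d} (\<lambda>i j. M $$ (i, j))"
    unfolding psd_on_def
  proof (intro iffI allI ballI)
    fix u :: "nat \<Rightarrow> complex" assume *: "\<forall>v\<in>carrier_vec d. 0 \<le> conjugate v \<bullet> (M *\<^sub>v v)"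
    obtain w where w: "w \<in> carrier_vec d" "\<forall>i<d. w $ i = u i" using v[of u] by blast
    show "0 \<le> sesq {..<d} (\<lambda>i j. M $$ (i, j)) u u"
      using *[rule_format, OF w(1)] unfolding q[OF w(1)] s[OF w(2)] .
  next
    fix v :: "complex vec" assume "\<forall>u. 0 \<le> sesq {..<d} (\<lambda>i j. M $$ (i, j)) u u" "v \<in> carrier_vec d"
    then show "0 \<le> conjugate v \<bullet> (M *\<^sub>v v)" using q by simp
  qed
  finally show ?thesis using M by simp
qed (auto simp: psd_def)

text \<open>Here completeness of the eigenbasis matters: it makes \<open>U\<close> invertible, so
  that \<open>M\<close> is similar to a diagonal matrix, whose characteristic polynomial displays
  the eigenvalues with their algebraic multiplicities.\<close>

lemma entropy_eq_entropy_on: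
  assumes "psd d M"
  shows "entropy M = entropy_on {..<d} (\<lambda>i j. M $$ (i, j))"
proof -
  have M: "M \<in> carrier_mat d d" and p: "psd_on {..<d} (\<lambda>i j. M $$ (i, j))"
    using assms psd_iff_psd_on by auto
  obtain \<mu> v where dec: "spectral {..<d} {..<d} \<mu> v (\<lambda>i j. M $$ (i, j))" and com: "complete_on {..<d} {..<d} v"
    using psd_on_spectral[OF _ p] by blast
  define U where "U = mat d d (\<lambda>(i,j). v j i)"
  define Us where "Us = mat d d (\<lambda>(i,j). cnj (v i j))"
  define D where "D = mat d d (\<lambda>(i,j). if i = j then complex_of_real (\<mu> i) else 0)"
  have car: "U \<in> carrier_mat d d" "Us \<in> carrier_mat d d" "D \<in> carrier_mat d d"
    by (auto simp: U_def Us_def D_def)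
  have 1: "U * Us = 1\<^sub>m d"
    using com unfolding complete_on_def
    by (intro eq_matI) (auto simp: U_def Us_def scalar_prod_def lessThan_atLeast0)
  have 2: "Us * U = 1\<^sub>m d"
    using dec unfolding spectral_def orthonormal_def ip_def
    by (intro eq_matI) (auto simp: U_def Us_def scalar_prod_def lessThan_atLeast0)
  have UD: "U * D = mat d d (\<lambda>(i,j). v j i * of_real (\<mu> j))"
  proof (rule eq_matI)
    fix i j assume ij: "i < dim_row (mat d d (\<lambda>(i,j). v j i * complex_of_real (\<mu> j)))"
      "j < dim_col (mat d d (\<lambda>(i,j). v j i * complex_of_real (\<mu> j)))"
    then have "(U * D) $$ (i, j) = (\<Sum>k\<in>{0..<d}. if k = j then v k i * of_real (\<mu> k) else 0)"
      by (simp add: U_def D_def scalar_prod_def if_distrib[of "\<lambda>z. _ * z"] cong: if_cong)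
    then show "(U * D) $$ (i, j) = mat d d (\<lambda>(i,j). v j i * complex_of_real (\<mu> j)) $$ (i, j)"
      using ij by simp
  qed (use car in auto)
  have 3: "M = U * D * Us"
    using dec M unfolding spectral_def UD
    by (intro eq_matI) (auto simp: Us_def scalar_prod_def lessThan_atLeast0 mult_ac)
  have "similar_mat M D"
    unfolding similar_mat_def similar_mat_wit_def using 1 2 3 M car
    by (intro exI[of _ U] exI[of _ Us]) (auto simp: Let_def)
  then have "char_poly M = char_poly D" by (rule char_poly_similar)
  also have "\<dots> = (\<Prod>a\<leftarrow>diag_mat D. [:- a, 1:])"
    by (rule char_poly_upper_triangular[OF car(3)]) (auto simp: D_def)
  also have "\<dots> = (\<Prod>i<d. [:- complex_of_real (\<mu> i), 1:])"
    unfolding diag_mat_def using car(3)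
    by (simp add: comp_def prod.distinct_set_conv_list[symmetric] lessThan_atLeast0)
      (auto simp: D_def intro!: prod.cong)
  finally have "proots (char_poly M) = (\<Sum>i<d. {# complex_of_real (\<mu> i) #})"
    by (simp add: proots_prod)
  moreover have "sum_mset (image_mset f (\<Sum>i<n. {# g i #})) = (\<Sum>i<n. f (g i))"
    for f :: "complex \<Rightarrow> real" and g and n :: nat
    by (induction n) auto
  ultimately show ?thesis
    unfolding entropy_def entropy_on_eq[OF finite_lessThan dec] eta_def by (simp add: sum_negf)
qed

subsection \<open>Joint convexity of the relative entropy\<close>

lemma parseval:
  assumes fin: "finite I" and com: "complete_on I J v"
  shows "(\<Sum>y\<in>I. f y * g y) = (\<Sum>j\<in>J. (\<Sum>y\<in>I. f y * v j y) * (\<Sum>y\<in>I. cnj (v j y) * g y))"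
proof -
  have "(\<Sum>j\<in>J. (\<Sum>y\<in>I. f y * v j y) * (\<Sum>y\<in>I. cnj (v j y) * g y)) =
      (\<Sum>j\<in>J. \<Sum>y\<in>I. \<Sum>z\<in>I. f y * g z * (v j y * cnj (v j z)))"
    unfolding sum_product by (simp add: mult_ac)
  also have "\<dots> = (\<Sum>y\<in>I. \<Sum>j\<in>J. \<Sum>z\<in>I. f y * g z * (v j y * cnj (v j z)))"
    by (rule sum.swap)
  also have "\<dots> = (\<Sum>y\<in>I. \<Sum>z\<in>I. f y * g z * (\<Sum>j\<in>J. v j y * cnj (v j z)))"
    unfolding sum_distrib_left by (subst (2) sum.swap) (rule refl)
  also have "\<dots> = (\<Sum>y\<in>I. \<Sum>z\<in>I. if y = z then f y * g z else 0)"
    using com unfolding complete_on_def by (intro sum.cong refl) simp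
  also have "\<dots> = (\<Sum>y\<in>I. f y * g y)" using fin by (intro sum.cong refl) simp
  finally show ?thesis by simp
qed

text \<open>The quadratic form below is the one whose supremum over \<open>X\<close> is
  \<open>\<langle>A - B, (L\<^sub>A + s R\<^sub>B)\<^sup>-\<^sup>1 (A - B)\<rangle>\<close>, with \<open>L\<^sub>A\<close> and \<open>R\<^sub>B\<close> the left and right multiplication
  operators; it is additive in the pair \<open>(A, B)\<close>.\<close>
definition lform :: "'i set \<Rightarrow> real \<Rightarrow> ('i \<Rightarrow> 'i \<Rightarrow> complex) \<Rightarrow> ('i \<Rightarrow> 'i \<Rightarrow> complex) \<Rightarrow>
    ('i \<Rightarrow> 'i \<Rightarrow> complex) \<Rightarrow> real" where
  "lform I s X A B = 2 * Re (\<Sum>x\<in>I. \<Sum>y\<in>I. cnj (X x y) * (A x y - B x y))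
     - Re (\<Sum>z\<in>I. sesq I A (\<lambda>x. X x z) (\<lambda>x. X x z))
     - s * Re (\<Sum>x\<in>I. sesq I B (\<lambda>y. cnj (X x y)) (\<lambda>y. cnj (X x y)))"

lemma lform_sum:
  "lform I s X (\<lambda>x y. \<Sum>k\<in>K. A k x y) (\<lambda>x y. \<Sum>k\<in>K. B k x y) = (\<Sum>k\<in>K. lform I s X (A k) (B k))"
proof -
  have 1: "(\<Sum>x\<in>I. \<Sum>y\<in>I. cnj (X x y) * ((\<Sum>k\<in>K. A k x y) - (\<Sum>k\<in>K. B k x y)))
      = (\<Sum>k\<in>K. \<Sum>x\<in>I. \<Sum>y\<in>I. cnj (X x y) * (A k x y - B k x y))"
  proof -
    have "(\<Sum>x\<in>I. \<Sum>y\<in>I. cnj (X x y) * ((\<Sum>k\<in>K. A k x y) - (\<Sum>k\<in>K. B k x y)))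
       = (\<Sum>x\<in>I. \<Sum>y\<in>I. \<Sum>k\<in>K. cnj (X x y) * (A k x y - B k x y))"
      by (simp add: sum_subtractf[symmetric] sum_distrib_left)
    also have "\<dots> = (\<Sum>x\<in>I. \<Sum>k\<in>K. \<Sum>y\<in>I. cnj (X x y) * (A k x y - B k x y))"
      by (subst (2) sum.swap) simp
    finally show ?thesis by (subst (asm) sum.swap)
  qed
  have 2: "(\<Sum>z\<in>I. \<Sum>k\<in>K. sesq I (C k) (f z) (f z)) = (\<Sum>k\<in>K. \<Sum>z\<in>I. sesq I (C k) (f z) (f z))" for C f
    by (rule sum.swap)
  show ?thesis
    unfolding lform_def sesq_sum 1 2 by (simp add: sum_subtractf sum_distrib_left)
qed

definition coord :: "'i set \<Rightarrow> ('i \<Rightarrow> complex) \<Rightarrow> ('i \<Rightarrow> complex) \<Rightarrow> ('i \<Rightarrow> 'i \<Rightarrow> complex) \<Rightarrow> complex" where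
  "coord I u v X = (\<Sum>x\<in>I. \<Sum>y\<in>I. cnj (u x) * X x y * v y)"

text \<open>The operators \<open>|u i><v j|\<close> diagonalise left multiplication by
  \<open>A\<close> and right multiplication by \<open>B\<close> simultaneously, with eigenvalues
  \<open>a i\<close> and \<open>b j\<close>. In these coordinates the form decouples into scalar
  quadratics, and \<open>A - B\<close> has the coordinates
  \<open>(a i - b j) * ip I (u i) (v j)\<close>.\<close>

lemma lform_coord:
  assumes fin: "finite I"
    and A: "spectral I I a u A" "complete_on I I u" and B: "spectral I I b v B" "complete_on I I v"
  shows "lform I s X A B = (\<Sum>i\<in>I. \<Sum>j\<in>I.
     2 * (a i - b j) * Re (cnj (coord I (u i) (v j) X) * ip I (u i) (v j))
     - (a i + s * b j) * (cmod (coord I (u i) (v j) X))\<^sup>2)"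
proof -
  let ?x = "\<lambda>i j. coord I (u i) (v j) X"
  let ?c = "\<lambda>i j. ip I (u i) (v j)"
  \<comment> \<open>\<open>r\<close> and \<open>t\<close> contract \<open>X\<close> on one side
    only: each term of the form brings in one eigenbasis through the decomposition of
    \<open>A\<close> or \<open>B\<close>, the other through \<open>parseval\<close>.\<close>
  define r where "r i y = (\<Sum>x\<in>I. cnj (u i x) * X x y)" for i y
  define t where "t j x = (\<Sum>y\<in>I. X x y * v j y)" for j x
  have xr: "(\<Sum>y\<in>I. r i y * v j y) = ?x i j" for i j
    unfolding r_def coord_def sum_distrib_right by (rule sum.swap)
  have xt: "(\<Sum>x\<in>I. cnj (u i x) * t j x) = ?x i j" for i j
    unfolding t_def coord_def sum_distrib_left by (simp add: mult.assoc)
  have cxr: "(\<Sum>y\<in>I. cnj (v j y) * cnj (r i y)) = cnj (?x i j)" for i j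
    unfolding xr[symmetric] cnj_sum by (simp add: mult.commute)
  have cxt: "(\<Sum>x\<in>I. cnj (t j x) * u i x) = cnj (?x i j)" for i j
    unfolding xt[symmetric] cnj_sum by (simp add: mult.commute)
  have TA: "(\<Sum>x\<in>I. \<Sum>y\<in>I. cnj (X x y) * A x y) = (\<Sum>i\<in>I. \<Sum>j\<in>I. of_real (a i) * (cnj (?x i j) * ?c i j))"
  proof -
    let ?T = "\<lambda>i x y. of_real (a i) * (cnj (u i y) * (u i x * cnj (X x y)))"
    have "(\<Sum>x\<in>I. \<Sum>y\<in>I. cnj (X x y) * A x y)
        = (\<Sum>x\<in>I. \<Sum>y\<in>I. \<Sum>i\<in>I. ?T i x y)"
      using A(1) unfolding spectral_def by (intro sum.cong refl) (simp add: sum_distrib_left mult_ac)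
    also have "\<dots> = (\<Sum>y\<in>I. \<Sum>x\<in>I. \<Sum>i\<in>I. ?T i x y)"
      by (rule sum.swap)
    also have "\<dots> = (\<Sum>y\<in>I. \<Sum>i\<in>I. \<Sum>x\<in>I. ?T i x y)"
      by (subst (2) sum.swap) simp
    also have "\<dots> = (\<Sum>i\<in>I. \<Sum>y\<in>I. \<Sum>x\<in>I. ?T i x y)"
      by (rule sum.swap)
    also have "\<dots> = (\<Sum>i\<in>I. of_real (a i) * (\<Sum>y\<in>I. cnj (u i y) * cnj (r i y)))"
      unfolding r_def cnj_sum by (simp add: sum_distrib_left)
    also have "\<dots> = (\<Sum>i\<in>I. of_real (a i) * (\<Sum>j\<in>I. ?c i j * cnj (?x i j)))"
    proof (rule sum.cong[OF refl], rule arg_cong2[where f = "(*)", OF refl])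
      fix i
      show "(\<Sum>y\<in>I. cnj (u i y) * cnj (r i y)) = (\<Sum>j\<in>I. ?c i j * cnj (?x i j))"
        by (subst parseval[OF fin B(2)]) (simp only: cxr ip_def)
    qed
    finally show ?thesis by (simp add: sum_distrib_left mult_ac)
  qed
  have TB: "(\<Sum>x\<in>I. \<Sum>y\<in>I. cnj (X x y) * B x y) = (\<Sum>i\<in>I. \<Sum>j\<in>I. of_real (b j) * (cnj (?x i j) * ?c i j))"
  proof -
    let ?T = "\<lambda>j x y. of_real (b j) * (cnj (X x y) * cnj (v j y) * v j x)"
    have "(\<Sum>x\<in>I. \<Sum>y\<in>I. cnj (X x y) * B x y)
        = (\<Sum>x\<in>I. \<Sum>y\<in>I. \<Sum>j\<in>I. ?T j x y)"
      using B(1) unfolding spectral_def by (intro sum.cong refl) (simp add: sum_distrib_left mult_ac)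
    also have "\<dots> = (\<Sum>x\<in>I. \<Sum>j\<in>I. \<Sum>y\<in>I. ?T j x y)"
      by (subst (2) sum.swap) simp
    also have "\<dots> = (\<Sum>j\<in>I. \<Sum>x\<in>I. \<Sum>y\<in>I. ?T j x y)"
      by (rule sum.swap)
    also have "\<dots> = (\<Sum>j\<in>I. of_real (b j) * (\<Sum>x\<in>I. cnj (t j x) * v j x))"
      unfolding t_def cnj_sum by (simp add: sum_distrib_left sum_distrib_right)
    also have "\<dots> = (\<Sum>j\<in>I. of_real (b j) * (\<Sum>i\<in>I. cnj (?x i j) * ?c i j))"
    proof (rule sum.cong[OF refl], rule arg_cong2[where f = "(*)", OF refl])
      fix j
      show "(\<Sum>x\<in>I. cnj (t j x) * v j x) = (\<Sum>i\<in>I. cnj (?x i j) * ?c i j)"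
        by (subst parseval[OF fin A(2)]) (simp only: cxt ip_def)
    qed
    also have "\<dots> = (\<Sum>j\<in>I. \<Sum>i\<in>I. of_real (b j) * (cnj (?x i j) * ?c i j))"
      by (simp add: sum_distrib_left)
    finally show ?thesis by (subst (asm) (2) sum.swap)
  qed
  have QA: "(\<Sum>z\<in>I. sesq I A (\<lambda>x. X x z) (\<lambda>x. X x z)) = of_real (\<Sum>i\<in>I. \<Sum>j\<in>I. a i * (cmod (?x i j))\<^sup>2)"
  proof -
    have "(\<Sum>z\<in>I. sesq I A (\<lambda>x. X x z) (\<lambda>x. X x z)) = (\<Sum>z\<in>I. \<Sum>i\<in>I. of_real (a i) * (r i z * cnj (r i z)))"
      unfolding sesq_spectral[OF A(1)] r_def cnj_sum ip_def by (simp add: mult_ac)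
    also have "\<dots> = (\<Sum>i\<in>I. of_real (a i) * (\<Sum>z\<in>I. r i z * cnj (r i z)))"
      by (subst sum.swap) (simp add: sum_distrib_left)
    also have "\<dots> = (\<Sum>i\<in>I. of_real (a i) * (\<Sum>j\<in>I. ?x i j * cnj (?x i j)))"
    proof (rule sum.cong[OF refl], rule arg_cong2[where f = "(*)", OF refl])
      fix i
      show "(\<Sum>z\<in>I. r i z * cnj (r i z)) = (\<Sum>j\<in>I. ?x i j * cnj (?x i j))"
        by (subst parseval[OF fin B(2)]) (simp only: cxr xr)
    qed
    finally show ?thesis
      by (simp add: sum_distrib_left complex_norm_square[symmetric] del: of_real_power)
  qed
  have QB: "(\<Sum>x\<in>I. sesq I B (\<lambda>y. cnj (X x y)) (\<lambda>y. cnj (X x y))) = of_real (\<Sum>i\<in>I. \<Sum>j\<in>I. b j * (cmod (?x i j))\<^sup>2)"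
  proof -
    have "(\<Sum>x\<in>I. sesq I B (\<lambda>y. cnj (X x y)) (\<lambda>y. cnj (X x y)))
        = (\<Sum>x\<in>I. \<Sum>j\<in>I. of_real (b j) * (cnj (t j x) * t j x))"
      unfolding sesq_spectral[OF B(1)] t_def cnj_sum ip_def by (simp add: mult_ac)
    also have "\<dots> = (\<Sum>j\<in>I. of_real (b j) * (\<Sum>x\<in>I. cnj (t j x) * t j x))"
      by (subst sum.swap) (simp add: sum_distrib_left)
    also have "\<dots> = (\<Sum>j\<in>I. of_real (b j) * (\<Sum>i\<in>I. cnj (?x i j) * ?x i j))"
    proof (rule sum.cong[OF refl], rule arg_cong2[where f = "(*)", OF refl])
      fix j
      show "(\<Sum>x\<in>I. cnj (t j x) * t j x) = (\<Sum>i\<in>I. cnj (?x i j) * ?x i j)"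
        by (subst parseval[OF fin A(2)]) (simp only: cxt xt)
    qed
    also have "\<dots> = of_real (\<Sum>j\<in>I. \<Sum>i\<in>I. b j * (cmod (?x i j))\<^sup>2)"
      by (simp add: sum_distrib_left mult.commute[of "cnj _"] complex_norm_square[symmetric] del: of_real_power)
    finally show ?thesis by (subst sum.swap)
  qed
  have Re_mult: "Re (complex_of_real q * z) = q * Re z" for q z by simp
  have "lform I s X A B = 2 * Re ((\<Sum>x\<in>I. \<Sum>y\<in>I. cnj (X x y) * A x y) - (\<Sum>x\<in>I. \<Sum>y\<in>I. cnj (X x y) * B x y))
     - (\<Sum>i\<in>I. \<Sum>j\<in>I. a i * (cmod (?x i j))\<^sup>2) - s * (\<Sum>i\<in>I. \<Sum>j\<in>I. b j * (cmod (?x i j))\<^sup>2)"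
    unfolding lform_def QA QB by (simp add: right_diff_distrib sum_subtractf)
  also have "\<dots> = (\<Sum>i\<in>I. \<Sum>j\<in>I. 2 * (a i * Re (cnj (?x i j) * ?c i j)) - 2 * (b j * Re (cnj (?x i j) * ?c i j))
     - a i * (cmod (?x i j))\<^sup>2 - s * (b j * (cmod (?x i j))\<^sup>2))"
    unfolding TA TB by (simp add: sum_subtractf sum_distrib_left right_diff_distrib Re_mult del: times_complex.sel)
  also have "\<dots> = (\<Sum>i\<in>I. \<Sum>j\<in>I. 2 * (a i - b j) * Re (cnj (?x i j) * ?c i j)
     - (a i + s * b j) * (cmod (?x i j))\<^sup>2)"
    by (intro sum.cong refl) (simp add: algebra_simps del: times_complex.sel)
  finally show ?thesis .
qed

text \<open>The last condition says that the kernel of \<open>A\<close> lies in the kernel of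
  \<open>B\<close>, which makes the relative entropy of \<open>B\<close> with respect to
  \<open>A\<close> finite.\<close>

definition spectral_pair :: "'i set \<Rightarrow> ('i \<Rightarrow> real) \<Rightarrow> ('i \<Rightarrow> 'i \<Rightarrow> complex) \<Rightarrow> ('i \<Rightarrow> real) \<Rightarrow> ('i \<Rightarrow> 'i \<Rightarrow> complex) \<Rightarrow>
    ('i \<Rightarrow> 'i \<Rightarrow> complex) \<Rightarrow> ('i \<Rightarrow> 'i \<Rightarrow> complex) \<Rightarrow> bool" where
  "spectral_pair I a u b v A B \<longleftrightarrow> spectral I I a u A \<and> complete_on I I u \<and> spectral I I b v B \<and> complete_on I I v \<and>
     (\<forall>i\<in>I. 0 \<le> a i) \<and> (\<forall>j\<in>I. 0 \<le> b j) \<and>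
     (\<forall>i\<in>I. \<forall>j\<in>I. a i = 0 \<longrightarrow> b j \<noteq> 0 \<longrightarrow> ip I (u i) (v j) = 0)"

text \<open>The supremum of \<open>lform\<close> over \<open>X\<close>, in the two eigenbases.
  Division by zero gives 0, the right value for \<open>s \<ge> 0\<close>: then
  \<open>a i = 0\<close>, and by \<open>spectral_pair\<close> either \<open>b j = 0\<close> or the
  overlap vanishes.\<close>

definition qform :: "'i set \<Rightarrow> ('i \<Rightarrow> real) \<Rightarrow> ('i \<Rightarrow> 'i \<Rightarrow> complex) \<Rightarrow> ('i \<Rightarrow> real) \<Rightarrow> ('i \<Rightarrow> 'i \<Rightarrow> complex) \<Rightarrow>
    real \<Rightarrow> real" where
  "qform I a u b v s = (\<Sum>i\<in>I. \<Sum>j\<in>I. (cmod (ip I (u i) (v j)))\<^sup>2 * ((a i - b j)\<^sup>2 / (a i + s * b j)))"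

text \<open>Completing the square in \<open>cmod x\<close>. The second assumption covers the
  degenerate denominator and will come from the kernel condition of
  \<open>spectral_pair\<close>.\<close>

lemma complete_on_square_bound:
  fixes x c :: complex and d m :: real
  assumes "0 \<le> m" "m = 0 \<Longrightarrow> d = 0 \<or> c = 0"
  shows "2 * d * Re (cnj x * c) - m * (cmod x)\<^sup>2 \<le> (cmod c)\<^sup>2 * (d\<^sup>2 / m)"
proof (cases "m = 0")
  case False
  then have m: "m > 0" using assms by simp
  have "\<bar>Re (cnj x * c)\<bar> \<le> cmod x * cmod c"
    using abs_Re_le_cmod[of "cnj x * c"] by (simp add: norm_mult)
  then have "\<bar>d\<bar> * \<bar>Re (cnj x * c)\<bar> \<le> \<bar>d\<bar> * (cmod x * cmod c)"
    by (rule mult_left_mono) simp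
  then have 1: "d * Re (cnj x * c) \<le> \<bar>d\<bar> * cmod x * cmod c"
    by (metis abs_le_D1 abs_mult mult.assoc)
  have "0 \<le> m * (cmod x - \<bar>d\<bar> * cmod c / m)\<^sup>2" using m by simp
  also have "\<dots> = m * (cmod x)\<^sup>2 - 2 * (\<bar>d\<bar> * cmod x * cmod c) + (cmod c)\<^sup>2 * (d\<^sup>2 / m)"
    using m by (simp add: power2_eq_square field_simps)
  finally show ?thesis using 1 by linarith
qed (use assms in auto)

lemma lform_le_qform:
  assumes fin: "finite I" and p: "spectral_pair I a u b v A B" and s: "0 \<le> s"
  shows "lform I s X A B \<le> qform I a u b v s"
proof -
  have p': "spectral I I a u A" "complete_on I I u" "spectral I I b v B" "complete_on I I v"
    "\<And>i. i \<in> I \<Longrightarrow> 0 \<le> a i" "\<And>i. i \<in> I \<Longrightarrow> 0 \<le> b i"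
    "\<And>i j. i \<in> I \<Longrightarrow> j \<in> I \<Longrightarrow> a i = 0 \<Longrightarrow> b j \<noteq> 0 \<Longrightarrow> ip I (u i) (v j) = 0"
    using p unfolding spectral_pair_def by auto
  show ?thesis
    unfolding lform_coord[OF fin p'(1-4)] qform_def
  proof (intro sum_mono complete_on_square_bound)
    fix i j assume ij: "i \<in> I" "j \<in> I"
    have n: "0 \<le> a i" "0 \<le> s * b j" using p'(5,6) ij s by auto
    show "0 \<le> a i + s * b j" using n by simp
    show "a i - b j = 0 \<or> ip I (u i) (v j) = 0" if "a i + s * b j = 0"
      using n that p'(7)[OF ij] by (cases "b j = 0") auto
  qed
qed

lemma qform_attained:
  assumes fin: "finite I" and p: "spectral_pair I a u b v A B"
  shows "\<exists>X. lform I s X A B = qform I a u b v s"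
proof -
  have p': "spectral I I a u A" "complete_on I I u" "spectral I I b v B" "complete_on I I v"
    using p unfolding spectral_pair_def by auto
  \<comment> \<open>Stationarity of \<open>lform\<close> in \<open>X\<close> reads
    \<open>A X + s X B = A - B\<close>; these are the coordinates of its solution, set to 0 where
    the denominator vanishes.\<close>
  define x where "x i j = ip I (u i) (v j) * of_real ((a i - b j) / (a i + s * b j))" for i j
  define X where "X p q = (\<Sum>k\<in>I. \<Sum>l\<in>I. u k p * x k l * cnj (v l q))" for p q
  have ou: "ip I (u i) (u k) = (if i = k then 1 else 0)" if "i \<in> I" "k \<in> I" for i k
    using p'(1) that unfolding spectral_def orthonormal_def by blast
  have ov: "ip I (v i) (v k) = (if i = k then 1 else 0)" if "i \<in> I" "k \<in> I" for i k
    using p'(3) that unfolding spectral_def orthonormal_def by blast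
  have X: "coord I (u i) (v j) X = x i j" if ij: "i \<in> I" "j \<in> I" for i j
  proof -
    let ?T = "\<lambda>k l p q. x k l * (cnj (u i p) * u k p) * (cnj (v l q) * v j q)"
    have "coord I (u i) (v j) X = (\<Sum>p\<in>I. \<Sum>q\<in>I. \<Sum>k\<in>I. \<Sum>l\<in>I. ?T k l p q)"
      unfolding coord_def X_def by (simp add: sum_distrib_left sum_distrib_right mult_ac)
    also have "\<dots> = (\<Sum>p\<in>I. \<Sum>k\<in>I. \<Sum>q\<in>I. \<Sum>l\<in>I. ?T k l p q)"
      by (subst (2) sum.swap) simp
    also have "\<dots> = (\<Sum>k\<in>I. \<Sum>p\<in>I. \<Sum>q\<in>I. \<Sum>l\<in>I. ?T k l p q)"
      by (rule sum.swap)
    also have "\<dots> = (\<Sum>k\<in>I. \<Sum>p\<in>I. \<Sum>l\<in>I. \<Sum>q\<in>I. ?T k l p q)"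
      by (subst (3) sum.swap) simp
    also have "\<dots> = (\<Sum>k\<in>I. \<Sum>l\<in>I. \<Sum>p\<in>I. \<Sum>q\<in>I. ?T k l p q)"
      by (subst (2) sum.swap) simp
    also have "\<dots> = (\<Sum>k\<in>I. \<Sum>l\<in>I. x k l * ip I (u i) (u k) * ip I (v l) (v j))"
      unfolding ip_def by (simp add: sum_distrib_left sum_distrib_right mult_ac)
    also have "\<dots> = (\<Sum>k\<in>I. if k = i then (\<Sum>l\<in>I. if l = j then x k l else 0) else 0)"
      using ij ou ov by (intro sum.cong refl) (auto intro!: sum.cong)
    also have "\<dots> = x i j" using fin ij by simp
    finally show ?thesis .
  qed
  have alg: "2 * d * (d / m * e) - m * ((d / m)\<^sup>2 * e) = e * (d\<^sup>2 / m)" for d m e :: real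
    by (cases "m = 0") (simp_all add: power2_eq_square field_simps)
  have "lform I s X A B = qform I a u b v s"
    unfolding lform_coord[OF fin p'] qform_def
  proof (intro sum.cong refl)
    fix i j assume ij: "i \<in> I" "j \<in> I"
    let ?c = "ip I (u i) (v j)" and ?m = "a i + s * b j" and ?d = "a i - b j"
    have cc: "cnj ?c * ?c = of_real ((cmod ?c)\<^sup>2)"
      by (metis complex_norm_square mult.commute of_real_power)
    have "cnj (x i j) * ?c = of_real (?d / ?m) * (cnj ?c * ?c)" unfolding x_def by (simp add: mult_ac)
    then have "cnj (x i j) * ?c = of_real (?d / ?m * (cmod ?c)\<^sup>2)" unfolding cc by simp
    then have 1: "Re (cnj (x i j) * ?c) = ?d / ?m * (cmod ?c)\<^sup>2" by (metis Re_complex_of_real)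
    have 2: "(cmod (x i j))\<^sup>2 = (?d / ?m)\<^sup>2 * (cmod ?c)\<^sup>2"
      unfolding x_def norm_mult norm_of_real power_mult_distrib power2_abs by simp
    show "2 * ?d * Re (cnj (coord I (u i) (v j) X) * ?c) - ?m * (cmod (coord I (u i) (v j) X))\<^sup>2
        = (cmod ?c)\<^sup>2 * (?d\<^sup>2 / ?m)"
      unfolding X[OF ij] 1 2 by (rule alg)
  qed
  then show ?thesis by blast
qed

text \<open>A maximiser for the sum is a competitor for every summand, and \<open>lform\<close> is
  additive at fixed \<open>X\<close>.\<close>

lemma qform_subadditive:
  assumes fin: "finite I" and s: "0 \<le> s"
    and p: "\<And>k. k \<in> K \<Longrightarrow> spectral_pair I (a k) (u k) (b k) (v k) (A k) (B k)"
    and p0: "spectral_pair I a0 u0 b0 v0 (\<lambda>x y. \<Sum>k\<in>K. A k x y) (\<lambda>x y. \<Sum>k\<in>K. B k x y)"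
  shows "qform I a0 u0 b0 v0 s \<le> (\<Sum>k\<in>K. qform I (a k) (u k) (b k) (v k) s)"
proof -
  obtain X where X: "lform I s X (\<lambda>x y. \<Sum>k\<in>K. A k x y) (\<lambda>x y. \<Sum>k\<in>K. B k x y) = qform I a0 u0 b0 v0 s"
    using qform_attained[OF fin p0] by blast
  show ?thesis
    unfolding X[symmetric] lform_sum by (intro sum_mono lform_le_qform[OF fin p s])
qed

text \<open>An antiderivative in \<open>s\<close> of \<open>(a - b)\<^sup>2 / ((a + s b) (1 + s)\<^sup>2)\<close>; it increases from
  \<open>b ln a - a + b\<close> at \<open>0\<close> to \<open>b ln b\<close> at infinity.\<close>
definition rel_prim :: "real \<Rightarrow> real \<Rightarrow> real \<Rightarrow> real" where
  "rel_prim a b s = b * ln ((a + s * b) / (1 + s)) - (a - b) / (1 + s)"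

lemma rel_prim_deriv:
  assumes a: "0 \<le> a" and b: "0 \<le> b" and ab: "a = 0 \<Longrightarrow> b = 0" and s: "0 \<le> s"
  shows "(rel_prim a b has_real_derivative (a - b)\<^sup>2 / (a + s * b) / (1 + s)\<^sup>2) (at s)"
proof (cases "a = 0")
  case True
  then show ?thesis using ab unfolding rel_prim_def by simp
next
  case False
  then have m: "a + s * b > 0" using a b s by (simp add: add_pos_nonneg)
  have d1: "((\<lambda>s. a + s * b) has_real_derivative b) (at s)" "((\<lambda>s. 1 + s) has_real_derivative 1) (at s)"
    by (auto intro!: derivative_eq_intros)
  have s1: "1 + s \<noteq> 0" using s by simp
  have q: "(a + s * b) / (1 + s) > 0" using m s by simp
  note d2 = DERIV_divide[OF d1 s1]
  note d3 = DERIV_diff[OF DERIV_cmult[OF DERIV_chain2[OF DERIV_ln[OF q] d2], of b] DERIV_divide[OF DERIV_const[of "a - b"] d1(2) s1]]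
  show ?thesis unfolding rel_prim_def[abs_def]
  proof (rule DERIV_cong[OF d3])
    let ?m = "a + s * b" and ?n = "1 + s"
    have "b * (inverse (?m / ?n) * ((b * ?n - ?m * 1) / (?n * ?n))) = b * (b - a) * (1 / (?m * ?n))"
      using m s1 by (simp add: divide_simps) (simp add: algebra_simps)
    moreover have "(0 * ?n - (a - b) * 1) / (?n * ?n) = (b - a) * (1 / ?n ^ 2)"
      by (simp add: power2_eq_square)
    moreover have "b * (b - a) * (1 / (?m * ?n)) - (b - a) * (1 / ?n ^ 2) = (a - b)\<^sup>2 / ?m / ?n ^ 2"
      using m s1 by (simp add: divide_simps) (simp add: power2_eq_square algebra_simps)
    ultimately show "b * (inverse (?m / ?n) * ((b * ?n - ?m * 1) / (?n * ?n))) - (0 * ?n - (a - b) * 1) / (?n * ?n)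
        = (a - b)\<^sup>2 / ?m / ?n ^ 2" by (simp only:)
  qed
qed

lemma rel_prim_tendsto:
  assumes b: "0 \<le> b"
  shows "(rel_prim a b \<longlongrightarrow> b * ln b) at_top"
proof -
  have inv: "((\<lambda>s::real. 1 / (1 + s)) \<longlongrightarrow> 0) at_top"
    by (intro tendsto_divide_0[OF tendsto_const] filterlim_at_top_imp_at_infinity
        filterlim_tendsto_add_at_top[OF tendsto_const] filterlim_ident)
  have eq: "eventually (\<lambda>s. b * ln (b + (a - b) * (1 / (1 + s))) - (a - b) * (1 / (1 + s)) = rel_prim a b s) at_top"
    using eventually_ge_at_top[of 0]
  proof eventually_elim
    case (elim s)
    have "(a + s * b) / (1 + s) = b + (a - b) * (1 / (1 + s))" using elim by (simp add: field_simps)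
    then show ?case unfolding rel_prim_def by simp
  qed
  have "((\<lambda>s. b * ln (b + (a - b) * (1 / (1 + s))) - (a - b) * (1 / (1 + s))) \<longlongrightarrow> b * ln b) at_top"
  \<comment> \<open>For \<open>b = 0\<close> the argument of the logarithm tends to 0, where
    \<open>ln\<close> has no limit, but the factor \<open>b\<close> removes it.\<close>
  proof (cases "b = 0")
    case True
    then show ?thesis using tendsto_mult[OF tendsto_const inv, of "- a"] by simp
  next
    case False
    have "((\<lambda>s. b * ln (b + (a - b) * (1 / (1 + s))) - (a - b) * (1 / (1 + s))) \<longlongrightarrow>
        b * ln (b + (a - b) * 0) - (a - b) * 0) at_top"
      by (intro tendsto_intros inv) (use False in simp)
    then show ?thesis by simp
  qed
  then show ?thesis by (rule Lim_transform_eventually[OF _ eq])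
qed

text \<open>For complete eigenbases this is \<open>Tr (B ln B - B ln A + A - B)\<close>: the
  relative entropy of \<open>B\<close> with respect to \<open>A\<close> in natural units, with the
  linear correction that the antiderivative \<open>rel_prim\<close> leaves at
  \<open>s = 0\<close>.\<close>

definition rel_ent :: "'i set \<Rightarrow> ('i \<Rightarrow> real) \<Rightarrow> ('i \<Rightarrow> 'i \<Rightarrow> complex) \<Rightarrow> ('i \<Rightarrow> real) \<Rightarrow> ('i \<Rightarrow> 'i \<Rightarrow> complex) \<Rightarrow>
    real" where
  "rel_ent I a u b v = (\<Sum>i\<in>I. \<Sum>j\<in>I. (cmod (ip I (u i) (v j)))\<^sup>2 * (b j * ln (b j) - b j * ln (a i) + a i - b j))"

text \<open>Lieb's joint convexity of the relative entropy, in homogeneous form.\<close>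
lemma rel_ent_subadditive:
  assumes fin: "finite I"
    and p: "\<And>k. k \<in> K \<Longrightarrow> spectral_pair I (a k) (u k) (b k) (v k) (A k) (B k)"
    and p0: "spectral_pair I a0 u0 b0 v0 (\<lambda>x y. \<Sum>k\<in>K. A k x y) (\<lambda>x y. \<Sum>k\<in>K. B k x y)"
  shows "rel_ent I a0 u0 b0 v0 \<le> (\<Sum>k\<in>K. rel_ent I (a k) (u k) (b k) (v k))"
proof -
  define \<Psi> where "\<Psi> a u b v s = (\<Sum>i\<in>I. \<Sum>j\<in>I. (cmod (ip I (u i) (v j)))\<^sup>2 * rel_prim (a i) (b j) s)"
    for a :: "'a \<Rightarrow> real" and u :: "'a \<Rightarrow> 'a \<Rightarrow> complex" and b v s
  have der: "(\<Psi> a u b v has_real_derivative qform I a u b v s / (1 + s)\<^sup>2) (at s)"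
    if sp: "spectral_pair I a u b v A B" and s: "0 \<le> s" for a u b v A B s
  proof -
    have *: "((\<lambda>s. (cmod (ip I (u i) (v j)))\<^sup>2 * rel_prim (a i) (b j) s) has_real_derivative
      (cmod (ip I (u i) (v j)))\<^sup>2 * ((a i - b j)\<^sup>2 / (a i + s * b j)) / (1 + s)\<^sup>2) (at s)"
      if ij: "i \<in> I" "j \<in> I" for i j
    \<comment> \<open>Vanishing overlaps are split off, because only for the remaining pairs does
      \<open>a i = 0\<close> force \<open>b j = 0\<close>, as \<open>rel_prim_deriv\<close>
      requires.\<close>
    proof (cases "ip I (u i) (v j) = 0")
      case False
      have "(rel_prim (a i) (b j) has_real_derivative (a i - b j)\<^sup>2 / (a i + s * b j) / (1 + s)\<^sup>2) (at s)"
        using sp ij s False by (intro rel_prim_deriv) (auto simp: spectral_pair_def)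
      from DERIV_cmult[OF this, of "(cmod (ip I (u i) (v j)))\<^sup>2"] show ?thesis by simp
    qed simp
    show ?thesis
      unfolding \<Psi>_def[abs_def] qform_def sum_divide_distrib
      by (intro DERIV_sum *)
  qed
  have lim: "(\<Psi> a u b v \<longlongrightarrow> (\<Sum>i\<in>I. \<Sum>j\<in>I. (cmod (ip I (u i) (v j)))\<^sup>2 * (b j * ln (b j)))) at_top"
    if sp: "spectral_pair I a u b v A B" for a u b v A B
    unfolding \<Psi>_def[abs_def]
    by (intro tendsto_sum tendsto_mult tendsto_const rel_prim_tendsto) (use sp in \<open>auto simp: spectral_pair_def\<close>)
  have rel: "rel_ent I a u b v = (\<Sum>i\<in>I. \<Sum>j\<in>I. (cmod (ip I (u i) (v j)))\<^sup>2 * (b j * ln (b j))) - \<Psi> a u b v 0"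
    for a :: "'a \<Rightarrow> real" and u :: "'a \<Rightarrow> 'a \<Rightarrow> complex" and b v
    unfolding rel_ent_def \<Psi>_def rel_prim_def sum_subtractf[symmetric]
    by (intro sum.cong refl) (simp add: algebra_simps)
  \<comment> \<open>By subadditivity of \<open>qform\<close>, \<open>\<Delta>\<close> is
    nondecreasing on the half-line, and it has a finite limit. Its value at 0 is therefore at most
    that limit, and by \<open>rel\<close> this inequality is the claim.\<close>
  define \<Delta> where "\<Delta> s = (\<Sum>k\<in>K. \<Psi> (a k) (u k) (b k) (v k) s) - \<Psi> a0 u0 b0 v0 s" for s
  have mono: "\<Delta> 0 \<le> \<Delta> s" if s: "0 \<le> s" for s
  proof (rule DERIV_nonneg_imp_nondecreasing[OF s])
    fix r :: real assume r: "0 \<le> r" "r \<le> s"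
    have "(\<Delta> has_real_derivative (\<Sum>k\<in>K. qform I (a k) (u k) (b k) (v k) r / (1 + r)\<^sup>2)
       - qform I a0 u0 b0 v0 r / (1 + r)\<^sup>2) (at r)"
      unfolding \<Delta>_def[abs_def] by (intro DERIV_diff DERIV_sum der[OF p r(1)] der[OF p0 r(1)])
    moreover have "0 \<le> (\<Sum>k\<in>K. qform I (a k) (u k) (b k) (v k) r / (1 + r)\<^sup>2) - qform I a0 u0 b0 v0 r / (1 + r)\<^sup>2"
      using qform_subadditive[where A=A and B=B, OF fin r(1) p p0]
      unfolding sum_divide_distrib[symmetric] by (simp add: divide_right_mono)
    ultimately show "\<exists>y. (\<Delta> has_real_derivative y) (at r) \<and> 0 \<le> y" by blast
  qed
  define l where "l b u v = (\<Sum>i\<in>I. \<Sum>j\<in>I. (cmod (ip I (u i) (v j)))\<^sup>2 * (b j * ln (b j)))"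
    for b :: "'a \<Rightarrow> real" and u v :: "'a \<Rightarrow> 'a \<Rightarrow> complex"
  have "(\<Delta> \<longlongrightarrow> (\<Sum>k\<in>K. l (b k) (u k) (v k)) - l b0 u0 v0) at_top"
    unfolding \<Delta>_def[abs_def] l_def by (intro tendsto_diff tendsto_sum lim[OF p] lim[OF p0])
  then have "\<Delta> 0 \<le> (\<Sum>k\<in>K. l (b k) (u k) (v k)) - l b0 u0 v0"
  proof (rule tendsto_lowerbound)
    show "\<forall>\<^sub>F s in at_top. \<Delta> 0 \<le> \<Delta> s"
      using eventually_ge_at_top[of 0] by eventually_elim (rule mono)
  qed simp
  then show ?thesis
    unfolding rel \<Delta>_def l_def by (simp add: sum_subtractf)
qed

subsection \<open>Strong subadditivity\<close>

lemma complete_on_overlap_sum: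
  assumes fin: "finite I" and com: "complete_on I J u" and w: "ip I w w = 1"
  shows "(\<Sum>i\<in>J. (cmod (ip I (u i) w))\<^sup>2) = 1"
proof -
  have "1 = (\<Sum>x\<in>I. cnj (w x) * w x)" using w by (simp add: ip_def)
  also have "\<dots> = (\<Sum>i\<in>J. ip I w (u i) * ip I (u i) w)"
    unfolding ip_def by (rule parseval[OF fin com])
  also have "\<dots> = of_real (\<Sum>i\<in>J. (cmod (ip I (u i) w))\<^sup>2)"
    unfolding of_real_sum by (intro sum.cong refl) (metis ip_mult_cnj mult.commute)
  finally show ?thesis by (metis of_real_eq_1_iff)
qed

lemma sum_Times: "(\<Sum>p\<in>L \<times> M. f p) = (\<Sum>l\<in>L. \<Sum>m\<in>M. f (l, m))"
  by (simp add: sum.cartesian_product split_def)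

section \<open>Partial trace and conditional entropy of unnormalised operators\<close>

definition ptrace :: "'l set \<Rightarrow> ('l \<times> 'm \<Rightarrow> 'l \<times> 'm \<Rightarrow> complex) \<Rightarrow> 'm \<Rightarrow> 'm \<Rightarrow> complex" where
  "ptrace L B m m' = (\<Sum>l\<in>L. B (l, m) (l, m'))"

definition cond_ent :: "'l set \<Rightarrow> 'm set \<Rightarrow> ('l \<times> 'm \<Rightarrow> 'l \<times> 'm \<Rightarrow> complex) \<Rightarrow> real" where
  "cond_ent L M B = entropy_on (L \<times> M) B - entropy_on M (ptrace L B)"

lemma psd_on_ptrace:
  assumes "finite L" "finite M" "psd_on (L \<times> M) B"
  shows "psd_on M (ptrace L B)"
  unfolding ptrace_def[abs_def]
proof (rule psd_on_sum)
  fix l assume "l \<in> L"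
  then show "psd_on M (\<lambda>m m'. B (l, m) (l, m'))"
    using assms by (intro psd_on_reindex[of "L \<times> M" M B "\<lambda>m. (l, m)"]) auto
qed

lemma trace_on_ptrace: "trace_on M (ptrace L B) = trace_on (L \<times> M) B"
  unfolding trace_on_def ptrace_def sum_Times by (subst sum.swap) (rule refl)

lemma ptrace_sum: "ptrace L (\<lambda>x y. \<Sum>k\<in>K. B k x y) = (\<lambda>x y. \<Sum>k\<in>K. ptrace L (B k) x y)"
  unfolding ptrace_def by (intro ext sum.swap)

lemma ptrace_scale: "ptrace L (\<lambda>x y. c * B x y) = (\<lambda>x y. c * ptrace L B x y)"
  unfolding ptrace_def by (simp add: sum_distrib_left)

text \<open>The terms \<open>eta c * trace\<close> from \<open>entropy_on_scale\<close> cancel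
  because the partial trace preserves the trace. This homogeneity lets probabilities move between
  the operators and the coefficients.\<close>

lemma cond_ent_scale:
  assumes fin: "finite L" "finite M" and p: "psd_on (L \<times> M) B" and c: "0 \<le> c"
  shows "cond_ent L M (\<lambda>x y. of_real c * B x y) = c * cond_ent L M B"
proof -
  have "finite (L \<times> M)" using fin by simp
  then show ?thesis
    unfolding cond_ent_def ptrace_scale
    using entropy_on_scale[OF _ p c] entropy_on_scale[OF fin(2) psd_on_ptrace[OF fin p] c]
    by (simp add: trace_on_ptrace right_diff_distrib)
qed

lemma cond_ent_cong:
  assumes "\<And>x y. x \<in> L \<times> M \<Longrightarrow> y \<in> L \<times> M \<Longrightarrow> A x y = B x y"
  shows "cond_ent L M A = cond_ent L M B"
proof -
  have "entropy_on (L \<times> M) A = entropy_on (L \<times> M) B" by (rule entropy_on_cong) (rule assms)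
  moreover have "entropy_on M (ptrace L A) = entropy_on M (ptrace L B)"
    by (rule entropy_on_cong) (auto simp: ptrace_def assms intro!: sum.cong)
  ultimately show ?thesis unfolding cond_ent_def by simp
qed

lemma trace_on_sum: "trace_on I (\<lambda>x y. \<Sum>k\<in>K. A k x y) = (\<Sum>k\<in>K. trace_on I (A k))"
  unfolding trace_on_def by (subst sum.swap) simp

text \<open>The reference operator is \<open>1 \<otimes> tr_L B\<close>, diagonal in the products of
  the standard basis of \<open>L\<close> with an eigenbasis of the partial trace. Then
  \<open>Tr (B ln A)\<close> is minus the marginal entropy in natural units, and
  \<open>Tr A - Tr B\<close> is \<open>card L - 1\<close> times the trace of \<open>B\<close>, which
  is linear and will drop out.\<close>

lemma rel_ent_ptrace:
  fixes B :: "'l \<times> 'm \<Rightarrow> 'l \<times> 'm \<Rightarrow> complex"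
  assumes fin: "finite L" "finite M" and p: "psd_on (L \<times> M) B"
  shows "\<exists>a u b v. spectral_pair (L \<times> M) a u b v (\<lambda>x y. if fst x = fst y then ptrace L B (snd x) (snd y) else 0) B \<and>
    rel_ent (L \<times> M) a u b v = (real (card L) - 1) * trace_on (L \<times> M) B - ln 2 * cond_ent L M B"
proof -
  let ?I = "L \<times> M"
  let ?A = "\<lambda>x y. if fst x = fst y then ptrace L B (snd x) (snd y) else 0"
  have finI: "finite ?I" using fin by simp
  obtain b v where bv: "spectral ?I ?I b v B" "complete_on ?I ?I v" "\<And>j. j \<in> ?I \<Longrightarrow> 0 \<le> b j"
    using psd_on_spectral[OF finI p] by blast
  obtain \<beta> n where bn: "spectral M M \<beta> n (ptrace L B)" "complete_on M M n" "\<And>j. j \<in> M \<Longrightarrow> 0 \<le> \<beta> j"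
    using psd_on_spectral[OF fin(2) psd_on_ptrace[OF fin p]] by blast
  define u where "u i x = (if fst x = fst i then n (snd i) (snd x) else 0)" for i x :: "'l \<times> 'm"
  define a where "a i = \<beta> (snd i)" for i :: "'l \<times> 'm"
  have o: "ip ?I (u i) (u j) = (if i = j then 1 else 0)" if ij: "i \<in> ?I" "j \<in> ?I" for i j
  proof -
    have "ip ?I (u i) (u j) = (\<Sum>l\<in>L. \<Sum>m\<in>M. cnj (u i (l, m)) * u j (l, m))"
      unfolding ip_def sum_Times ..
    also have "\<dots> = (\<Sum>l\<in>L. if l = fst i then (\<Sum>m\<in>M. cnj (n (snd i) m) * u j (l, m)) else 0)"
      unfolding u_def by (intro sum.cong refl) auto
    also have "\<dots> = (\<Sum>m\<in>M. cnj (n (snd i) m) * u j (fst i, m))" using fin ij by auto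
    also have "\<dots> = (if fst i = fst j then ip M (n (snd i)) (n (snd j)) else 0)"
      unfolding u_def ip_def by simp
    finally show ?thesis using bn(1) ij unfolding spectral_def orthonormal_def by (auto simp: prod_eq_iff)
  qed
  have e: "(\<Sum>j\<in>?I. c (snd j) * u j x * cnj (u j y)) =
      (if fst x = fst y then (\<Sum>m\<in>M. c m * n m (snd x) * cnj (n m (snd y))) else 0)"
    if "x \<in> ?I" for c x y
  proof -
    have "(\<Sum>j\<in>?I. c (snd j) * u j x * cnj (u j y)) = (\<Sum>l\<in>L. \<Sum>m\<in>M. c m * u (l, m) x * cnj (u (l, m) y))"
      unfolding sum_Times by simp
    also have "\<dots> = (\<Sum>l\<in>L. if l = fst x then (\<Sum>m\<in>M. c m * n m (snd x) * cnj (u (l, m) y)) else 0)"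
      unfolding u_def by (intro sum.cong refl) auto
    also have "\<dots> = (\<Sum>m\<in>M. c m * n m (snd x) * cnj (u (fst x, m) y))" using fin that by auto
    finally show ?thesis unfolding u_def by auto
  qed
  have A: "spectral ?I ?I a u ?A"
    unfolding spectral_def orthonormal_def
  proof (intro conjI ballI)
    fix x y assume xy: "x \<in> ?I" "y \<in> ?I"
    show "?A x y = (\<Sum>j\<in>?I. complex_of_real (a j) * u j x * cnj (u j y))"
      unfolding a_def e[OF xy(1), of "\<lambda>m. complex_of_real (\<beta> m)"]
      using bn(1) xy unfolding spectral_def by auto
  qed (use finI o in auto)
  have Ac: "complete_on ?I ?I u"
    unfolding complete_on_def
  proof (intro ballI)
    fix x y assume xy: "x \<in> ?I" "y \<in> ?I"
    show "(\<Sum>j\<in>?I. u j x * cnj (u j y)) = (if x = y then 1 else 0)"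
      using e[OF xy(1), of "\<lambda>_. 1" y] bn(2) xy unfolding complete_on_def by (auto simp: prod_eq_iff)
  qed
  define W where "W i j = (cmod (ip ?I (u i) (v j)))\<^sup>2" for i j
  \<comment> \<open>The diagonal of \<open>B\<close> in the basis \<open>u\<close>. Summed over
    \<open>L\<close> it gives the eigenvalues of the partial trace, which yields both the kernel
    condition and the cross term \<open>b j * ln (a i)\<close>.\<close>
  define d where "d i = (\<Sum>j\<in>?I. b j * W i j)" for i
  have d: "sesq ?I B (u i) (u i) = of_real (d i)" for i
    unfolding d_def W_def by (rule quad_spectral[OF bv(1)])
  have dsum: "(\<Sum>l\<in>L. d (l, m)) = \<beta> m" if m: "m \<in> M" for m
  proof -
    have "sesq ?I B (u (l, m)) (u (l, m)) = (\<Sum>m1\<in>M. \<Sum>m2\<in>M. cnj (n m m1) * B (l, m1) (l, m2) * n m m2)"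
      if l: "l \<in> L" for l
    proof -
      have "sesq ?I B (u (l, m)) (u (l, m)) = (\<Sum>l1\<in>L. if l1 = l then (\<Sum>m1\<in>M.
          (\<Sum>l2\<in>L. if l2 = l then (\<Sum>m2\<in>M. cnj (n m m1) * B (l1, m1) (l2, m2) * n m m2) else 0)) else 0)"
        unfolding sesq_def sum_Times u_def by (intro sum.cong refl) (auto intro!: sum.cong)
      then show ?thesis using fin l by simp
    qed
    then have "of_real (\<Sum>l\<in>L. d (l, m)) = (\<Sum>l\<in>L. \<Sum>m1\<in>M. \<Sum>m2\<in>M. cnj (n m m1) * B (l, m1) (l, m2) * n m m2)"
      unfolding of_real_sum d[symmetric] by (intro sum.cong refl) blast
    also have "\<dots> = (\<Sum>m1\<in>M. \<Sum>l\<in>L. \<Sum>m2\<in>M. cnj (n m m1) * B (l, m1) (l, m2) * n m m2)"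
      by (rule sum.swap)
    also have "\<dots> = (\<Sum>m1\<in>M. \<Sum>m2\<in>M. \<Sum>l\<in>L. cnj (n m m1) * B (l, m1) (l, m2) * n m m2)"
      by (subst (2) sum.swap) (rule refl)
    also have "\<dots> = sesq M (ptrace L B) (n m) (n m)"
      unfolding sesq_def ptrace_def by (simp add: sum_distrib_left sum_distrib_right)
    also have "\<dots> = of_real (\<beta> m)" by (rule quad_eigenvector[OF bn(1) m])
    finally show ?thesis by (simp only: of_real_eq_iff)
  qed
  have W0: "0 \<le> W i j" for i j unfolding W_def by simp
  have sp: "spectral_pair ?I a u b v ?A B"
    unfolding spectral_pair_def
  proof (intro conjI ballI impI A Ac bv(1,2))
    \<comment> \<open>If the partial trace has eigenvalue 0, the nonnegative diagonal entries
      \<open>d (l, m)\<close> summing to it vanish, and with them every overlap weighted by a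
      positive \<open>b j\<close>.\<close>
    fix i j assume ij: "i \<in> ?I" "j \<in> ?I" and ai: "a i = 0" and bj: "b j \<noteq> 0"
    have dn: "0 \<le> d q" if "q \<in> ?I" for q unfolding d_def using bv(3) W0 by (intro sum_nonneg) simp
    have "(\<Sum>l\<in>L. d (l, snd i)) = 0" using dsum ij ai unfolding a_def by auto
    then have "d (fst i, snd i) = 0" using dn ij fin by (subst (asm) sum_nonneg_eq_0_iff) auto
    then have "b j * W i j = 0" unfolding d_def using ij bv(3) W0 finI by (subst (asm) sum_nonneg_eq_0_iff) auto
    then show "ip ?I (u i) (v j) = 0" using bj unfolding W_def by simp
  qed (use bv bn in \<open>auto simp: a_def\<close>)
  have Wi: "(\<Sum>i\<in>?I. W i j) = 1" if "j \<in> ?I" for j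
    unfolding W_def using bv(1) that by (intro complete_on_overlap_sum[OF finI Ac]) (auto simp: spectral_def orthonormal_def)
  have Wj: "(\<Sum>j\<in>?I. W i j) = 1" if "i \<in> ?I" for i
  proof -
    have "W i j = (cmod (ip ?I (v j) (u i)))\<^sup>2" for j
      unfolding W_def by (metis cnj_ip complex_mod_cnj)
    then show ?thesis using complete_on_overlap_sum[OF finI bv(2) o[OF that that, simplified]] by simp
  qed
  have s1: "(\<Sum>i\<in>?I. \<Sum>j\<in>?I. W i j * f j) = (\<Sum>j\<in>?I. f j)" for f
    using Wi by (subst sum.swap) (simp add: sum_distrib_right[symmetric])
  have s2: "(\<Sum>i\<in>?I. \<Sum>j\<in>?I. W i j * f i) = (\<Sum>i\<in>?I. f i)" for f
    using Wj by (simp add: sum_distrib_right[symmetric])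
  have s3: "(\<Sum>i\<in>?I. \<Sum>j\<in>?I. W i j * (b j * ln (a i))) = (\<Sum>m\<in>M. \<beta> m * ln (\<beta> m))"
  proof -
    have "(\<Sum>i\<in>?I. \<Sum>j\<in>?I. W i j * (b j * ln (a i))) = (\<Sum>i\<in>?I. d i * ln (a i))"
      unfolding d_def sum_distrib_right by (intro sum.cong refl) simp
    also have "\<dots> = (\<Sum>m\<in>M. \<Sum>l\<in>L. d (l, m) * ln (\<beta> m))"
      unfolding sum_Times a_def snd_conv by (rule sum.swap)
    finally show ?thesis using dsum by (simp add: sum_distrib_right[symmetric])
  qed
  have "rel_ent ?I a u b v = (\<Sum>i\<in>?I. \<Sum>j\<in>?I. W i j * (b j * ln (b j)) - W i j * (b j * ln (a i)) + W i j * a i - W i j * b j)"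
    unfolding rel_ent_def W_def[symmetric] by (intro sum.cong refl) (simp add: algebra_simps)
  also have "\<dots> = (\<Sum>j\<in>?I. b j * ln (b j)) - (\<Sum>m\<in>M. \<beta> m * ln (\<beta> m)) + (\<Sum>i\<in>?I. a i) - (\<Sum>j\<in>?I. b j)"
    unfolding sum.distrib sum_subtractf s1 s2 s3 ..
  also have "(\<Sum>i\<in>?I. a i) = card L * trace_on ?I B"
    unfolding a_def sum_Times using trace_on_eq[OF bn(1)] trace_on_ptrace[of M L B] by simp
  also have "(\<Sum>j\<in>?I. b j) = trace_on ?I B" using trace_on_eq[OF bv(1)] by simp
  also have "(\<Sum>j\<in>?I. b j * ln (b j)) = - ln 2 * entropy_on ?I B"
    unfolding entropy_on_eq[OF finI bv(1)] eta_def log_def by (simp add: sum_distrib_left sum_negf)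
  also have "(\<Sum>m\<in>M. \<beta> m * ln (\<beta> m)) = - ln 2 * entropy_on M (ptrace L B)"
    unfolding entropy_on_eq[OF fin(2) bn(1)] eta_def log_def by (simp add: sum_distrib_left sum_negf)
  finally have "rel_ent ?I a u b v = (real (card L) - 1) * trace_on ?I B - ln 2 * cond_ent L M B"
    unfolding cond_ent_def by (simp add: algebra_simps)
  with sp show ?thesis by (intro exI conjI)
qed

text \<open>Strong subadditivity of the von Neumann entropy.\<close>
lemma cond_ent_superadditive:
  fixes B :: "'k \<Rightarrow> 'l \<times> 'm \<Rightarrow> 'l \<times> 'm \<Rightarrow> complex"
  assumes fin: "finite L" "finite M" and p: "\<And>k. k \<in> K \<Longrightarrow> psd_on (L \<times> M) (B k)"
  shows "(\<Sum>k\<in>K. cond_ent L M (B k)) \<le> cond_ent L M (\<lambda>x y. \<Sum>k\<in>K. B k x y)"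
proof -
  let ?I = "L \<times> M"
  let ?A = "\<lambda>B x y. if fst x = fst y then ptrace L B (snd x) (snd y) else 0"
  let ?S = "\<lambda>x y. \<Sum>k\<in>K. B k x y"
  have finI: "finite ?I" using fin by simp
  let ?P = "\<lambda>k a u b v. spectral_pair ?I a u b v (?A (B k)) (B k) \<and>
      rel_ent ?I a u b v = (real (card L) - 1) * trace_on ?I (B k) - ln 2 * cond_ent L M (B k)"
  have "\<forall>k\<in>K. \<exists>a u b v. ?P k a u b v"
    by (intro ballI rel_ent_ptrace fin p)
  from bchoice[OF this] obtain a where "\<forall>k\<in>K. \<exists>u b v. ?P k (a k) u b v" ..
  from bchoice[OF this] obtain u where "\<forall>k\<in>K. \<exists>b v. ?P k (a k) (u k) b v" ..
  from bchoice[OF this] obtain b where "\<forall>k\<in>K. \<exists>v. ?P k (a k) (u k) (b k) v" ..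
  from bchoice[OF this] obtain v where v: "\<forall>k\<in>K. ?P k (a k) (u k) (b k) (v k)" ..
  have pS: "psd_on ?I ?S" by (rule psd_on_sum) (rule p)
  obtain a0 u0 b0 v0 where 0: "spectral_pair ?I a0 u0 b0 v0 (?A ?S) ?S"
    "rel_ent ?I a0 u0 b0 v0 = (real (card L) - 1) * trace_on ?I ?S - ln 2 * cond_ent L M ?S"
    using rel_ent_ptrace[OF fin pS] by (elim exE conjE) (rule that)
  \<comment> \<open>The reference operator is linear in \<open>B\<close>, so the pair belonging to
    the sum is the sum of the pairs.\<close>
  have "?A ?S = (\<lambda>x y. \<Sum>k\<in>K. ?A (B k) x y)" unfolding ptrace_sum by (intro ext) simp
  then have 1: "spectral_pair ?I a0 u0 b0 v0 (\<lambda>x y. \<Sum>k\<in>K. ?A (B k) x y) ?S"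
    by (rule subst[where P = "\<lambda>A. spectral_pair ?I a0 u0 b0 v0 A ?S"]) (rule 0(1))
  have "rel_ent ?I a0 u0 b0 v0 \<le> (\<Sum>k\<in>K. rel_ent ?I (a k) (u k) (b k) (v k))"
    by (rule rel_ent_subadditive[OF finI bspec[OF v, THEN conjunct1] 1])
  also have "\<dots> = (\<Sum>k\<in>K. (real (card L) - 1) * trace_on ?I (B k) - ln 2 * cond_ent L M (B k))"
    using v by (intro sum.cong refl) blast
  also have "\<dots> = (real (card L) - 1) * trace_on ?I ?S - ln 2 * (\<Sum>k\<in>K. cond_ent L M (B k))"
    unfolding trace_on_sum by (simp add: sum_subtractf sum_distrib_left)
  finally show ?thesis unfolding 0(2) by simp
qed

text \<open>Superadditivity of \<open>cond_ent\<close> on the block operators \<open>|k\<rangle>\<langle>k| \<otimes> A k\<close>, where it becomes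
  nonnegativity of the entropy of a classical system conditioned on a quantum one.\<close>
lemma entropy_on_sum_le:
  fixes A :: "'k \<Rightarrow> 'i \<Rightarrow> 'i \<Rightarrow> complex"
  assumes fin: "finite K" "finite I" and p: "\<And>k. k \<in> K \<Longrightarrow> psd_on I (A k)"
  shows "entropy_on I (\<lambda>x y. \<Sum>k\<in>K. A k x y) \<le> (\<Sum>k\<in>K. entropy_on I (A k))"
proof -
  define B where "B k x y = (if fst x = k \<and> fst y = k then A k (snd x) (snd y) else 0)" for k x y
  have 1: "psd_on (K \<times> I) (B k) \<and> entropy_on (K \<times> I) (B k) = (\<Sum>k\<in>{k}. entropy_on I (A k))" if "k \<in> K" for k
    using that fin p by (intro block_spectral[where \<phi> = Pair and A = A]) (auto simp: B_def split: if_splits)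
  have 2: "ptrace K (B k) = A k" if k: "k \<in> K" for k
  proof (intro ext)
    fix x y
    have "ptrace K (B k) x y = (\<Sum>l\<in>K. if l = k then A k x y else 0)"
      unfolding ptrace_def B_def by (intro sum.cong refl) simp
    then show "ptrace K (B k) x y = A k x y" using fin k by simp
  qed
  have S: "(\<Sum>k\<in>K. B k (l, x) (l', y)) = (if l = l' then A l x y else 0)" if "l \<in> K" for l l' x y
  proof -
    have "(\<Sum>k\<in>K. B k (l, x) (l', y)) = (\<Sum>k\<in>K. if k = l then (if l = l' then A l x y else 0) else 0)"
      unfolding B_def by (intro sum.cong refl) auto
    then show ?thesis using fin that by simp
  qed
  have 3: "entropy_on (K \<times> I) (\<lambda>x y. \<Sum>k\<in>K. B k x y) = (\<Sum>k\<in>K. entropy_on I (A k))"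
    using fin p S by (intro entropy_on_block[where \<phi> = Pair and A = A]) auto
  have 4: "ptrace K (\<lambda>x y. \<Sum>k\<in>K. B k x y) = (\<lambda>x y. \<Sum>k\<in>K. A k x y)"
    unfolding ptrace_sum using 2 by simp
  \<comment> \<open>A single block has the same nonzero spectrum as its partial trace.\<close>
  have "(\<Sum>k\<in>K. cond_ent K I (B k)) = 0"
    unfolding cond_ent_def using 1 2 by (intro sum.neutral) simp
  with cond_ent_superadditive[OF fin, of K B] 1 show ?thesis
    unfolding cond_ent_def 3 4 by simp
qed

text \<open>For total weight 1 this is the bound of Shannon entropy by the logarithm of the number
  of outcomes. It is Gibbs' inequality against the uniform weights \<open>T / n\<close>, obtained
  termwise from \<open>ln z \<le> z - 1\<close>.\<close>

lemma sum_eta_le: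
  fixes t :: "'k \<Rightarrow> real"
  assumes fin: "finite K" and t: "\<And>k. k \<in> K \<Longrightarrow> 0 \<le> t k"
  shows "(\<Sum>k\<in>K. eta (t k)) - eta (\<Sum>k\<in>K. t k) \<le> (\<Sum>k\<in>K. t k) * log 2 (card K)"
proof -
  define T where "T = (\<Sum>k\<in>K. t k)"
  define n where "n = real (card K)"
  have T0: "0 \<le> T" unfolding T_def using t by (rule sum_nonneg)
  show ?thesis
  proof (cases "T = 0")
    case True
    then have "\<forall>k\<in>K. t k = 0" using t fin unfolding T_def by (subst (asm) sum_nonneg_eq_0_iff) auto
    then show ?thesis by simp
  next
    case False
    then have T: "T > 0" using T0 by simp
    then have "K \<noteq> {}" unfolding T_def by auto
    then have n: "n > 0" using fin unfolding n_def by (simp add: card_gt_0_iff)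
    have *: "eta (t k) + t k * log 2 T - t k * log 2 n \<le> (T / n - t k) / ln 2" if k: "k \<in> K" for k
    proof (cases "t k = 0")
      case True
      then show ?thesis using T n by simp
    next
      case False
      then have tk: "t k > 0" using t[OF k] by simp
      have "ln (T / (n * t k)) \<le> T / (n * t k) - 1" using T n tk by (intro ln_le_minus_one) simp
      then have "t k * ln (T / (n * t k)) \<le> t k * (T / (n * t k) - 1)" using tk by simp
      also have "\<dots> = T / n - t k" using tk n by (simp add: field_simps)
      finally have "t k * ln (T / (n * t k)) / ln 2 \<le> (T / n - t k) / ln 2" by (simp add: divide_right_mono)
      moreover have "t k * ln (T / (n * t k)) / ln 2 = eta (t k) + t k * log 2 T - t k * log 2 n"
        using T n tk unfolding eta_def log_def by (simp add: ln_div ln_mult field_simps)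
      ultimately show ?thesis by simp
    qed
    have "(\<Sum>k\<in>K. eta (t k) + t k * log 2 T - t k * log 2 n) \<le> (\<Sum>k\<in>K. (T / n - t k) / ln 2)"
      by (rule sum_mono) (rule *)
    also have "\<dots> = (n * (T / n) - T) / ln 2"
      unfolding sum_divide_distrib[symmetric] by (simp add: sum_subtractf T_def n_def)
    also have "\<dots> = 0" using n by simp
    finally have "(\<Sum>k\<in>K. eta (t k)) + T * log 2 T - T * log 2 n \<le> 0"
      by (simp add: sum.distrib sum_subtractf sum_distrib_right T_def)
    then show ?thesis unfolding T_def[symmetric] n_def[symmetric] by (simp add: eta_def)
  qed
qed

lemma entropy_on_singleton:
  assumes p: "psd_on {m} A"
  shows "entropy_on {m} A = eta (trace_on {m} A)"
proof -
  have "A m m = cnj (A m m)" using psd_on_hermitian[OF _ p] by simp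
  then have "A m m = of_real (trace_on {m} A)" unfolding trace_on_def by (simp add: complex_eq_iff)
  then have "spectral {m} {m} (\<lambda>_. trace_on {m} A) (\<lambda>_ _. 1) A"
    unfolding spectral_def orthonormal_def ip_def by simp
  from entropy_on_eq[OF _ this] show ?thesis by simp
qed

text \<open>With a one-dimensional conditioning system the marginal entropy is \<open>eta\<close> of
  the trace. What remains is \<open>entropy_on_sum_le\<close> plus the Shannon bound for the traces,
  so the estimate depends on the classical alphabet and the total weight but not on the dimension of
  \<open>L\<close>.\<close>

lemma holevo_cmi_at_le:
  fixes A :: "'k \<Rightarrow> 'l \<times> 'm \<Rightarrow> 'l \<times> 'm \<Rightarrow> complex"
  assumes fin: "finite K" "finite L" and p: "\<And>k. k \<in> K \<Longrightarrow> psd_on (L \<times> {m}) (A k)"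
  shows "cond_ent L {m} (\<lambda>x y. \<Sum>k\<in>K. A k x y) - (\<Sum>k\<in>K. cond_ent L {m} (A k))
    \<le> (\<Sum>k\<in>K. trace_on (L \<times> {m}) (A k)) * log 2 (card K)"
proof -
  let ?I = "L \<times> {m}"
  have finI: "finite ?I" using fin by simp
  have c: "cond_ent L {m} B = entropy_on ?I B - eta (trace_on ?I B)" if "psd_on ?I B" for B
    unfolding cond_ent_def using entropy_on_singleton[OF psd_on_ptrace[OF fin(2) _ that]] by (simp add: trace_on_ptrace)
  have "cond_ent L {m} (\<lambda>x y. \<Sum>k\<in>K. A k x y) - (\<Sum>k\<in>K. cond_ent L {m} (A k))
     = (entropy_on ?I (\<lambda>x y. \<Sum>k\<in>K. A k x y) - (\<Sum>k\<in>K. entropy_on ?I (A k)))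
      + ((\<Sum>k\<in>K. eta (trace_on ?I (A k))) - eta (\<Sum>k\<in>K. trace_on ?I (A k)))"
    using c[OF psd_on_sum[OF p]] c[OF p] by (simp add: sum_subtractf trace_on_sum)
  also have "\<dots> \<le> 0 + (\<Sum>k\<in>K. trace_on ?I (A k)) * log 2 (card K)"
    using entropy_on_sum_le[OF fin(1) finI p] trace_on_nonneg[OF finI p]
    by (intro add_mono sum_eta_le fin) auto
  finally show ?thesis by simp
qed

subsection \<open>The conditional mutual information of a classical-quantum extension\<close>

lemma entropy_block:
  fixes \<phi> :: "'t \<Rightarrow> 's \<Rightarrow> nat"
  assumes M: "M \<in> carrier_mat D D"
    and fin: "finite T" "\<And>t. t \<in> T \<Longrightarrow> finite (S t)"
    and p: "\<And>t. t \<in> T \<Longrightarrow> psd_on (S t) (A t)"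
    and into: "\<And>t s. t \<in> T \<Longrightarrow> s \<in> S t \<Longrightarrow> \<phi> t s < D"
    and inj: "\<And>t s t' s'. t \<in> T \<Longrightarrow> s \<in> S t \<Longrightarrow> t' \<in> T \<Longrightarrow> s' \<in> S t' \<Longrightarrow> \<phi> t s = \<phi> t' s' \<Longrightarrow> t = t' \<and> s = s'"
    and surj: "\<And>i. i < D \<Longrightarrow> \<exists>t\<in>T. \<exists>s\<in>S t. i = \<phi> t s"
    and entries: "\<And>t s t' s'. t \<in> T \<Longrightarrow> s \<in> S t \<Longrightarrow> t' \<in> T \<Longrightarrow> s' \<in> S t' \<Longrightarrow>
      M $$ (\<phi> t s, \<phi> t' s') = (if t = t' then A t s s' else 0)"
  shows "entropy M = (\<Sum>t\<in>T. entropy_on (S t) (A t))"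
proof -
  have "psd_on {..<D} (\<lambda>i j. M $$ (i, j)) \<and> entropy_on {..<D} (\<lambda>i j. M $$ (i, j)) = (\<Sum>t\<in>T. entropy_on (S t) (A t))"
  proof (rule block_spectral[where \<phi> = \<phi>])
    fix x y assume "x \<in> {..<D}" "y \<in> {..<D}"
    then show "(\<exists>t\<in>T. \<exists>s\<in>S t. x = \<phi> t s) \<and> (\<exists>t\<in>T. \<exists>s\<in>S t. y = \<phi> t s)"
      using surj by simp
  qed (use fin p into inj entries in auto)
  then show ?thesis using entropy_eq_entropy_on[of D M] M psd_iff_psd_on by simp
qed

section \<open>Arithmetic of tensor product indices\<close>

lemma pair_less: "q < m \<Longrightarrow> r < n \<Longrightarrow> q * n + r < m * n" for q m r n :: nat
  by (metis div_less_iff_less_mult div_mult_self3 gr_zeroI less_nat_zero_code div_less add.right_neutral)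

lemma pair_inj: "r < n \<Longrightarrow> r' < n \<Longrightarrow> q * n + r = q' * n + r' \<longleftrightarrow> q = q' \<and> r = r'" for q q' r n :: nat
  by (metis div_mult_self3 div_less add.right_neutral gr_zeroI less_nat_zero_code add_left_cancel)

lemma pair_split: "i < m * n \<Longrightarrow> \<exists>q<m. \<exists>r<n. i = q * n + r" for i m n :: nat
  by (metis div_mult_mod_eq less_mult_imp_div_less mod_less_divisor gr_zeroI mult_0_right less_nat_zero_code)

lemma pair_div: "r < n \<Longrightarrow> (q * n + r) div n = q" and pair_mod: "r < n \<Longrightarrow> (q * n + r) mod n = r"
  for q r n :: nat
  by auto

lemma sum_pair: "(\<Sum>i<m * n. f i) = (\<Sum>q<m. \<Sum>r<n. f (q * n + r))" for m n :: nat
proof -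
  have "(\<Sum>q<m. \<Sum>r<n. f (q * n + r)) = (\<Sum>p\<in>{..<m} \<times> {..<n}. f (fst p * n + snd p))"
    unfolding sum_Times by simp
  also have "\<dots> = (\<Sum>i<m * n. f i)"
    by (rule sum.reindex_bij_witness[where i = "\<lambda>i. (i div n, i mod n)" and j = "\<lambda>p. fst p * n + snd p"])
      (auto simp: pair_less less_mult_imp_div_less intro!: mod_less_divisor gr_zeroI)
  finally show ?thesis by simp
qed

lemma ptrace_mid_entry:
  assumes "q < d1" "r < d3" "q' < d1" "r' < d3"
  shows "ptrace_mid d1 d2 d3 M $$ (q * d3 + r, q' * d3 + r') =
    (\<Sum>k<d2. M $$ ((q * d2 + k) * d3 + r, (q' * d2 + k) * d3 + r'))"
  using assms unfolding ptrace_mid_def by (simp add: pair_less)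

lemma ptrace_mid_carrier: "ptrace_mid d1 d2 d3 M \<in> carrier_mat (d1 * d3) (d1 * d3)"
  unfolding ptrace_mid_def by simp

lemma cmi_block:
  fixes A :: "nat \<Rightarrow> nat \<Rightarrow> nat \<times> nat \<Rightarrow> nat \<times> nat \<Rightarrow> complex"
  assumes R: "R \<in> carrier_mat (nK * dB * dE * nY) (nK * dB * dE * nY)"
    and p: "\<And>k y. k < nK \<Longrightarrow> y < nY \<Longrightarrow> psd_on ({..<dB} \<times> {..<dE}) (A k y)"
    and entries: "\<And>k b e y k' b' e' y'. k < nK \<Longrightarrow> b < dB \<Longrightarrow> e < dE \<Longrightarrow> y < nY \<Longrightarrow>
       k' < nK \<Longrightarrow> b' < dB \<Longrightarrow> e' < dE \<Longrightarrow> y' < nY \<Longrightarrow>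
       R $$ (((k * dB + b) * dE + e) * nY + y, ((k' * dB + b') * dE + e') * nY + y') =
       (if k = k' \<and> y = y' then A k y (b, e) (b', e') else 0)"
  shows "cmi nK dB (dE * nY) R = (\<Sum>y<nY. cond_ent {..<dB} {..<dE} (\<lambda>u v. \<Sum>k<nK. A k y u v)
     - (\<Sum>k<nK. cond_ent {..<dB} {..<dE} (A k y)))"
proof -
  let ?L = "{..<dB}" and ?M = "{..<dE}"
  let ?S = "\<lambda>y u v. \<Sum>k<nK. A k y u v"
  have pS: "psd_on (?L \<times> ?M) (?S y)" if "y < nY" for y
    using p that by (intro psd_on_sum) auto
  \<comment> \<open>One index in two bracketings: the first fits the partial traces over
    \<open>B'\<close>, alone or together with \<open>X A\<close>; the second fits the trace over
    \<open>X A\<close> alone.\<close>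
  have assoc: "((k * dB + b) * dE + e) * nY + y = (k * dB + b) * (dE * nY) + (e * nY + y)"
    "((k * dB + b) * dE + e) * nY + y = k * (dB * (dE * nY)) + (b * (dE * nY) + (e * nY + y))"
    for k b e y by (simp_all add: algebra_simps)
  note ent1 = entries[unfolded assoc(1)] and ent2 = entries[unfolded assoc(2)]
  have eR: "entropy R = (\<Sum>t\<in>{..<nK} \<times> {..<nY}. entropy_on (?L \<times> ?M) (A (fst t) (snd t)))"
  proof (rule entropy_block[where \<phi> = "\<lambda>t s. ((fst t * dB + fst s) * dE + snd s) * nY + snd t", OF R])
    fix i assume i: "i < nK * dB * dE * nY"
    obtain q y where 1: "q < nK * dB * dE" "y < nY" "i = q * nY + y" using pair_split[OF i] by blast
    obtain r e where 2: "r < nK * dB" "e < dE" "q = r * dE + e" using pair_split[OF 1(1)] by blast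
    obtain k b where 3: "k < nK" "b < dB" "r = k * dB + b" using pair_split[OF 2(1)] by blast
    show "\<exists>t\<in>{..<nK} \<times> {..<nY}. \<exists>s\<in>?L \<times> ?M. i = ((fst t * dB + fst s) * dE + snd s) * nY + snd t"
      using 1 2 3 by (intro bexI[of _ "(k, y)"] bexI[of _ "(b, e)"]) auto
  qed (use p entries in \<open>auto simp: pair_inj split: if_splits intro!: pair_less\<close>)
  have e1: "entropy (ptrace_mid nK dB (dE * nY) R) = (\<Sum>t\<in>{..<nK} \<times> {..<nY}. entropy_on ?M (ptrace ?L (A (fst t) (snd t))))"
  proof (rule entropy_block[where \<phi> = "\<lambda>t e. fst t * (dE * nY) + (e * nY + snd t)", OF ptrace_mid_carrier])
    fix i assume i: "i < nK * (dE * nY)"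
    obtain k r where 1: "k < nK" "r < dE * nY" "i = k * (dE * nY) + r" using pair_split[OF i] by blast
    obtain e y where 2: "e < dE" "y < nY" "r = e * nY + y" using pair_split[OF 1(2)] by blast
    show "\<exists>t\<in>{..<nK} \<times> {..<nY}. \<exists>e\<in>?M. i = fst t * (dE * nY) + (e * nY + snd t)"
      using 1 2 by (intro bexI[of _ "(k, y)"] bexI[of _ e]) auto
  next
    fix t e t' e' assume a: "t \<in> {..<nK} \<times> {..<nY}" "e \<in> ?M" "t' \<in> {..<nK} \<times> {..<nY}" "e' \<in> ?M"
    then show "ptrace_mid nK dB (dE * nY) R $$ (fst t * (dE * nY) + (e * nY + snd t), fst t' * (dE * nY) + (e' * nY + snd t'))
      = (if t = t' then ptrace ?L (A (fst t) (snd t)) e e' else 0)"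
      by (subst ptrace_mid_entry) (auto simp: ent1 ptrace_def prod_eq_iff intro!: pair_less sum.neutral)
  qed (use p in \<open>auto simp: pair_inj pair_less intro!: pair_less psd_on_ptrace\<close>)
  have e2: "entropy (ptrace_mid 1 nK (dB * (dE * nY)) R) = (\<Sum>y\<in>{..<nY}. entropy_on (?L \<times> ?M) (?S y))"
  proof (rule entropy_block[where \<phi> = "\<lambda>y s. fst s * (dE * nY) + (snd s * nY + y)", OF ptrace_mid_carrier[of 1 _ "dB * (dE * nY)", unfolded mult_1]])
    fix i assume i: "i < dB * (dE * nY)"
    obtain b r where 1: "b < dB" "r < dE * nY" "i = b * (dE * nY) + r" using pair_split[OF i] by blast
    obtain e y where 2: "e < dE" "y < nY" "r = e * nY + y" using pair_split[OF 1(2)] by blast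
    show "\<exists>y\<in>{..<nY}. \<exists>s\<in>?L \<times> ?M. i = fst s * (dE * nY) + (snd s * nY + y)"
      using 1 2 by (intro bexI[of _ y] bexI[of _ "(b, e)"]) auto
  next
    fix y s y' s' assume a: "y \<in> {..<nY}" "s \<in> ?L \<times> ?M" "y' \<in> {..<nY}" "s' \<in> ?L \<times> ?M"
    obtain b e b' e' where s: "s = (b, e)" "s' = (b', e')" by (cases s; cases s')
    have "ptrace_mid 1 nK (dB * (dE * nY)) R $$ (0 * (dB * (dE * nY)) + (b * (dE * nY) + (e * nY + y)), 0 * (dB * (dE * nY)) + (b' * (dE * nY) + (e' * nY + y')))
      = (\<Sum>k<nK. R $$ ((0 * nK + k) * (dB * (dE * nY)) + (b * (dE * nY) + (e * nY + y)), (0 * nK + k) * (dB * (dE * nY)) + (b' * (dE * nY) + (e' * nY + y'))))"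
      using a s by (intro ptrace_mid_entry pair_less) auto
    also have "\<dots> = (\<Sum>k<nK. if y = y' then A k y (b, e) (b', e') else 0)"
      using a s by (intro sum.cong refl) (simp add: ent2)
    finally show "ptrace_mid 1 nK (dB * (dE * nY)) R $$ (fst s * (dE * nY) + (snd s * nY + y), fst s' * (dE * nY) + (snd s' * nY + y'))
      = (if y = y' then ?S y s s' else 0)" using s by simp
  qed (use pS in \<open>auto simp: pair_inj pair_less intro!: pair_less\<close>)
  have e3: "entropy (ptrace_mid 1 (nK * dB) (dE * nY) R) = (\<Sum>y\<in>{..<nY}. entropy_on ?M (ptrace ?L (?S y)))"
  proof (rule entropy_block[where \<phi> = "\<lambda>y e. e * nY + y", OF ptrace_mid_carrier[of 1 _ "dE * nY", unfolded mult_1]])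
    fix i assume i: "i < dE * nY"
    obtain e y where 2: "e < dE" "y < nY" "i = e * nY + y" using pair_split[OF i] by blast
    show "\<exists>y\<in>{..<nY}. \<exists>e\<in>?M. i = e * nY + y" using 2 by auto
  next
    fix y e y' e' assume a: "y \<in> {..<nY}" "e \<in> ?M" "y' \<in> {..<nY}" "e' \<in> ?M"
    have "ptrace_mid 1 (nK * dB) (dE * nY) R $$ (0 * (dE * nY) + (e * nY + y), 0 * (dE * nY) + (e' * nY + y'))
      = (\<Sum>q<nK * dB. R $$ ((0 * (nK * dB) + q) * (dE * nY) + (e * nY + y), (0 * (nK * dB) + q) * (dE * nY) + (e' * nY + y')))"
      using a by (intro ptrace_mid_entry pair_less) auto
    also have "\<dots> = (\<Sum>k<nK. \<Sum>b<dB. if y = y' then A k y (b, e) (b, e') else 0)"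
      unfolding sum_pair mult_0 add_0 using a by (intro sum.cong refl) (simp add: ent1)
    also have "\<dots> = (if y = y' then ptrace ?L (?S y) e e' else 0)"
      unfolding ptrace_def by (subst sum.swap) simp
    finally show "ptrace_mid 1 (nK * dB) (dE * nY) R $$ (e * nY + y, e' * nY + y')
      = (if y = y' then ptrace ?L (?S y) e e' else 0)" by simp
  qed (use pS in \<open>auto simp: pair_inj pair_less intro!: pair_less psd_on_ptrace\<close>)
  have sw: "(\<Sum>t\<in>{..<nK} \<times> {..<nY}. f (fst t) (snd t)) = (\<Sum>y<nY. \<Sum>k<nK. f k y)" for f :: "nat \<Rightarrow> nat \<Rightarrow> real"
    unfolding sum_Times by (subst sum.swap) simp
  show ?thesis
    unfolding cmi_def e1 e2 e3 eR cond_ent_def sw[of "\<lambda>k y. entropy_on ?M (ptrace ?L (A k y))"] sw[of "\<lambda>k y. entropy_on (?L \<times> ?M) (A k y)"]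
    by (simp add: sum_subtractf)
qed

section \<open>Extension states and their entries\<close>

definition entries :: "nat \<Rightarrow> complex mat \<Rightarrow> nat \<times> nat \<Rightarrow> nat \<times> nat \<Rightarrow> complex" where
  "entries dE M u v = M $$ (fst u * dE + snd u, fst v * dE + snd v)"

lemma psd_on_entries:
  assumes "psd (dB * dE) M"
  shows "psd_on ({..<dB} \<times> {..<dE}) (entries dE M)"
proof -
  have "psd_on {..<dB * dE} (\<lambda>i j. M $$ (i, j))" using assms by (simp add: psd_iff_psd_on)
  then show ?thesis unfolding entries_def[abs_def]
    by (rule psd_on_reindex[rotated 2]) (auto intro!: pair_less)
qed

lemma psd_of_entries:
  assumes M: "M \<in> carrier_mat (dB * dE) (dB * dE)" and p: "psd_on ({..<dB} \<times> {..<dE}) (entries dE M)"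
  shows "psd (dB * dE) M"
proof -
  have "psd_on {..<dB * dE} (\<lambda>i j. entries dE M (i div dE, i mod dE) (j div dE, j mod dE))"
    by (rule psd_on_reindex[OF _ _ p])
      (auto simp: less_mult_imp_div_less intro!: mod_less_divisor gr_zeroI)
  then show ?thesis using M by (simp add: psd_iff_psd_on entries_def)
qed

text \<open>\<open>k\<close> is the joint index \<open>x * nA + a\<close> of the classical pair
  \<open>X A\<close>, so \<open>k div nA\<close> recovers the input and \<open>k mod nA\<close> the
  output.\<close>

lemma ext_state_entry:
  assumes ext: "\<And>a x y. a < nA \<Longrightarrow> x < nX \<Longrightarrow> y < nY \<Longrightarrow> ext a x y \<in> carrier_mat (dB * dE) (dB * dE)"
    and k: "k < nX * nA" "k' < nX * nA" and c: "c < dB * dE" "c' < dB * dE" and y: "y < nY" "y' < nY"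
  shows "ext_state nA nX nY dB dE p ext $$ ((k * (dB * dE) + c) * nY + y, (k' * (dB * dE) + c') * nY + y')
    = (if k = k' \<and> y = y' then of_real (p (k div nA) y) * ext (k mod nA) (k div nA) y $$ (c, c') else 0)"
proof -
  let ?D = "nX * nA * dB * dE * nY"
  let ?i = "(k * (dB * dE) + c) * nY + y" and ?j = "(k' * (dB * dE) + c') * nY + y'"
  have A0: "nA > 0" using k by (auto intro: gr_zeroI)
  have ka: "k mod nA < nA" "k div nA < nX" "k' mod nA < nA" "k' div nA < nX"
    using k A0 by (auto simp: less_mult_imp_div_less)
  have kc: "k * (dB * dE) + c < nX * nA * (dB * dE)" "k' * (dB * dE) + c' < nX * nA * (dB * dE)"
    using k c by (auto intro: pair_less)
  have "?i < nX * nA * (dB * dE) * nY" "?j < nX * nA * (dB * dE) * nY"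
    using kc y by (auto intro: pair_less)
  then have ij: "?i < ?D" "?j < ?D" by (simp_all add: mult.assoc)
  \<comment> \<open>The outermost condition belongs to the innermost sum of
    \<open>ext_state\<close>, so that the three sums collapse one after the other.\<close>
  have e: "(complex_of_real (p x y0) \<cdot>\<^sub>m kron (kron (kron (proj nX x) (proj nA a)) (ext a x y0)) (proj nY y0)) $$ (?i, ?j)
     = (if y0 = y then if a = k mod nA then if x = k div nA then
        (if k = k' \<and> y = y' then of_real (p x y0) * ext a x y0 $$ (c, c') else 0) else 0 else 0 else 0)"
    if x: "x < nX" and a: "a < nA" and y0: "y0 < nY" for x a y0
  proof -
    have kk: "k = k' \<longleftrightarrow> k div nA = k' div nA \<and> k mod nA = k' mod nA" by (metis div_mult_mod_eq)
    have K1: "kron (proj nX x) (proj nA a) = mat (nX * nA) (nX * nA) (\<lambda>(i, j).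
        (if i div nA = x \<and> j div nA = x then 1 else 0) * (if i mod nA = a \<and> j mod nA = a then 1 else 0))"
      unfolding kron_def proj_def using A0
      by (intro eq_matI) (auto simp: less_mult_imp_div_less)
    have K2: "kron (kron (proj nX x) (proj nA a)) (ext a x y0) $$ (k * (dB * dE) + c, k' * (dB * dE) + c') =
       (if k div nA = x \<and> k' div nA = x \<and> k mod nA = a \<and> k' mod nA = a then ext a x y0 $$ (c, c') else 0)"
      using ext[OF a x y0] k kc c unfolding kron_def[of _ "ext a x y0"] K1 by (simp add: pair_div pair_mod del: div_mult_self3)
    have dim: "dim_row (kron (kron (proj nX x) (proj nA a)) (ext a x y0)) = nX * nA * (dB * dE)"
      "dim_col (kron (kron (proj nX x) (proj nA a)) (ext a x y0)) = nX * nA * (dB * dE)"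
      using ext[OF a x y0] unfolding kron_def proj_def by auto
    have "kron (kron (kron (proj nX x) (proj nA a)) (ext a x y0)) (proj nY y0) $$ (?i, ?j)
       = kron (kron (proj nX x) (proj nA a)) (ext a x y0) $$ (k * (dB * dE) + c, k' * (dB * dE) + c') * (if y = y0 \<and> y' = y0 then 1 else 0)"
      unfolding kron_def[of _ "proj nY y0"] dim using y kc
      by (simp add: proj_def pair_less)
    moreover have "dim_row (kron (kron (kron (proj nX x) (proj nA a)) (ext a x y0)) (proj nY y0)) = ?D"
      "dim_col (kron (kron (kron (proj nX x) (proj nA a)) (ext a x y0)) (proj nY y0)) = ?D"
      unfolding kron_def[of _ "proj nY y0"] dim by (simp_all add: proj_def mult.assoc)
    ultimately show ?thesis using ij unfolding K2 kk by auto
  qed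
  have "ext_state nA nX nY dB dE p ext $$ (?i, ?j) = (\<Sum>x<nX. \<Sum>a<nA. \<Sum>y0<nY.
     (complex_of_real (p x y0) \<cdot>\<^sub>m kron (kron (kron (proj nX x) (proj nA a)) (ext a x y0)) (proj nY y0)) $$ (?i, ?j))"
    unfolding ext_state_def msum_def Let_def using ij by simp
  also have "\<dots> = (\<Sum>x<nX. \<Sum>a<nA. \<Sum>y0<nY. if y0 = y then if a = k mod nA then if x = k div nA then
        (if k = k' \<and> y = y' then of_real (p x y0) * ext a x y0 $$ (c, c') else 0) else 0 else 0 else 0)"
    using e by (intro sum.cong refl) simp

  also have "\<dots> = (if k = k' \<and> y = y' then of_real (p (k div nA) y) * ext (k mod nA) (k div nA) y $$ (c, c') else 0)"
    using ka y by simp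
  finally show ?thesis .
qed

lemma ext_state_carrier:
  "ext_state nA nX nY dB dE p ext \<in> carrier_mat (nX * nA * dB * dE * nY) (nX * nA * dB * dE * nY)"
  unfolding ext_state_def Let_def msum_def by simp

lemma sum_div_mod: "(\<Sum>k<nX * nA. f (k div nA) (k mod nA)) = (\<Sum>x<nX. \<Sum>a<nA. f x a)" for nA :: nat
  unfolding sum_pair by (intro sum.cong refl) simp

text \<open>The contribution of one value of \<open>y\<close>, with \<open>q\<close> the input
  distribution for it: the gap in the superadditivity of \<open>cond_ent\<close>, where homogeneity
  has moved \<open>q x\<close> out of the subtracted terms.\<close>

definition cmi_at :: "nat \<Rightarrow> nat \<Rightarrow> nat \<Rightarrow> nat \<Rightarrow> (nat \<Rightarrow> real) \<Rightarrow>
    (nat \<Rightarrow> nat \<Rightarrow> nat \<times> nat \<Rightarrow> nat \<times> nat \<Rightarrow> complex) \<Rightarrow> real" where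
  "cmi_at nA nX dB dE q N =
     cond_ent {..<dB} {..<dE} (\<lambda>u v. \<Sum>x<nX. \<Sum>a<nA. of_real (q x) * N a x u v)
     - (\<Sum>x<nX. \<Sum>a<nA. q x * cond_ent {..<dB} {..<dE} (N a x))"

lemma cmi_ext_state:
  assumes ext: "\<And>a x y. a < nA \<Longrightarrow> x < nX \<Longrightarrow> y < nY \<Longrightarrow> psd (dB * dE) (ext a x y)"
    and p: "\<And>x y. x < nX \<Longrightarrow> y < nY \<Longrightarrow> 0 \<le> p x y"
  shows "cmi (nX * nA) dB (dE * nY) (ext_state nA nX nY dB dE p ext) =
    (\<Sum>y<nY. cmi_at nA nX dB dE (\<lambda>x. p x y) (\<lambda>a x. entries dE (ext a x y)))"
proof -
  define A where "A k y u v = complex_of_real (p (k div nA) y) * entries dE (ext (k mod nA) (k div nA) y) u v" for k y u v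
  have km: "k mod nA < nA \<and> k div nA < nX" if "k < nX * nA" for k
    using that by (auto simp: less_mult_imp_div_less intro!: mod_less_divisor gr_zeroI)
  have pA: "psd_on ({..<dB} \<times> {..<dE}) (A k y)" if "k < nX * nA" "y < nY" for k y
    unfolding A_def[abs_def] using km[OF that(1)] that by (intro psd_on_scale psd_on_entries ext p) auto
  have cA: "cond_ent {..<dB} {..<dE} (A k y) = p (k div nA) y * cond_ent {..<dB} {..<dE} (entries dE (ext (k mod nA) (k div nA) y))"
    if "k < nX * nA" "y < nY" for k y
    unfolding A_def[abs_def] using km[OF that(1)] that by (intro cond_ent_scale psd_on_entries ext p) auto
  have "cmi (nX * nA) dB (dE * nY) (ext_state nA nX nY dB dE p ext) =
    (\<Sum>y<nY. cond_ent {..<dB} {..<dE} (\<lambda>u v. \<Sum>k<nX * nA. A k y u v) - (\<Sum>k<nX * nA. cond_ent {..<dB} {..<dE} (A k y)))"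
  proof (rule cmi_block[OF ext_state_carrier pA])
    fix k b e y k' b' e' y'
    assume *: "k < nX * nA" "b < dB" "e < dE" "y < nY" "k' < nX * nA" "b' < dB" "e' < dE" "y' < nY"
    have ee: "((k * dB + b) * dE + e) * nY + y = (k * (dB * dE) + (b * dE + e)) * nY + y" for k b e y
      by (simp add: algebra_simps)
    show "ext_state nA nX nY dB dE p ext $$ (((k * dB + b) * dE + e) * nY + y, ((k' * dB + b') * dE + e') * nY + y') =
       (if k = k' \<and> y = y' then A k y (b, e) (b', e') else 0)"
      unfolding ee using * ext
      by (subst ext_state_entry) (auto simp: A_def entries_def psd_def intro!: pair_less)
  qed
  also have "\<dots> = (\<Sum>y<nY. cmi_at nA nX dB dE (\<lambda>x. p x y) (\<lambda>a x. entries dE (ext a x y)))"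
  proof (intro sum.cong refl)
    fix y assume y: "y \<in> {..<nY}"
    have "(\<Sum>k<nX * nA. cond_ent {..<dB} {..<dE} (A k y)) =
      (\<Sum>k<nX * nA. p (k div nA) y * cond_ent {..<dB} {..<dE} (entries dE (ext (k mod nA) (k div nA) y)))"
      using y by (intro sum.cong refl cA) auto
    also have "\<dots> = (\<Sum>x<nX. \<Sum>a<nA. p x y * cond_ent {..<dB} {..<dE} (entries dE (ext a x y)))"
      by (rule sum_div_mod[of "\<lambda>x a. p x y * cond_ent {..<dB} {..<dE} (entries dE (ext a x y))"])
    finally have 1: "(\<Sum>k<nX * nA. cond_ent {..<dB} {..<dE} (A k y)) = \<dots>" .
    have 2: "(\<lambda>u v. \<Sum>k<nX * nA. A k y u v) = (\<lambda>u v. \<Sum>x<nX. \<Sum>a<nA. of_real (p x y) * entries dE (ext a x y) u v)"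
      unfolding A_def by (intro HOL.ext sum_div_mod[of "\<lambda>x a. of_real (p x y) * entries dE (ext a x y) _ _"])
    show "cond_ent {..<dB} {..<dE} (\<lambda>u v. \<Sum>k<nX * nA. A k y u v) - (\<Sum>k<nX * nA. cond_ent {..<dB} {..<dE} (A k y))
      = cmi_at nA nX dB dE (\<lambda>x. p x y) (\<lambda>a x. entries dE (ext a x y))"
      unfolding 1 2 cmi_at_def ..
  qed
  finally show ?thesis .
qed

subsection \<open>Intrinsic steerability\<close>

text \<open>The weights may depend on \<open>a\<close> as well as on \<open>x\<close>: nonnegativity
  uses the input distribution alone, coarse-graining also the output channel.\<close>

lemma superadditive_pairs:
  fixes N :: "nat \<Rightarrow> nat \<Rightarrow> nat \<times> nat \<Rightarrow> nat \<times> nat \<Rightarrow> complex"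
  assumes p: "\<And>x a. x < nX \<Longrightarrow> a < nA \<Longrightarrow> psd_on ({..<dB} \<times> {..<dE}) (N a x)"
    and q: "\<And>x a. x < nX \<Longrightarrow> a < nA \<Longrightarrow> 0 \<le> q a x"
  shows "(\<Sum>x<nX. \<Sum>a<nA. q a x * cond_ent {..<dB} {..<dE} (N a x))
    \<le> cond_ent {..<dB} {..<dE} (\<lambda>u v. \<Sum>x<nX. \<Sum>a<nA. of_real (q a x) * N a x u v)"
proof -
  let ?B = "\<lambda>k u v. of_real (q (snd k) (fst k)) * N (snd k) (fst k) u v"
  have "(\<Sum>x<nX. \<Sum>a<nA. q a x * cond_ent {..<dB} {..<dE} (N a x))
      = (\<Sum>k\<in>{..<nX} \<times> {..<nA}. cond_ent {..<dB} {..<dE} (?B k))"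
    unfolding sum_Times using p q by (intro sum.cong refl) (simp add: cond_ent_scale)
  also have "\<dots> \<le> cond_ent {..<dB} {..<dE} (\<lambda>u v. \<Sum>k\<in>{..<nX} \<times> {..<nA}. ?B k u v)"
    by (intro cond_ent_superadditive psd_on_scale) (auto intro: p q)
  finally show ?thesis unfolding sum_Times by simp
qed

lemma cmi_at_nonneg:
  assumes "\<And>x a. x < nX \<Longrightarrow> a < nA \<Longrightarrow> psd_on ({..<dB} \<times> {..<dE}) (N a x)"
    and "\<And>x. x < nX \<Longrightarrow> 0 \<le> q x"
  shows "0 \<le> cmi_at nA nX dB dE q N"
  unfolding cmi_at_def using superadditive_pairs[of nX nA dB dE N "\<lambda>_. q"] assms by simp

text \<open>The condition \<open>ns_ext\<close> for extensions given as functions of index pairs \<open>(b, e)\<close> of \<open>B' E\<close>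
  (matrix index \<open>b * dE + e\<close>); \<open>N a x y\<close> is the prescribed marginal.\<close>
definition ns_ext_on :: "nat \<Rightarrow> nat \<Rightarrow> nat \<Rightarrow> (nat \<Rightarrow> nat \<Rightarrow> nat \<Rightarrow> complex mat) \<Rightarrow> nat \<Rightarrow> nat \<Rightarrow>
    (nat \<Rightarrow> nat \<Rightarrow> nat \<Rightarrow> nat \<times> nat \<Rightarrow> nat \<times> nat \<Rightarrow> complex) \<Rightarrow> bool" where
  "ns_ext_on nA nX nY N dB dE f \<longleftrightarrow> 0 < dE \<and>
     (\<forall>a<nA. \<forall>x<nX. \<forall>y<nY. psd_on ({..<dB} \<times> {..<dE}) (f a x y) \<and>
        (\<forall>b<dB. \<forall>b'<dB. (\<Sum>e<dE. f a x y (b, e) (b', e)) = N a x y $$ (b, b'))) \<and>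
     (\<forall>x<nX. \<forall>x'<nX. \<forall>y<nY. \<forall>u\<in>{..<dB} \<times> {..<dE}. \<forall>v\<in>{..<dB} \<times> {..<dE}.
        (\<Sum>a<nA. f a x y u v) = (\<Sum>a<nA. f a x' y u v))"

lemma ns_ext_on_psd_on: "ns_ext_on nA nX nY N dB dE f \<Longrightarrow> a < nA \<Longrightarrow> x < nX \<Longrightarrow> y < nY \<Longrightarrow> psd_on ({..<dB} \<times> {..<dE}) (f a x y)"
  unfolding ns_ext_on_def by simp

lemma ns_ext_on_ptrace: "ns_ext_on nA nX nY N dB dE f \<Longrightarrow> a < nA \<Longrightarrow> x < nX \<Longrightarrow> y < nY \<Longrightarrow> b < dB \<Longrightarrow> b' < dB \<Longrightarrow>
    (\<Sum>e<dE. f a x y (b, e) (b', e)) = N a x y $$ (b, b')"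
  unfolding ns_ext_on_def by simp

lemma ns_ext_on_no_signalling: "ns_ext_on nA nX nY N dB dE f \<Longrightarrow> x < nX \<Longrightarrow> x' < nX \<Longrightarrow> y < nY \<Longrightarrow>
    u \<in> {..<dB} \<times> {..<dE} \<Longrightarrow> v \<in> {..<dB} \<times> {..<dE} \<Longrightarrow> (\<Sum>a<nA. f a x y u v) = (\<Sum>a<nA. f a x' y u v)"
  unfolding ns_ext_on_def by blast

definition of_entries :: "nat \<Rightarrow> nat \<Rightarrow> (nat \<times> nat \<Rightarrow> nat \<times> nat \<Rightarrow> complex) \<Rightarrow> complex mat" where
  "of_entries dB dE f = mat (dB * dE) (dB * dE) (\<lambda>(i, j). f (i div dE, i mod dE) (j div dE, j mod dE))"

lemma entries_of_entries:
  assumes "u \<in> {..<dB} \<times> {..<dE}" "v \<in> {..<dB} \<times> {..<dE}"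
  shows "entries dE (of_entries dB dE f) u v = f u v"
  using assms by (auto simp: entries_def of_entries_def pair_less pair_div pair_mod simp del: div_mult_self3)

lemma eq_matI_entries:
  assumes "A \<in> carrier_mat (dB * dE) (dB * dE)" "B \<in> carrier_mat (dB * dE) (dB * dE)"
    and "\<And>u v. u \<in> {..<dB} \<times> {..<dE} \<Longrightarrow> v \<in> {..<dB} \<times> {..<dE} \<Longrightarrow> entries dE A u v = entries dE B u v"
  shows "A = B"
proof (rule eq_matI)
  fix i j assume "i < dim_row B" "j < dim_col B"
  then have ij: "i < dB * dE" "j < dB * dE" using assms by auto
  obtain b e where 1: "b < dB" "e < dE" "i = b * dE + e" using pair_split[OF ij(1)] by blast
  obtain b' e' where 2: "b' < dB" "e' < dE" "j = b' * dE + e'" using pair_split[OF ij(2)] by blast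
  show "A $$ (i, j) = B $$ (i, j)" using assms(3)[of "(b, e)" "(b', e')"] 1 2 by (simp add: entries_def)
qed (use assms in auto)

lemma entries_msum:
  assumes "u \<in> {..<dB} \<times> {..<dE}" "v \<in> {..<dB} \<times> {..<dE}"
  shows "entries dE (msum (dB * dE) n g) u v = (\<Sum>k<n. entries dE (g k) u v)"
  using assms by (auto simp: entries_def msum_def pair_less)

lemma ptrace_last:
  "ptrace_mid dB dE 1 M = mat dB dB (\<lambda>(b, b'). \<Sum>e<dE. entries dE M (b, e) (b', e))"
  unfolding ptrace_mid_def entries_def by (intro eq_matI) auto

definition ext_cmis :: "nat \<Rightarrow> nat \<Rightarrow> (nat \<Rightarrow> nat \<Rightarrow> complex mat) \<Rightarrow> nat \<Rightarrow> nat \<Rightarrow>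
    (nat \<Rightarrow> complex mat \<Rightarrow> complex mat) \<Rightarrow> (nat \<Rightarrow> nat \<Rightarrow> real) \<Rightarrow> real set" where
  "ext_cmis nA nX \<rho> nY dB' K p = {cmi (nX * nA) dB' (dE * nY) (ext_state nA nX nY dB' dE p ext)
      | dE ext. ns_ext nA nX nY \<rho> dB' dE K ext}"

text \<open>This lets extensions be built as functions on index pairs. Such a function is arbitrary
  outside the index range, so the reverse inclusion passes through \<open>of_entries\<close> and the
  congruence rules for \<open>cond_ent\<close>.\<close>

lemma ext_cmis_eq:
  assumes K: "\<And>a x y. a < nA \<Longrightarrow> x < nX \<Longrightarrow> y < nY \<Longrightarrow> K y (\<rho> a x) \<in> carrier_mat dB dB"
    and p: "cond_dist nX nY p"
  shows "ext_cmis nA nX \<rho> nY dB K p =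
    {\<Sum>y<nY. cmi_at nA nX dB dE (\<lambda>x. p x y) (\<lambda>a x. f a x y) | dE f. ns_ext_on nA nX nY (\<lambda>a x y. K y (\<rho> a x)) dB dE f}"
    (is "?L = ?R")
proof (intro equalityI subsetI)
  fix c assume "c \<in> ?L"
  then obtain dE ext where c: "c = cmi (nX * nA) dB (dE * nY) (ext_state nA nX nY dB dE p ext)"
    and ns: "ns_ext nA nX nY \<rho> dB dE K ext" unfolding ext_cmis_def by blast
  have psd: "psd (dB * dE) (ext a x y)" and trace_on: "ptrace_mid dB dE 1 (ext a x y) = K y (\<rho> a x)"
    if "a < nA" "x < nX" "y < nY" for a x y
    using ns that unfolding ns_ext_def by blast+
  have c': "c = (\<Sum>y<nY. cmi_at nA nX dB dE (\<lambda>x. p x y) (\<lambda>a x. entries dE (ext a x y)))"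
    unfolding c using p by (intro cmi_ext_state psd) (auto simp: cond_dist_def)
  have "ns_ext_on nA nX nY (\<lambda>a x y. K y (\<rho> a x)) dB dE (\<lambda>a x y. entries dE (ext a x y))"
    unfolding ns_ext_on_def
  proof (intro conjI allI impI ballI)
    show "0 < dE" using ns unfolding ns_ext_def by blast
    fix a x y assume axy: "a < nA" "x < nX" "y < nY"
    show "psd_on ({..<dB} \<times> {..<dE}) (entries dE (ext a x y))" by (rule psd_on_entries[OF psd[OF axy]])
    fix b b' assume "b < dB" "b' < dB"
    then show "(\<Sum>e<dE. entries dE (ext a x y) (b, e) (b', e)) = K y (\<rho> a x) $$ (b, b')"
      unfolding trace_on[OF axy, symmetric] ptrace_last by simp
  next
    fix x x' y u v assume *: "x < nX" "x' < nX" "y < nY" "u \<in> {..<dB} \<times> {..<dE}" "v \<in> {..<dB} \<times> {..<dE}"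
    have "msum (dB * dE) nA (\<lambda>a. ext a x y) = msum (dB * dE) nA (\<lambda>a. ext a x' y)"
      using ns * unfolding ns_ext_def by blast
    then have "entries dE (msum (dB * dE) nA (\<lambda>a. ext a x y)) u v = entries dE (msum (dB * dE) nA (\<lambda>a. ext a x' y)) u v"
      by simp
    then show "(\<Sum>a<nA. entries dE (ext a x y) u v) = (\<Sum>a<nA. entries dE (ext a x' y) u v)"
      unfolding entries_msum[OF *(4,5)] .
  qed
  with c' show "c \<in> ?R"
    by (intro CollectI exI[of _ dE] exI[of _ "\<lambda>a x y. entries dE (ext a x y)"] conjI)
next
  fix c assume "c \<in> ?R"
  then obtain dE f where c: "c = (\<Sum>y<nY. cmi_at nA nX dB dE (\<lambda>x. p x y) (\<lambda>a x. f a x y))"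
    and ns: "ns_ext_on nA nX nY (\<lambda>a x y. K y (\<rho> a x)) dB dE f"
    by (elim CollectE exE conjE) (rule that)
  define ext where "ext a x y = of_entries dB dE (f a x y)" for a x y
  have car: "ext a x y \<in> carrier_mat (dB * dE) (dB * dE)" for a x y by (simp add: ext_def of_entries_def)
  have ee: "entries dE (ext a x y) u v = f a x y u v" if "u \<in> {..<dB} \<times> {..<dE}" "v \<in> {..<dB} \<times> {..<dE}" for a x y u v
    unfolding ext_def using that by (rule entries_of_entries)
  have pf: "psd_on ({..<dB} \<times> {..<dE}) (f a x y)" if "a < nA" "x < nX" "y < nY" for a x y
    using ns that unfolding ns_ext_on_def by blast
  have psd: "psd (dB * dE) (ext a x y)" if "a < nA" "x < nX" "y < nY" for a x y
  proof (rule psd_of_entries[OF car])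
    have "psd_on ({..<dB} \<times> {..<dE}) (entries dE (ext a x y)) = psd_on ({..<dB} \<times> {..<dE}) (f a x y)"
      by (rule psd_on_cong) (rule ee)
    then show "psd_on ({..<dB} \<times> {..<dE}) (entries dE (ext a x y))" using pf[OF that] by simp
  qed
  have "ns_ext nA nX nY \<rho> dB dE K ext"
    unfolding ns_ext_def
  proof (intro conjI allI impI psd)
    show "0 < dE" using ns unfolding ns_ext_on_def by blast
    fix a x y assume axy: "a < nA" "x < nX" "y < nY"
    have "(\<Sum>e<dE. f a x y (b, e) (b', e)) = K y (\<rho> a x) $$ (b, b')" if "b < dB" "b' < dB" for b b'
      using ns axy that unfolding ns_ext_on_def by blast
    then show "ptrace_mid dB dE 1 (ext a x y) = K y (\<rho> a x)"
      unfolding ptrace_last using K[OF axy] by (intro eq_matI) (auto simp: ee)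
  next
    fix x x' y assume *: "x < nX" "x' < nX" "y < nY"
    show "msum (dB * dE) nA (\<lambda>a. ext a x y) = msum (dB * dE) nA (\<lambda>a. ext a x' y)"
    proof (rule eq_matI_entries)
      fix u v assume uv: "u \<in> {..<dB} \<times> {..<dE}" "v \<in> {..<dB} \<times> {..<dE}"
      have "(\<Sum>a<nA. f a x y u v) = (\<Sum>a<nA. f a x' y u v)"
        using ns * uv unfolding ns_ext_on_def by blast
      then show "entries dE (msum (dB * dE) nA (\<lambda>a. ext a x y)) u v = entries dE (msum (dB * dE) nA (\<lambda>a. ext a x' y)) u v"
        by (simp add: entries_msum[OF uv] ee[OF uv])
    qed (auto simp: msum_def)
  qed
  moreover have "c = cmi (nX * nA) dB (dE * nY) (ext_state nA nX nY dB dE p ext)"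
  proof -
    have "cmi (nX * nA) dB (dE * nY) (ext_state nA nX nY dB dE p ext) =
      (\<Sum>y<nY. cmi_at nA nX dB dE (\<lambda>x. p x y) (\<lambda>a x. entries dE (ext a x y)))"
      using p by (intro cmi_ext_state psd) (auto simp: cond_dist_def)
    moreover have "cond_ent {..<dB} {..<dE} (entries dE (ext a x y)) = cond_ent {..<dB} {..<dE} (f a x y)" for a x y
      by (rule cond_ent_cong) (rule ee)
    moreover have "cond_ent {..<dB} {..<dE} (\<lambda>u v. \<Sum>x<nX. \<Sum>a<nA. of_real (p x y) * entries dE (ext a x y) u v)
      = cond_ent {..<dB} {..<dE} (\<lambda>u v. \<Sum>x<nX. \<Sum>a<nA. of_real (p x y) * f a x y u v)" for y
      by (rule cond_ent_cong) (simp add: ee)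
    ultimately show ?thesis unfolding c cmi_at_def by simp
  qed
  ultimately show "c \<in> ?L" unfolding ext_cmis_def
    by (intro CollectI exI[of _ dE] exI[of _ ext] conjI)
qed

section \<open>Linear maps, instruments and the values attained by extensions\<close>

lemma lin_msum:
  assumes lin: "lin_map d d' \<Phi>" and f: "\<And>k. k < n \<Longrightarrow> f k \<in> carrier_mat d d"
  shows "\<Phi> (msum d n f) = msum d' n (\<lambda>k. \<Phi> (f k))"
  using f
proof (induction n)
  case 0
  \<comment> \<open>Linearity is stated with sums and scalars only; \<open>\<Phi>\<close> maps the
    empty sum to zero because the empty sum equals 0 times itself.\<close>
  have z: "msum d 0 f = 0 \<cdot>\<^sub>m msum d 0 f" by (intro eq_matI) (auto simp: msum_def)
  have c: "msum d 0 f \<in> carrier_mat d d" by (simp add: msum_def)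
  define Z where "Z = \<Phi> (msum d 0 f)"
  have Zc: "Z \<in> carrier_mat d' d'" using lin c unfolding lin_map_def Z_def by blast
  have "\<Phi> (0 \<cdot>\<^sub>m msum d 0 f) = 0 \<cdot>\<^sub>m Z" using lin c unfolding lin_map_def Z_def by blast
  then have Z: "Z = 0 \<cdot>\<^sub>m Z" using z unfolding Z_def by simp
  have "Z $$ (i, j) = 0" if "i < d'" "j < d'" for i j
    by (subst Z) (use that Zc in simp)
  then show ?case unfolding Z_def[symmetric] using Zc by (intro eq_matI) (auto simp: msum_def)
next
  case (Suc n)
  have "msum d (Suc n) f = msum d n f + f n"
    using Suc.prems[of n] by (intro eq_matI) (auto simp: msum_def)
  moreover have "msum d n f \<in> carrier_mat d d" by (simp add: msum_def)
  ultimately have "\<Phi> (msum d (Suc n) f) = \<Phi> (msum d n f) + \<Phi> (f n)"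
    using lin Suc.prems[of n] unfolding lin_map_def by simp
  also have "\<dots> = msum d' n (\<lambda>k. \<Phi> (f k)) + \<Phi> (f n)" using Suc by simp
  also have "\<dots> = msum d' (Suc n) (\<lambda>k. \<Phi> (f k))"
    using lin Suc.prems[of n] unfolding lin_map_def by (intro eq_matI) (auto simp: msum_def)
  finally show ?case .
qed

lemma lin_comb:
  assumes lin: "lin_map d d' \<Phi>" and f: "\<And>k. k < n \<Longrightarrow> f k \<in> carrier_mat d d"
  shows "\<Phi> (msum d n (\<lambda>k. c k \<cdot>\<^sub>m f k)) = msum d' n (\<lambda>k. c k \<cdot>\<^sub>m \<Phi> (f k))"
proof -
  have "\<Phi> (msum d n (\<lambda>k. c k \<cdot>\<^sub>m f k)) = msum d' n (\<lambda>k. \<Phi> (c k \<cdot>\<^sub>m f k))"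
    using f by (intro lin_msum[OF lin]) auto
  also have "\<dots> = msum d' n (\<lambda>k. c k \<cdot>\<^sub>m \<Phi> (f k))"
    using f lin unfolding lin_map_def msum_def by (intro eq_matI) auto
  finally show ?thesis .
qed

text \<open>Complete positivity with a one-dimensional ancilla.\<close>

lemma psd_cp_map:
  assumes cp: "cp_map d d' \<Phi>" and M: "psd d M"
  shows "psd d' (\<Phi> M)"
proof -
  have Mc: "M \<in> carrier_mat d d" using M psd_def by blast
  then have "mat d d (\<lambda>(k, l). M $$ (k, l)) = M" by (intro eq_matI) auto
  moreover have "\<Phi> M \<in> carrier_mat d' d'" using cp Mc unfolding cp_map_def lin_map_def by blast
  ultimately have "ampl 1 d d' \<Phi> M = \<Phi> M"
    unfolding ampl_def by (intro eq_matI) auto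
  moreover have "psd (1 * d') (ampl 1 d d' \<Phi> M)"
    using cp M unfolding cp_map_def by (metis mult_1)
  ultimately show ?thesis by simp
qed

lemma msum_carrier [simp]: "msum d n f \<in> carrier_mat d d"
  by (simp add: msum_def)

lemma psd_carrier: "psd d M \<Longrightarrow> M \<in> carrier_mat d d"
  by (simp add: psd_def)

lemma assemblage_carrier: "assemblage nA nX dB \<rho> \<Longrightarrow> a < nA \<Longrightarrow> x < nX \<Longrightarrow> \<rho> a x \<in> carrier_mat dB dB"
  unfolding assemblage_def using psd_carrier by blast

lemma instrument_carrier: "instrument nY dB dB' K \<Longrightarrow> y < nY \<Longrightarrow> M \<in> carrier_mat dB dB \<Longrightarrow> K y M \<in> carrier_mat dB' dB'"
  unfolding instrument_def cp_map_def lin_map_def by blast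

lemma instrument_lin: "instrument nY dB dB' K \<Longrightarrow> y < nY \<Longrightarrow> lin_map dB dB' (K y)"
  unfolding instrument_def cp_map_def by blast

lemma mtrace_msum: "(\<And>k. k < n \<Longrightarrow> f k \<in> carrier_mat d d) \<Longrightarrow> mtrace (msum d n f) = (\<Sum>k<n. mtrace (f k))"
proof -
  assume f: "\<And>k. k < n \<Longrightarrow> f k \<in> carrier_mat d d"
  have "mtrace (msum d n f) = (\<Sum>i<d. \<Sum>k<n. f k $$ (i, i))"
    by (simp add: mtrace_def msum_def)
  also have "\<dots> = (\<Sum>k<n. \<Sum>i<d. f k $$ (i, i))" by (rule sum.swap)
  also have "\<dots> = (\<Sum>k<n. mtrace (f k))"
    using f unfolding mtrace_def by (intro sum.cong refl) auto
  finally show ?thesis .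
qed

lemma ext_cmis_instrument:
  assumes as: "assemblage nA nX dB \<rho>" and K: "instrument nY dB dB' K" and p: "cond_dist nX nY p"
  shows "ext_cmis nA nX \<rho> nY dB' K p = {\<Sum>y<nY. cmi_at nA nX dB' dE (\<lambda>x. p x y) (\<lambda>a x. f a x y)
     | dE f. ns_ext_on nA nX nY (\<lambda>a x y. K y (\<rho> a x)) dB' dE f}"
  by (rule ext_cmis_eq[OF _ p]) (rule instrument_carrier[OF K _ assemblage_carrier[OF as]])

lemma ext_cmisI:
  assumes "assemblage nA nX dB \<rho>" "instrument nY dB dB' K" "cond_dist nX nY p"
    and "ns_ext_on nA nX nY (\<lambda>a x y. K y (\<rho> a x)) dB' dE f"
  shows "(\<Sum>y<nY. cmi_at nA nX dB' dE (\<lambda>x. p x y) (\<lambda>a x. f a x y)) \<in> ext_cmis nA nX \<rho> nY dB' K p"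
  unfolding ext_cmis_instrument[OF assms(1-3)]
  by (intro CollectI exI[of _ dE] exI[of _ f] conjI refl assms(4))

lemma ext_cmisE:
  assumes "assemblage nA nX dB \<rho>" "instrument nY dB dB' K" "cond_dist nX nY p"
    and "c \<in> ext_cmis nA nX \<rho> nY dB' K p"
  obtains dE f where "ns_ext_on nA nX nY (\<lambda>a x y. K y (\<rho> a x)) dB' dE f"
    "c = (\<Sum>y<nY. cmi_at nA nX dB' dE (\<lambda>x. p x y) (\<lambda>a x. f a x y))"
  using assms(4) unfolding ext_cmis_instrument[OF assms(1-3)]
  by (elim CollectE exE conjE) (rule that)

lemma ext_cmis_nonneg:
  assumes as: "assemblage nA nX dB \<rho>" and K: "instrument nY dB dB' K" and p: "cond_dist nX nY p"
    and c: "c \<in> ext_cmis nA nX \<rho> nY dB' K p"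
  shows "0 \<le> c"
proof -
  obtain dE f where c: "c = (\<Sum>y<nY. cmi_at nA nX dB' dE (\<lambda>x. p x y) (\<lambda>a x. f a x y))"
    and ns: "ns_ext_on nA nX nY (\<lambda>a x y. K y (\<rho> a x)) dB' dE f"
    using c by (rule ext_cmisE[OF as K p])
  show ?thesis unfolding c
    using ns p by (intro sum_nonneg cmi_at_nonneg) (auto simp: ns_ext_on_def cond_dist_def)
qed

text \<open>The extension with one-dimensional \<open>E\<close> bounds the infimum independently of Bob's
  instrument, which is what makes the supremum over instruments finite.\<close>
lemma ext_cmis_trivial:
  assumes as: "assemblage nA nX dB \<rho>" and K: "instrument nY dB dB' K" and p: "cond_dist nX nY p"
  shows "\<exists>c\<in>ext_cmis nA nX \<rho> nY dB' K p. c \<le> log 2 (real (nX * nA))"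
proof -
  define f where "f a x y u v = K y (\<rho> a x) $$ (fst u, fst v)" for a x y and u v :: "nat \<times> nat"
  have one: "{..<1::nat} = {0}" by auto
  have psd: "psd dB' (K y (\<rho> a x))" if "a < nA" "x < nX" "y < nY" for a x y
  proof (rule psd_cp_map[where \<Phi> = "K y" and d = dB])
    show "cp_map dB dB' (K y)" using K that unfolding instrument_def by blast
    show "psd dB (\<rho> a x)" using as that unfolding assemblage_def by blast
  qed
  have pf: "psd_on ({..<dB'} \<times> {..<1::nat}) (f a x y)" if "a < nA" "x < nX" "y < nY" for a x y
  proof -
    have "psd_on {..<dB'} (\<lambda>i j. K y (\<rho> a x) $$ (i, j))" using psd[OF that] by (simp add: psd_iff_psd_on)
    then show ?thesis unfolding f_def[abs_def] by (rule psd_on_reindex[rotated 2]) auto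
  qed
  obtain \<sigma> where \<sigma>: "density dB \<sigma>" "\<And>x. x < nX \<Longrightarrow> msum dB nA (\<lambda>a. \<rho> a x) = \<sigma>"
    using as unfolding assemblage_def by blast
  have \<sigma>c: "\<sigma> \<in> carrier_mat dB dB" using \<sigma>(1) psd_carrier unfolding density_def by blast
  have K\<sigma>: "msum dB' nA (\<lambda>a. K y (\<rho> a x)) = K y \<sigma>" if "x < nX" "y < nY" for x y
    unfolding \<sigma>(2)[OF that(1), symmetric]
    using assemblage_carrier[OF as] that by (intro lin_msum[symmetric] instrument_lin[OF K]) auto
  have fs: "(\<Sum>a<nA. f a x y u v) = K y \<sigma> $$ (fst u, fst v)"
    if "x < nX" "y < nY" "u \<in> {..<dB'} \<times> {..<1::nat}" "v \<in> {..<dB'} \<times> {..<1::nat}" for x y u v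
    unfolding K\<sigma>[OF that(1,2), symmetric] using that by (auto simp: msum_def f_def)
  have ns: "ns_ext_on nA nX nY (\<lambda>a x y. K y (\<rho> a x)) dB' 1 f"
    unfolding ns_ext_on_def using pf fs by (auto simp: f_def)
  have trf: "trace_on ({..<dB'} \<times> {0}) (\<lambda>u v. of_real q * f a x y u v) = q * Re (mtrace (K y (\<rho> a x)))"
    if "a < nA" "x < nX" "y < nY" for a x y q
    unfolding trace_on_def sum_Times using psd_carrier[OF psd[OF that]]
    by (auto simp: f_def mtrace_def sum_distrib_left)
  \<comment> \<open>By no-signalling the probability of outcome \<open>y\<close> does not depend on
    \<open>x\<close>, so the input distribution sums out. These probabilities add up to 1 in
    \<open>tot\<close>, because the instrument preserves the trace.\<close>
  have T: "(\<Sum>x<nX. \<Sum>a<nA. p x y * Re (mtrace (K y (\<rho> a x)))) = Re (mtrace (K y \<sigma>))" if y: "y < nY" for y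
  proof -
    have "(\<Sum>a<nA. p x y * Re (mtrace (K y (\<rho> a x)))) = p x y * Re (mtrace (K y \<sigma>))" if x: "x < nX" for x
      unfolding K\<sigma>[OF x y, symmetric] using psd_carrier[OF psd[OF _ x y]]
      by (subst mtrace_msum) (auto simp: sum_distrib_left)
    then have "(\<Sum>x<nX. \<Sum>a<nA. p x y * Re (mtrace (K y (\<rho> a x)))) = (\<Sum>x<nX. p x y * Re (mtrace (K y \<sigma>)))"
      by (intro sum.cong refl) simp
    also have "\<dots> = Re (mtrace (K y \<sigma>))"
      using p y unfolding cond_dist_def by (simp add: sum_distrib_right[symmetric])
    finally show ?thesis .
  qed
  have g: "cmi_at nA nX dB' 1 (\<lambda>x. p x y) (\<lambda>a x. f a x y) \<le> Re (mtrace (K y \<sigma>)) * log 2 (real (nX * nA))"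
    if y: "y < nY" for y
  proof -
    let ?A = "\<lambda>k u v. complex_of_real (p (fst k) y) * f (snd k) (fst k) y u v"
    have p0: "0 \<le> p x y" if "x < nX" for x using p that y unfolding cond_dist_def by blast
    have pA: "psd_on ({..<dB'} \<times> {0}) (?A k)" if "k \<in> {..<nX} \<times> {..<nA}" for k
      using that pf[unfolded one] p0 y by (intro psd_on_scale) auto
    have "cond_ent {..<dB'} {0} (\<lambda>u v. \<Sum>k\<in>{..<nX} \<times> {..<nA}. ?A k u v) - (\<Sum>k\<in>{..<nX} \<times> {..<nA}. cond_ent {..<dB'} {0} (?A k))
      \<le> (\<Sum>k\<in>{..<nX} \<times> {..<nA}. trace_on ({..<dB'} \<times> {0}) (?A k)) * log 2 (card ({..<nX} \<times> {..<nA}))"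
      by (rule holevo_cmi_at_le) (use pA in auto)
    moreover have "(\<Sum>k\<in>{..<nX} \<times> {..<nA}. cond_ent {..<dB'} {0} (?A k)) = (\<Sum>x<nX. \<Sum>a<nA. p x y * cond_ent {..<dB'} {0} (f a x y))"
      unfolding sum_Times using pf[unfolded one] p0 y by (intro sum.cong refl) (simp add: cond_ent_scale)
    moreover have "(\<Sum>k\<in>{..<nX} \<times> {..<nA}. trace_on ({..<dB'} \<times> {0}) (?A k)) = Re (mtrace (K y \<sigma>))"
      unfolding sum_Times T[OF y, symmetric] using y by (intro sum.cong refl) (simp add: trf)
    ultimately show ?thesis unfolding cmi_at_def one by (simp add: sum_Times card_cartesian_product)
  qed
  have tot: "(\<Sum>y<nY. Re (mtrace (K y \<sigma>))) = 1"
  proof -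
    have "mtrace (msum dB' nY (\<lambda>y. K y \<sigma>)) = mtrace \<sigma>"
      using K \<sigma>c unfolding instrument_def by blast
    then have "(\<Sum>y<nY. mtrace (K y \<sigma>)) = 1"
      using mtrace_msum[of nY "\<lambda>y. K y \<sigma>" dB'] instrument_carrier[OF K _ \<sigma>c] \<sigma>(1) unfolding density_def by simp
    then show ?thesis by (metis Re_sum one_complex.sel(1))
  qed
  have "(\<Sum>y<nY. cmi_at nA nX dB' 1 (\<lambda>x. p x y) (\<lambda>a x. f a x y)) \<le> (\<Sum>y<nY. Re (mtrace (K y \<sigma>)) * log 2 (real (nX * nA)))"
    using g by (intro sum_mono) auto
  also have "\<dots> = log 2 (real (nX * nA))" unfolding sum_distrib_right[symmetric] tot by simp
  finally show ?thesis using ext_cmisI[OF as K p ns] by (rule rev_bexI[rotated])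
qed

section \<open>Infimum over extensions and supremum over strategies\<close>

definition opt_cmi :: "nat \<Rightarrow> nat \<Rightarrow> (nat \<Rightarrow> nat \<Rightarrow> complex mat) \<Rightarrow> nat \<Rightarrow> nat \<Rightarrow>
    (nat \<Rightarrow> complex mat \<Rightarrow> complex mat) \<Rightarrow> (nat \<Rightarrow> nat \<Rightarrow> real) \<Rightarrow> real" where
  "opt_cmi nA nX \<rho> nY dB' K p = Inf (ext_cmis nA nX \<rho> nY dB' K p)"

text \<open>Strong subadditivity, in the form of \<open>ext_cmis_nonneg\<close>, supplies the lower
  bound without which a real infimum would be unspecified.\<close>

lemma opt_cmi_le:
  assumes "assemblage nA nX dB \<rho>" "instrument nY dB dB' K" "cond_dist nX nY p"
    and "c \<in> ext_cmis nA nX \<rho> nY dB' K p"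
  shows "opt_cmi nA nX \<rho> nY dB' K p \<le> c"
  unfolding opt_cmi_def using ext_cmis_nonneg[OF assms(1-3)] assms(4)
  by (intro cInf_lower bdd_belowI[of _ 0]) auto

lemma opt_cmi_greatest:
  assumes "assemblage nA nX dB \<rho>" "instrument nY dB dB' K" "cond_dist nX nY p"
    and "\<And>c. c \<in> ext_cmis nA nX \<rho> nY dB' K p \<Longrightarrow> b \<le> c"
  shows "b \<le> opt_cmi nA nX \<rho> nY dB' K p"
  unfolding opt_cmi_def using ext_cmis_trivial[OF assms(1-3)] assms(4)
  by (intro cInf_greatest) auto

lemma opt_cmi_approx:
  assumes "assemblage nA nX dB \<rho>" "instrument nY dB dB' K" "cond_dist nX nY p" and "0 < \<epsilon>"
  shows "\<exists>c\<in>ext_cmis nA nX \<rho> nY dB' K p. c < opt_cmi nA nX \<rho> nY dB' K p + \<epsilon>"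
  unfolding opt_cmi_def using ext_cmis_trivial[OF assms(1-3)] assms(4)
  by (intro cInf_lessD) auto

lemma steerability_eq:
  "steerability nA nX dB \<rho> =
    Sup {opt_cmi nA nX \<rho> nY dB' K p | nY dB' K p. instrument nY dB dB' K \<and> cond_dist nX nY p}"
  unfolding steerability_def opt_cmi_def ext_cmis_def ..

text \<open>The set of optimal values is bounded above by \<open>log 2 (real (nX * nA))\<close>,
  since each infimum is at most the value at the extension with trivial \<open>E\<close>.\<close>

lemma opt_cmi_le_steerability:
  assumes as: "assemblage nA nX dB \<rho>" and K: "instrument nY dB dB' K" and p: "cond_dist nX nY p"
  shows "opt_cmi nA nX \<rho> nY dB' K p \<le> steerability nA nX dB \<rho>"
  unfolding steerability_eq
proof (rule cSup_upper)
  show "bdd_above {opt_cmi nA nX \<rho> nY dB' K p | nY dB' K p. instrument nY dB dB' K \<and> cond_dist nX nY p}"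
  proof (rule bdd_aboveI)
    fix s assume "s \<in> {opt_cmi nA nX \<rho> nY dB' K p | nY dB' K p. instrument nY dB dB' K \<and> cond_dist nX nY p}"
    then obtain nY dB' K p where s: "s = opt_cmi nA nX \<rho> nY dB' K p"
      and Kp: "instrument nY dB dB' K" "cond_dist nX nY p" by blast
    obtain c where "c \<in> ext_cmis nA nX \<rho> nY dB' K p" "c \<le> log 2 (real (nX * nA))"
      using ext_cmis_trivial[OF as Kp] by blast
    then show "s \<le> log 2 (real (nX * nA))" unfolding s using opt_cmi_le[OF as Kp] by (meson order_trans)
  qed
qed (use K p in blast)

lemma instrument_exists: "\<exists>K. instrument 1 d d K"
proof -
  have "cp_map d d (\<lambda>M. M)"
  proof -
    have "ampl n d d (\<lambda>M. M) M = M" if M: "psd (n * d) M" for n M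
    proof (rule eq_matI)
      fix i j assume "i < dim_row M" "j < dim_col M"
      then have ij: "i < n * d" "j < n * d" using psd_carrier[OF M] by auto
      then have "d > 0" by (auto intro: gr_zeroI)
      then show "ampl n d d (\<lambda>M. M) M $$ (i, j) = M $$ (i, j)"
        unfolding ampl_def using ij by simp
    qed (use psd_carrier[OF M] in \<open>auto simp: ampl_def\<close>)
    then show ?thesis unfolding cp_map_def lin_map_def by auto
  qed
  moreover have "msum d 1 (\<lambda>y. M) = M" if "M \<in> carrier_mat d d" for M
    using that by (intro eq_matI) (auto simp: msum_def)
  ultimately show ?thesis unfolding instrument_def by (intro exI[of _ "\<lambda>_ M. M"]) auto
qed

lemma cond_dist_exists: "0 < nX \<Longrightarrow> \<exists>p. cond_dist nX nY p"
  by (intro exI[of _ "\<lambda>x y. if x = 0 then 1 else 0"]) (auto simp: cond_dist_def)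

lemma steerability_le:
  assumes as: "assemblage nA nX dB \<rho>"
    and le: "\<And>nY dB' K p. instrument nY dB dB' K \<Longrightarrow> cond_dist nX nY p \<Longrightarrow> opt_cmi nA nX \<rho> nY dB' K p \<le> b"
  shows "steerability nA nX dB \<rho> \<le> b"
  unfolding steerability_eq
proof (rule cSup_least)
  have "0 < nX" using as unfolding assemblage_def by blast
  then show "{opt_cmi nA nX \<rho> nY dB' K p | nY dB' K p. instrument nY dB dB' K \<and> cond_dist nX nY p} \<noteq> {}"
    using instrument_exists[of dB] cond_dist_exists[of nX 1] by blast
qed (use le in blast)

lemma steerability_approx:
  assumes as: "assemblage nA nX dB \<rho>" and e: "0 < \<epsilon>"
  shows "\<exists>nY dB' K p. instrument nY dB dB' K \<and> cond_dist nX nY p \<and>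
    steerability nA nX dB \<rho> - \<epsilon> < opt_cmi nA nX \<rho> nY dB' K p"
proof (rule ccontr)
  assume "\<not> ?thesis"
  then have "steerability nA nX dB \<rho> \<le> steerability nA nX dB \<rho> - \<epsilon>"
    by (intro steerability_le[OF as]) (meson not_le)
  then show False using e by simp
qed

lemma steerability_nonneg:
  assumes as: "assemblage nA nX dB \<rho>"
  shows "0 \<le> steerability nA nX dB \<rho>"
proof -
  have "0 < nX" using as unfolding assemblage_def by blast
  then obtain K p where Kp: "instrument 1 dB dB K" "cond_dist nX 1 p"
    using instrument_exists cond_dist_exists by blast
  have "0 \<le> opt_cmi nA nX \<rho> 1 dB K p"
    using ext_cmis_nonneg[OF as Kp] by (intro opt_cmi_greatest[OF as Kp])
  also have "\<dots> \<le> steerability nA nX dB \<rho>" by (rule opt_cmi_le_steerability[OF as Kp])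
  finally show ?thesis .
qed

subsection \<open>Unsteerable assemblages and convexity\<close>

text \<open>The label \<open>t\<close> can be read off from \<open>M\<close> alone, so
  \<open>B\<close> and its partial trace are block diagonal with the same labels, and the entropies
  of the blocks add in both terms.\<close>

lemma cond_ent_direct_sum:
  fixes \<phi> :: "'t \<Rightarrow> 's \<Rightarrow> 'm" and B :: "'l \<times> 'm \<Rightarrow> 'l \<times> 'm \<Rightarrow> complex"
  assumes fin: "finite L" "finite M" "finite T" "\<And>t. t \<in> T \<Longrightarrow> finite (S t)"
    and p: "\<And>t. t \<in> T \<Longrightarrow> psd_on (L \<times> S t) (A t)"
    and into: "\<And>t s. t \<in> T \<Longrightarrow> s \<in> S t \<Longrightarrow> \<phi> t s \<in> M"
    and inj: "\<And>t s t' s'. t \<in> T \<Longrightarrow> s \<in> S t \<Longrightarrow> t' \<in> T \<Longrightarrow> s' \<in> S t' \<Longrightarrow> \<phi> t s = \<phi> t' s' \<Longrightarrow> t = t' \<and> s = s'"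
    and surj: "\<And>m. m \<in> M \<Longrightarrow> \<exists>t\<in>T. \<exists>s\<in>S t. m = \<phi> t s"
    and entries: "\<And>l t s l' t' s'. l \<in> L \<Longrightarrow> t \<in> T \<Longrightarrow> s \<in> S t \<Longrightarrow> l' \<in> L \<Longrightarrow> t' \<in> T \<Longrightarrow> s' \<in> S t' \<Longrightarrow>
      B (l, \<phi> t s) (l', \<phi> t' s') = (if t = t' then A t (l, s) (l', s') else 0)"
  shows "psd_on (L \<times> M) B \<and> cond_ent L M B = (\<Sum>t\<in>T. cond_ent L (S t) (A t))"
proof -
  have 1: "psd_on (L \<times> M) B \<and> entropy_on (L \<times> M) B = (\<Sum>t\<in>T. entropy_on (L \<times> S t) (A t))"
  proof (rule block_spectral[where \<phi> = "\<lambda>t u. (fst u, \<phi> t (snd u))"])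
    fix x y assume "x \<in> L \<times> M" "y \<in> L \<times> M"
    then obtain l m l' m' where xy: "x = (l, m)" "y = (l', m')" "l \<in> L" "m \<in> M" "l' \<in> L" "m' \<in> M" by blast
    obtain t s t' s' where "t \<in> T" "s \<in> S t" "m = \<phi> t s" "t' \<in> T" "s' \<in> S t'" "m' = \<phi> t' s'"
      using surj[OF xy(4)] surj[OF xy(6)] by blast
    then show "(\<exists>t\<in>T. \<exists>u\<in>L \<times> S t. x = (fst u, \<phi> t (snd u))) \<and> (\<exists>t\<in>T. \<exists>u\<in>L \<times> S t. y = (fst u, \<phi> t (snd u)))"
      using xy by (intro conjI bexI[of _ t] bexI[of _ "(l, s)"] bexI[of _ t'] bexI[of _ "(l', s')"]) auto
  next
    fix t u t' u' assume *: "t \<in> T" "u \<in> L \<times> S t" "t' \<in> T" "u' \<in> L \<times> S t'"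
    show "B (fst u, \<phi> t (snd u)) (fst u', \<phi> t' (snd u')) = (if t = t' then A t u u' else 0)"
      using * entries[of "fst u" t "snd u" "fst u'" t' "snd u'"] by auto
    show "t = t' \<and> u = u'" if "(fst u, \<phi> t (snd u)) = (fst u', \<phi> t' (snd u'))"
      using * that inj[of t "snd u" t' "snd u'"] by (auto simp: prod_eq_iff)
  qed (use fin p into in auto)
  have "psd_on M (ptrace L B) \<and> entropy_on M (ptrace L B) = (\<Sum>t\<in>T. entropy_on (S t) (ptrace L (A t)))"
  proof (rule block_spectral[where \<phi> = \<phi>])
    fix x y assume "x \<in> M" "y \<in> M"
    then show "(\<exists>t\<in>T. \<exists>s\<in>S t. x = \<phi> t s) \<and> (\<exists>t\<in>T. \<exists>s\<in>S t. y = \<phi> t s)" using surj by blast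
  next
    fix t s t' s' assume "t \<in> T" "s \<in> S t" "t' \<in> T" "s' \<in> S t'"
    then show "ptrace L B (\<phi> t s) (\<phi> t' s') = (if t = t' then ptrace L (A t) s s' else 0)"
      unfolding ptrace_def using entries by (auto intro!: sum.cong sum.neutral)
  qed (use fin into inj in \<open>auto intro!: psd_on_ptrace p\<close>)
  with 1 show ?thesis unfolding cond_ent_def by (simp add: sum_subtractf)
qed

text \<open>A classical-quantum operator: the sum over \<open>e\<close> of \<open>c e\<close> times
  \<open>N e \<otimes> |e><e|\<close>, with the classical register in the second factor.\<close>

definition cq_op :: "('e \<Rightarrow> real) \<Rightarrow> ('e \<Rightarrow> 'b \<Rightarrow> 'b \<Rightarrow> complex) \<Rightarrow> 'b \<times> 'e \<Rightarrow> 'b \<times> 'e \<Rightarrow> complex" where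
  "cq_op c N u v = (if snd u = snd v then of_real (c (snd u)) * N (snd u) (fst u) (fst v) else 0)"

lemma cond_ent_cq_op:
  fixes N :: "'e \<Rightarrow> 'b \<Rightarrow> 'b \<Rightarrow> complex"
  assumes fin: "finite L" "finite M" and N: "\<And>e. e \<in> M \<Longrightarrow> psd_on L (N e)" and c: "\<And>e. e \<in> M \<Longrightarrow> 0 \<le> c e"
  shows "psd_on (L \<times> M) (cq_op c N) \<and>
    cond_ent L M (cq_op c N) = (\<Sum>e\<in>M. c e * cond_ent L {()} (\<lambda>u v. N e (fst u) (fst v)))"
proof -
  have pN: "psd_on (L \<times> {()}) (\<lambda>u v. N e (fst u) (fst v))" if "e \<in> M" for e
    by (rule psd_on_reindex[OF fin(1) _ N[OF that]]) (use fin in auto)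
  have "psd_on (L \<times> M) (cq_op c N) \<and>
    cond_ent L M (cq_op c N) = (\<Sum>e\<in>M. cond_ent L {()} (\<lambda>u v. of_real (c e) * N e (fst u) (fst v)))"
    by (rule cond_ent_direct_sum[where \<phi> = "\<lambda>e _. e"]) (use fin c pN in \<open>auto simp: cq_op_def intro!: psd_on_scale\<close>)
  moreover have "cond_ent L {()} (\<lambda>u v. of_real (c e) * N e (fst u) (fst v)) = c e * cond_ent L {()} (\<lambda>u v. N e (fst u) (fst v))"
    if "e \<in> M" for e
    by (rule cond_ent_scale) (use fin pN c that in auto)
  ultimately show ?thesis by simp
qed

text \<open>Once \<open>E\<close> carries the hidden variable, \<open>a\<close> and \<open>x\<close>
  enter only through the weights of a classical-quantum operator. Since
  \<open>cond_ent_cq_op\<close> is linear in these weights, the superadditivity gap is zero for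
  every input distribution.\<close>

lemma unsteerable_ext_cmi:
  assumes as: "assemblage nA nX dB \<rho>" and K: "instrument nY dB dB' K" and p: "cond_dist nX nY p"
    and pL: "\<And>l. l < nL \<Longrightarrow> 0 \<le> pL l" "(\<Sum>l<nL. pL l) = 1"
    and pA: "\<And>x l a. x < nX \<Longrightarrow> l < nL \<Longrightarrow> a < nA \<Longrightarrow> 0 \<le> pA a x l"
      "\<And>x l. x < nX \<Longrightarrow> l < nL \<Longrightarrow> (\<Sum>a<nA. pA a x l) = 1"
    and \<sigma>: "\<And>l. l < nL \<Longrightarrow> psd dB (\<sigma> l)"
    and \<rho>: "\<And>a x. a < nA \<Longrightarrow> x < nX \<Longrightarrow> \<rho> a x = msum dB nL (\<lambda>l. of_real (pL l * pA a x l) \<cdot>\<^sub>m \<sigma> l)"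
  shows "0 \<in> ext_cmis nA nX \<rho> nY dB' K p"
proof -
  let ?L = "{..<dB'}" and ?M = "{..<nL}"
  define N where "N y l i j = K y (\<sigma> l) $$ (i, j)" for y l i j
  define f where "f a x y = cq_op (\<lambda>l. pL l * pA a x l) (N y)" for a x y
  have psd: "psd dB' (K y (\<sigma> l))" if "y < nY" "l < nL" for y l
  proof (rule psd_cp_map[where \<Phi> = "K y" and d = dB])
    show "cp_map dB dB' (K y)" using K that unfolding instrument_def by blast
  qed (rule \<sigma>[OF that(2)])
  have pN: "psd_on ?L (N y l)" if "y < nY" "l < nL" for y l
    using psd[OF that] unfolding N_def[abs_def] by (simp add: psd_iff_psd_on)
  have c0: "0 \<le> pL l * pA a x l" if "a < nA" "x < nX" "l < nL" for a x l
    using pL(1) pA(1) that by simp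
  have K\<rho>: "K y (\<rho> a x) $$ (b, b') = (\<Sum>l<nL. of_real (pL l * pA a x l) * N y l b b')"
    if "a < nA" "x < nX" "y < nY" "b < dB'" "b' < dB'" for a x y b b'
  proof -
    have "K y (\<rho> a x) = msum dB' nL (\<lambda>l. of_real (pL l * pA a x l) \<cdot>\<^sub>m K y (\<sigma> l))"
      unfolding \<rho>[OF that(1,2)] by (rule lin_comb[OF instrument_lin[OF K that(3)]]) (use \<sigma> psd_carrier in blast)
    moreover have "dim_row (K y (\<sigma> l)) = dB'" "dim_col (K y (\<sigma> l)) = dB'" if "l < nL" for l
      using psd_carrier[OF psd[OF \<open>y < nY\<close> that]] by auto
    ultimately show ?thesis using that by (auto simp: msum_def N_def intro!: sum.cong)
  qed
  have ns: "ns_ext_on nA nX nY (\<lambda>a x y. K y (\<rho> a x)) dB' nL f"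
    unfolding ns_ext_on_def
  proof (intro conjI allI impI ballI)
    show "0 < nL" using pL(2) by (auto intro: gr_zeroI)
    fix a x y assume axy: "a < nA" "x < nX" "y < nY"
    show "psd_on (?L \<times> ?M) (f a x y)"
      unfolding f_def by (rule cond_ent_cq_op[THEN conjunct1]) (use pN c0 axy in auto)
    fix b b' assume "b < dB'" "b' < dB'"
    then show "(\<Sum>e<nL. f a x y (b, e) (b', e)) = K y (\<rho> a x) $$ (b, b')"
      using axy by (simp add: K\<rho> f_def cq_op_def)
  next
    fix x x' y u v assume xy: "x < nX" "x' < nX" "y < nY" "u \<in> ?L \<times> ?M" "v \<in> ?L \<times> ?M"
    have "(\<Sum>a<nA. f a x y u v) = (if snd u = snd v then of_real (pL (snd u)) * N y (snd u) (fst u) (fst v) else 0)"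
      if "x < nX" for x
    proof -
      have "(\<Sum>a<nA. f a x y u v) = (if snd u = snd v then
          of_real (\<Sum>a<nA. pL (snd u) * pA a x (snd u)) * N y (snd u) (fst u) (fst v) else 0)"
        unfolding f_def cq_op_def by (simp add: sum_distrib_right)
      moreover have "(\<Sum>a<nA. pL (snd u) * pA a x (snd u)) = pL (snd u)"
        \<comment> \<open>Normalisation of the response functions removes the dependence on
          \<open>x\<close>; this is no-signalling of the extension.\<close>
        using pA(2)[OF that, of "snd u"] xy by (auto simp: sum_distrib_left[symmetric])
      ultimately show ?thesis by (simp only:)
    qed
    then show "(\<Sum>a<nA. f a x y u v) = (\<Sum>a<nA. f a x' y u v)" using xy by simp
  qed
  have "cmi_at nA nX dB' nL (\<lambda>x. p x y) (\<lambda>a x. f a x y) = 0" if y: "y < nY" for y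
  proof -
    let ?c = "\<lambda>l. \<Sum>x<nX. \<Sum>a<nA. p x y * (pL l * pA a x l)"
    let ?g = "\<lambda>l. cond_ent ?L {()} (\<lambda>u v. N y l (fst u) (fst v))"
    have p0: "0 \<le> p x y" if "x < nX" for x using p that y unfolding cond_dist_def by blast
    have tot: "(\<lambda>u v. \<Sum>x<nX. \<Sum>a<nA. of_real (p x y) * f a x y u v) = cq_op ?c (N y)"
      unfolding f_def cq_op_def by (intro HOL.ext) (simp add: sum_distrib_right sum_distrib_left mult.assoc)
    have "cond_ent ?L ?M (cq_op ?c (N y)) = (\<Sum>l<nL. ?c l * ?g l)"
      by (rule cond_ent_cq_op[THEN conjunct2]) (use pN y p0 pL(1) pA(1) in \<open>auto intro!: sum_nonneg mult_nonneg_nonneg\<close>)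
    also have "\<dots> = (\<Sum>l<nL. \<Sum>x<nX. \<Sum>a<nA. p x y * (pL l * pA a x l * ?g l))"
      by (simp add: sum_distrib_right mult.assoc)
    also have "\<dots> = (\<Sum>x<nX. \<Sum>l<nL. \<Sum>a<nA. p x y * (pL l * pA a x l * ?g l))" by (rule sum.swap)
    also have "\<dots> = (\<Sum>x<nX. \<Sum>a<nA. p x y * (\<Sum>l<nL. pL l * pA a x l * ?g l))"
      unfolding sum_distrib_left by (subst (2) sum.swap) (rule refl)
    also have "\<dots> = (\<Sum>x<nX. \<Sum>a<nA. p x y * cond_ent ?L ?M (f a x y))"
      unfolding f_def using pN y c0 by (intro sum.cong refl arg_cong2[where f = "(*)"] cond_ent_cq_op[THEN conjunct2, symmetric]) auto
    finally show ?thesis unfolding cmi_at_def tot by simp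
  qed
  then have "(\<Sum>y<nY. cmi_at nA nX dB' nL (\<lambda>x. p x y) (\<lambda>a x. f a x y)) = 0" by simp
  with ext_cmisI[OF as K p ns] show ?thesis by simp
qed

lemma steerability_unsteerable:
  assumes as: "assemblage nA nX dB \<rho>"
    and pL: "\<And>l. l < nL \<Longrightarrow> 0 \<le> pL l" "(\<Sum>l<nL. pL l) = 1"
    and pA: "\<And>x l a. x < nX \<Longrightarrow> l < nL \<Longrightarrow> a < nA \<Longrightarrow> 0 \<le> pA a x l"
      "\<And>x l. x < nX \<Longrightarrow> l < nL \<Longrightarrow> (\<Sum>a<nA. pA a x l) = 1"
    and \<sigma>: "\<And>l. l < nL \<Longrightarrow> psd dB (\<sigma> l)"
    and \<rho>: "\<And>a x. a < nA \<Longrightarrow> x < nX \<Longrightarrow> \<rho> a x = msum dB nL (\<lambda>l. of_real (pL l * pA a x l) \<cdot>\<^sub>m \<sigma> l)"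
  shows "steerability nA nX dB \<rho> = 0"
proof (rule antisym)
  show "steerability nA nX dB \<rho> \<le> 0"
  proof (rule steerability_le[OF as])
    fix nY dB' K p assume Kp: "instrument nY dB dB' K" "cond_dist nX nY p"
    have "0 \<in> ext_cmis nA nX \<rho> nY dB' K p"
      by (rule unsteerable_ext_cmi[OF as Kp pL pA \<sigma> \<rho>])
    then show "opt_cmi nA nX \<rho> nY dB' K p \<le> 0" by (rule opt_cmi_le[OF as Kp])
  qed
qed (rule steerability_nonneg[OF as])

section \<open>Direct sums of extensions and convexity\<close>

definition dsum :: "nat \<Rightarrow> ('b \<times> nat \<Rightarrow> 'b \<times> nat \<Rightarrow> complex) \<Rightarrow> ('b \<times> nat \<Rightarrow> 'b \<times> nat \<Rightarrow> complex) \<Rightarrow>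
    'b \<times> nat \<Rightarrow> 'b \<times> nat \<Rightarrow> complex" where
  "dsum d A B u v = (if snd u < d \<and> snd v < d then A u v
     else if d \<le> snd u \<and> d \<le> snd v then B (fst u, snd u - d) (fst v, snd v - d) else 0)"

lemma cond_ent_dsum:
  assumes fin: "finite L" and A: "psd_on (L \<times> {..<d1}) A" and B: "psd_on (L \<times> {..<d2}) B"
  shows "psd_on (L \<times> {..<d1 + d2}) (dsum d1 A B) \<and>
    cond_ent L {..<d1 + d2} (dsum d1 A B) = cond_ent L {..<d1} A + cond_ent L {..<d2} B"
proof -
  have "psd_on (L \<times> {..<d1 + d2}) (dsum d1 A B) \<and>
    cond_ent L {..<d1 + d2} (dsum d1 A B) = (\<Sum>t\<in>{False, True}. cond_ent L (if t then {..<d2} else {..<d1}) (if t then B else A))"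
  proof (rule cond_ent_direct_sum[where \<phi> = "\<lambda>t s. if t then d1 + s else s"])
    fix m assume m: "m \<in> {..<d1 + d2}"
    show "\<exists>t\<in>{False, True}. \<exists>s\<in>if t then {..<d2} else {..<d1}. m = (if t then d1 + s else s)"
    proof (cases "m < d1")
      case False
      then show ?thesis using m by (intro bexI[of _ True] bexI[of _ "m - d1"]) auto
    qed auto
  qed (use fin A B in \<open>auto simp: dsum_def split: if_splits\<close>)
  then show ?thesis by simp
qed

text \<open>Equality holds because the flag telling the two extensions apart lies in the
  conditioning system \<open>E\<close>: both the total operator and each individual one are direct
  sums.\<close>

lemma cmi_at_dsum:
  assumes 1: "\<And>x a. x < nX \<Longrightarrow> a < nA \<Longrightarrow> psd_on ({..<dB} \<times> {..<d1}) (f1 a x)"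
    and 2: "\<And>x a. x < nX \<Longrightarrow> a < nA \<Longrightarrow> psd_on ({..<dB} \<times> {..<d2}) (f2 a x)"
    and q: "\<And>x. x < nX \<Longrightarrow> 0 \<le> q x" and s: "0 \<le> s1" "0 \<le> s2"
  shows "cmi_at nA nX dB (d1 + d2) q (\<lambda>a x. dsum d1 (\<lambda>u v. of_real s1 * f1 a x u v) (\<lambda>u v. of_real s2 * f2 a x u v))
    = s1 * cmi_at nA nX dB d1 q f1 + s2 * cmi_at nA nX dB d2 q f2"
proof -
  let ?L = "{..<dB}"
  define t where "t N u v = (\<Sum>x<nX. \<Sum>a<nA. complex_of_real (q x) * N a x u v)" for N and u v :: "nat \<times> nat"
  have pt: "psd_on (?L \<times> {..<d}) (t N)" if "\<And>x a. x < nX \<Longrightarrow> a < nA \<Longrightarrow> psd_on (?L \<times> {..<d}) (N a x)" for N d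
    unfolding t_def[abs_def] using that q by (intro psd_on_sum psd_on_scale) auto
  have tot: "(\<lambda>u v. \<Sum>x<nX. \<Sum>a<nA. of_real (q x) * dsum d1 (\<lambda>u v. of_real s1 * f1 a x u v) (\<lambda>u v. of_real s2 * f2 a x u v) u v)
     = dsum d1 (\<lambda>u v. of_real s1 * t f1 u v) (\<lambda>u v. of_real s2 * t f2 u v)"
  proof (intro HOL.ext)
    fix u v :: "nat \<times> nat"
    show "(\<Sum>x<nX. \<Sum>a<nA. of_real (q x) * dsum d1 (\<lambda>u v. of_real s1 * f1 a x u v) (\<lambda>u v. of_real s2 * f2 a x u v) u v)
      = dsum d1 (\<lambda>u v. of_real s1 * t f1 u v) (\<lambda>u v. of_real s2 * t f2 u v) u v"
      by (cases "snd u < d1"; cases "snd v < d1")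
        (simp_all add: dsum_def t_def sum_distrib_left mult.left_commute)
  qed
  have c: "cond_ent ?L {..<d1 + d2} (dsum d1 (\<lambda>u v. of_real s1 * A u v) (\<lambda>u v. of_real s2 * B u v))
      = s1 * cond_ent ?L {..<d1} A + s2 * cond_ent ?L {..<d2} B"
    if A: "psd_on (?L \<times> {..<d1}) A" and B: "psd_on (?L \<times> {..<d2}) B" for A B
    using cond_ent_dsum[OF _ psd_on_scale[OF A s(1)] psd_on_scale[OF B s(2)]] cond_ent_scale[OF _ _ A s(1)] cond_ent_scale[OF _ _ B s(2)]
    by simp
  have "(\<Sum>x<nX. \<Sum>a<nA. q x * cond_ent ?L {..<d1 + d2} (dsum d1 (\<lambda>u v. of_real s1 * f1 a x u v) (\<lambda>u v. of_real s2 * f2 a x u v)))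
     = (\<Sum>x<nX. \<Sum>a<nA. s1 * (q x * cond_ent ?L {..<d1} (f1 a x)) + s2 * (q x * cond_ent ?L {..<d2} (f2 a x)))"
    using c[OF 1 2] by (intro sum.cong refl) (simp add: algebra_simps)
  also have "\<dots> = s1 * (\<Sum>x<nX. \<Sum>a<nA. q x * cond_ent ?L {..<d1} (f1 a x)) + s2 * (\<Sum>x<nX. \<Sum>a<nA. q x * cond_ent ?L {..<d2} (f2 a x))"
    by (simp add: sum.distrib sum_distrib_left)
  finally have s: "(\<Sum>x<nX. \<Sum>a<nA. q x * cond_ent ?L {..<d1 + d2} (dsum d1 (\<lambda>u v. of_real s1 * f1 a x u v) (\<lambda>u v. of_real s2 * f2 a x u v)))
     = s1 * (\<Sum>x<nX. \<Sum>a<nA. q x * cond_ent ?L {..<d1} (f1 a x)) + s2 * (\<Sum>x<nX. \<Sum>a<nA. q x * cond_ent ?L {..<d2} (f2 a x))" .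
  have t: "cond_ent ?L {..<d1 + d2} (dsum d1 (\<lambda>u v. of_real s1 * t f1 u v) (\<lambda>u v. of_real s2 * t f2 u v))
      = s1 * cond_ent ?L {..<d1} (t f1) + s2 * cond_ent ?L {..<d2} (t f2)"
    by (rule c[OF pt pt]) (use 1 2 in auto)
  have g: "cmi_at nA nX dB d q N = cond_ent ?L {..<d} (t N) - (\<Sum>x<nX. \<Sum>a<nA. q x * cond_ent ?L {..<d} (N a x))" for d N
    unfolding cmi_at_def t_def[abs_def] ..
  show ?thesis
    unfolding cmi_at_def[of _ _ _ "d1 + d2"] tot s t g[of d1] g[of d2] by (simp only: right_diff_distrib)
qed

lemma psd_on_add: "psd_on I A \<Longrightarrow> psd_on I B \<Longrightarrow> psd_on I (\<lambda>x y. A x y + B x y)"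
proof -
  have "sesq I (\<lambda>x y. A x y + B x y) u u = sesq I A u u + sesq I B u u" for u
    unfolding sesq_def by (simp add: distrib_left distrib_right sum.distrib)
  then show "psd_on I A \<Longrightarrow> psd_on I B \<Longrightarrow> psd_on I (\<lambda>x y. A x y + B x y)"
    unfolding psd_on_def by simp
qed

lemma psd_combination:
  assumes M: "psd d M" and N: "psd d N" and s: "0 \<le> s" "0 \<le> t"
  shows "psd d (of_real s \<cdot>\<^sub>m M + of_real t \<cdot>\<^sub>m N)"
proof -
  have c: "M \<in> carrier_mat d d" "N \<in> carrier_mat d d" using M N psd_carrier by auto
  have "psd_on {..<d} (\<lambda>i j. of_real s * M $$ (i, j) + of_real t * N $$ (i, j))"
    using M N s by (intro psd_on_add psd_on_scale) (auto simp: psd_iff_psd_on)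
  moreover have "psd_on {..<d} (\<lambda>i j. of_real s * M $$ (i, j) + of_real t * N $$ (i, j)) =
      psd_on {..<d} (\<lambda>i j. (of_real s \<cdot>\<^sub>m M + of_real t \<cdot>\<^sub>m N) $$ (i, j))"
    by (rule psd_on_cong) (use c in auto)
  ultimately show ?thesis using c by (simp add: psd_iff_psd_on)
qed

lemma assemblage_mixture:
  assumes \<rho>: "assemblage nA nX dB \<rho>" and \<sigma>: "assemblage nA nX dB \<sigma>" and t: "0 \<le> t" "t \<le> 1"
  shows "assemblage nA nX dB (\<lambda>a x. of_real t \<cdot>\<^sub>m \<rho> a x + of_real (1 - t) \<cdot>\<^sub>m \<sigma> a x)"
proof -
  obtain R where R: "density dB R" "\<And>x. x < nX \<Longrightarrow> msum dB nA (\<lambda>a. \<rho> a x) = R"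
    using \<rho> unfolding assemblage_def by blast
  obtain S where S: "density dB S" "\<And>x. x < nX \<Longrightarrow> msum dB nA (\<lambda>a. \<sigma> a x) = S"
    using \<sigma> unfolding assemblage_def by blast
  let ?T = "complex_of_real t \<cdot>\<^sub>m R + complex_of_real (1 - t) \<cdot>\<^sub>m S"
  have c: "R \<in> carrier_mat dB dB" "S \<in> carrier_mat dB dB" using R S psd_carrier unfolding density_def by blast+
  have "mtrace ?T = of_real t * mtrace R + of_real (1 - t) * mtrace S"
    unfolding mtrace_def using c by (simp add: sum.distrib sum_distrib_left del: of_real_diff)
  moreover have "psd dB ?T"
    using R(1) S(1) t unfolding density_def by (intro psd_combination) auto
  ultimately have "density dB ?T" using R(1) S(1) unfolding density_def by simp
  moreover have "msum dB nA (\<lambda>a. of_real t \<cdot>\<^sub>m \<rho> a x + of_real (1 - t) \<cdot>\<^sub>m \<sigma> a x) = ?T" if x: "x < nX" for x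
  proof -
    have car: "\<rho> a x \<in> carrier_mat dB dB" "\<sigma> a x \<in> carrier_mat dB dB" if "a < nA" for a
      using assemblage_carrier[OF \<rho> that x] assemblage_carrier[OF \<sigma> that x] .
    have "(\<Sum>a<nA. (complex_of_real t \<cdot>\<^sub>m \<rho> a x + complex_of_real (1 - t) \<cdot>\<^sub>m \<sigma> a x) $$ (i, j))
        = (\<Sum>a<nA. of_real t * \<rho> a x $$ (i, j) + of_real (1 - t) * \<sigma> a x $$ (i, j))"
      if "i < dB" "j < dB" for i j
      using that car[THEN carrier_matD(1)] car[THEN carrier_matD(2)]
      by (intro sum.cong refl) (simp del: of_real_diff)
    then show ?thesis
      unfolding R(2)[OF x, symmetric] S(2)[OF x, symmetric]
      by (intro eq_matI) (simp_all add: msum_def sum.distrib sum_distrib_left del: of_real_diff)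
  qed
  ultimately show ?thesis
    using \<rho> \<sigma> t unfolding assemblage_def by (intro conjI allI impI exI[of _ ?T] psd_combination) auto
qed

lemma sum_lessThan_add: "(\<Sum>e<m + n. f e) = (\<Sum>e<m. f e) + (\<Sum>e<n. f (m + e))" for m n :: nat
  by (induction n) (simp_all add: add.assoc)


lemma ext_cmis_mixture:
  assumes \<rho>: "assemblage nA nX dB \<rho>" and \<sigma>: "assemblage nA nX dB \<sigma>" and t: "0 \<le> t" "t \<le> 1"
    and K: "instrument nY dB dB' K" and p: "cond_dist nX nY p"
    and c1: "c1 \<in> ext_cmis nA nX \<rho> nY dB' K p" and c2: "c2 \<in> ext_cmis nA nX \<sigma> nY dB' K p"
  shows "t * c1 + (1 - t) * c2 \<in>
    ext_cmis nA nX (\<lambda>a x. of_real t \<cdot>\<^sub>m \<rho> a x + of_real (1 - t) \<cdot>\<^sub>m \<sigma> a x) nY dB' K p"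
proof -
  let ?L = "{..<dB'}"
  obtain d1 f1 where 1: "ns_ext_on nA nX nY (\<lambda>a x y. K y (\<rho> a x)) dB' d1 f1"
    and c1: "c1 = (\<Sum>y<nY. cmi_at nA nX dB' d1 (\<lambda>x. p x y) (\<lambda>a x. f1 a x y))"
    using c1 by (rule ext_cmisE[OF \<rho> K p])
  obtain d2 f2 where 2: "ns_ext_on nA nX nY (\<lambda>a x y. K y (\<sigma> a x)) dB' d2 f2"
    and c2: "c2 = (\<Sum>y<nY. cmi_at nA nX dB' d2 (\<lambda>x. p x y) (\<lambda>a x. f2 a x y))"
    using c2 by (rule ext_cmisE[OF \<sigma> K p])
  note p1 = ns_ext_on_psd_on[OF 1] and p2 = ns_ext_on_psd_on[OF 2] and t1 = ns_ext_on_ptrace[OF 1] and t2 = ns_ext_on_ptrace[OF 2]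
    and n1 = ns_ext_on_no_signalling[OF 1] and n2 = ns_ext_on_no_signalling[OF 2]
  define f where "f a x y = dsum d1 (\<lambda>u v. of_real t * f1 a x y u v) (\<lambda>u v. of_real (1 - t) * f2 a x y u v)" for a x y
  let ?\<tau> = "\<lambda>a x. of_real t \<cdot>\<^sub>m \<rho> a x + of_real (1 - t) \<cdot>\<^sub>m \<sigma> a x"
  have t': "0 \<le> 1 - t" using t by simp
  have K\<tau>: "K y (?\<tau> a x) = of_real t \<cdot>\<^sub>m K y (\<rho> a x) + of_real (1 - t) \<cdot>\<^sub>m K y (\<sigma> a x)"
    if "a < nA" "x < nX" "y < nY" for a x y
    using instrument_lin[OF K that(3)] assemblage_carrier[OF \<rho> that(1,2)] assemblage_carrier[OF \<sigma> that(1,2)]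
    unfolding lin_map_def by (simp del: of_real_diff)
  have "ns_ext_on nA nX nY (\<lambda>a x y. K y (?\<tau> a x)) dB' (d1 + d2) f"
    unfolding ns_ext_on_def
  proof (intro conjI allI impI ballI)
    show "0 < d1 + d2" using 1 unfolding ns_ext_on_def by simp
    fix a x y assume axy: "a < nA" "x < nX" "y < nY"
    show "psd_on (?L \<times> {..<d1 + d2}) (f a x y)"
      unfolding f_def using cond_ent_dsum[OF _ psd_on_scale[OF p1[OF axy] t(1)] psd_on_scale[OF p2[OF axy] t']] by simp
    fix b b' assume b: "b < dB'" "b' < dB'"
    have "(\<Sum>e<d1 + d2. f a x y (b, e) (b', e)) =
        of_real t * (\<Sum>e<d1. f1 a x y (b, e) (b', e)) + of_real (1 - t) * (\<Sum>e<d2. f2 a x y (b, e) (b', e))"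
      unfolding sum_lessThan_add by (simp add: f_def dsum_def sum_distrib_left del: of_real_diff)
    then show "(\<Sum>e<d1 + d2. f a x y (b, e) (b', e)) = K y (?\<tau> a x) $$ (b, b')"
      unfolding K\<tau>[OF axy] t1[OF axy b] t2[OF axy b]
      using instrument_carrier[OF K axy(3) assemblage_carrier[OF \<rho> axy(1,2)]]
        instrument_carrier[OF K axy(3) assemblage_carrier[OF \<sigma> axy(1,2)]] b
      by (simp del: of_real_diff)
  next
    fix x x' y u v assume *: "x < nX" "x' < nX" "y < nY" "u \<in> ?L \<times> {..<d1 + d2}" "v \<in> ?L \<times> {..<d1 + d2}"
    obtain b e b' e' where uv: "u = (b, e)" "v = (b', e')" by (cases u; cases v)
    have "(\<Sum>a<nA. f a x y u v) = dsum d1 (\<lambda>u v. of_real t * (\<Sum>a<nA. f1 a x y u v)) (\<lambda>u v. of_real (1 - t) * (\<Sum>a<nA. f2 a x y u v)) u v"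
      for x unfolding f_def dsum_def
      by (cases "snd u < d1"; cases "snd v < d1") (simp_all add: sum_distrib_left del: of_real_diff)
    \<comment> \<open>For an index of the first block, \<open>e - d1\<close> is truncated to 0;
      positivity of \<open>d2\<close> keeps it in range.\<close>
    moreover have "0 < d2" using 2 unfolding ns_ext_on_def by simp
    then have "e - d1 < d2" "e' - d1 < d2" using * unfolding uv by auto
    ultimately show "(\<Sum>a<nA. f a x y u v) = (\<Sum>a<nA. f a x' y u v)"
      using * n1[OF *(1-3), of u v] n2[OF *(1-3), of "(b, e - d1)" "(b', e' - d1)"]
      unfolding uv dsum_def by (auto simp del: of_real_diff)
  qed
  moreover have "cmi_at nA nX dB' (d1 + d2) (\<lambda>x. p x y) (\<lambda>a x. f a x y)
     = t * cmi_at nA nX dB' d1 (\<lambda>x. p x y) (\<lambda>a x. f1 a x y) + (1 - t) * cmi_at nA nX dB' d2 (\<lambda>x. p x y) (\<lambda>a x. f2 a x y)"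
    if y: "y < nY" for y
    unfolding f_def by (rule cmi_at_dsum) (use p1 p2 y p t in \<open>auto simp: cond_dist_def\<close>)
  ultimately show ?thesis
    using ext_cmisI[OF assemblage_mixture[OF \<rho> \<sigma> t] K p, of "d1 + d2" f]
    unfolding c1 c2 by (simp add: sum.distrib sum_distrib_left)
qed

text \<open>One strategy is applied to all three assemblages; the infima for \<open>\<rho>\<close>
  and \<open>\<sigma>\<close> are approached up to \<open>\<epsilon>\<close>, and the mixed
  extension is a candidate for \<open>?\<tau>\<close>.\<close>

lemma steerability_convex:
  assumes \<rho>: "assemblage nA nX dB \<rho>" and \<sigma>: "assemblage nA nX dB \<sigma>" and t: "0 \<le> t" "t \<le> 1"
  shows "steerability nA nX dB (\<lambda>a x. of_real t \<cdot>\<^sub>m \<rho> a x + of_real (1 - t) \<cdot>\<^sub>m \<sigma> a x)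
    \<le> t * steerability nA nX dB \<rho> + (1 - t) * steerability nA nX dB \<sigma>"
proof (rule steerability_le[OF assemblage_mixture[OF \<rho> \<sigma> t]])
  fix nY dB' K p assume Kp: "instrument nY dB dB' K" "cond_dist nX nY p"
  let ?\<tau> = "\<lambda>a x. of_real t \<cdot>\<^sub>m \<rho> a x + of_real (1 - t) \<cdot>\<^sub>m \<sigma> a x"
  let ?o = "\<lambda>\<rho>. opt_cmi nA nX \<rho> nY dB' K p"
  have t': "0 \<le> 1 - t" using t by simp
  show "?o ?\<tau> \<le> t * steerability nA nX dB \<rho> + (1 - t) * steerability nA nX dB \<sigma>"
  proof (rule field_le_epsilon)
    fix \<epsilon> :: real assume e: "0 < \<epsilon>"
    obtain c1 where c1: "c1 \<in> ext_cmis nA nX \<rho> nY dB' K p" "c1 < ?o \<rho> + \<epsilon>"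
      using opt_cmi_approx[OF \<rho> Kp e] by blast
    obtain c2 where c2: "c2 \<in> ext_cmis nA nX \<sigma> nY dB' K p" "c2 < ?o \<sigma> + \<epsilon>"
      using opt_cmi_approx[OF \<sigma> Kp e] by blast
    have "?o ?\<tau> \<le> t * c1 + (1 - t) * c2"
      by (rule opt_cmi_le[OF assemblage_mixture[OF \<rho> \<sigma> t] Kp ext_cmis_mixture[OF \<rho> \<sigma> t Kp c1(1) c2(1)]])
    also have "\<dots> \<le> t * (steerability nA nX dB \<rho> + \<epsilon>) + (1 - t) * (steerability nA nX dB \<sigma> + \<epsilon>)"
      using c1(2) c2(2) opt_cmi_le_steerability[OF \<rho> Kp] opt_cmi_le_steerability[OF \<sigma> Kp]
      by (intro add_mono mult_left_mono t(1) t') linarith+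
    finally show "?o ?\<tau> \<le> t * steerability nA nX dB \<rho> + (1 - t) * steerability nA nX dB \<sigma> + \<epsilon>"
      by (simp add: algebra_simps)
  qed
qed

subsection \<open>Monotonicity under one-way LOCC\<close>

text \<open>Amplification acts blockwise and therefore commutes with composition.\<close>

lemma cp_map_comp:
  assumes \<Phi>: "cp_map d d' \<Phi>" and \<Psi>: "cp_map d' d'' \<Psi>"
  shows "cp_map d d'' (\<lambda>M. \<Psi> (\<Phi> M))"
  unfolding cp_map_def
proof (intro conjI allI impI)
  show "lin_map d d'' (\<lambda>M. \<Psi> (\<Phi> M))"
    using \<Phi> \<Psi> unfolding cp_map_def lin_map_def by simp
  fix n M assume M: "psd (n * d) M"
  have "ampl n d d'' (\<lambda>M. \<Psi> (\<Phi> M)) M = ampl n d' d'' \<Psi> (ampl n d d' \<Phi> M)"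
  proof (rule eq_matI)
    fix i j assume "i < dim_row (ampl n d' d'' \<Psi> (ampl n d d' \<Phi> M))" "j < dim_col (ampl n d' d'' \<Psi> (ampl n d d' \<Phi> M))"
    then have ij: "i < n * d''" "j < n * d''" by (auto simp: ampl_def)
    have q: "i div d'' < n" "j div d'' < n" using ij by (auto simp: less_mult_imp_div_less)
    let ?B = "mat d d (\<lambda>(k, l). M $$ ((i div d'') * d + k, (j div d'') * d + l))"
    have c: "\<Phi> ?B \<in> carrier_mat d' d'" using \<Phi> unfolding cp_map_def lin_map_def by simp
    have "mat d' d' (\<lambda>(k, l). ampl n d d' \<Phi> M $$ ((i div d'') * d' + k, (j div d'') * d' + l)) = \<Phi> ?B"
      using c q by (intro eq_matI) (auto simp: ampl_def pair_less pair_div pair_mod simp del: div_mult_self3)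
    then show "ampl n d d'' (\<lambda>M. \<Psi> (\<Phi> M)) M $$ (i, j) = ampl n d' d'' \<Psi> (ampl n d d' \<Phi> M) $$ (i, j)"
      unfolding ampl_def[of n d d''] ampl_def[of n d' d''] using ij by simp
  qed (auto simp: ampl_def)
  moreover have "psd (n * d') (ampl n d d' \<Phi> M)" using \<Phi> M unfolding cp_map_def by blast
  ultimately show "psd (n * d'') (ampl n d d'' (\<lambda>M. \<Psi> (\<Phi> M)) M)"
    using \<Psi> unfolding cp_map_def by simp
qed

text \<open>All outcomes of an instrument share one output dimension, so the outputs of strategies
  with different dimensions are embedded into a common space.\<close>

definition pad :: "nat \<Rightarrow> nat \<Rightarrow> complex mat \<Rightarrow> complex mat" where
  "pad d D M = mat D D (\<lambda>(i, j). if i < d \<and> j < d then M $$ (i, j) else 0)"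

lemma pad_carrier [simp]: "pad d D M \<in> carrier_mat D D"
  by (simp add: pad_def)

lemma mtrace_pad: "d \<le> D \<Longrightarrow> M \<in> carrier_mat d d \<Longrightarrow> mtrace (pad d D M) = mtrace M"
proof -
  assume d: "d \<le> D" and M: "M \<in> carrier_mat d d"
  have "mtrace (pad d D M) = (\<Sum>i<D. if i < d then M $$ (i, i) else 0)"
    by (simp add: mtrace_def pad_def)
  also have "\<dots> = (\<Sum>i<d. M $$ (i, i))"
    using d by (intro sum.mono_neutral_cong_right) auto
  finally show ?thesis using M by (simp add: mtrace_def)
qed

text \<open>The amplified map re-indexes its argument along the injection
  \<open>s \<mapsto> (s div d) * D + s mod d\<close> and puts zeros elsewhere, a block embedding
  with a single block.\<close>

lemma cp_map_pad:
  assumes d: "d \<le> D"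
  shows "cp_map d D (pad d D)"
  unfolding cp_map_def
proof (intro conjI allI impI)
  show "lin_map d D (pad d D)"
    using d unfolding lin_map_def by (auto simp: pad_def intro!: eq_matI)
  fix n M assume M: "psd (n * d) M"
  have p: "psd_on {..<n * d} (\<lambda>i j. M $$ (i, j))" using M by (simp add: psd_iff_psd_on)
  have e: "ampl n d D (pad d D) M $$ (i, j) =
      (if i mod D < d \<and> j mod D < d then M $$ ((i div D) * d + i mod D, (j div D) * d + j mod D) else 0)"
    if "i < n * D" "j < n * D" for i j
    unfolding ampl_def using that by (cases "D = 0") (auto simp: pad_def)
  have "psd_on {..<n * D} (\<lambda>i j. ampl n d D (pad d D) M $$ (i, j))"
  proof (rule psd_on_block[where T = "{()}" and S = "\<lambda>_. {..<n * d}" and \<phi> = "\<lambda>_ s. (s div d) * D + s mod d"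
        and A = "\<lambda>_ i j. M $$ (i, j)"])
    fix x y assume xy: "x \<in> {..<n * D}" "y \<in> {..<n * D}" "ampl n d D (pad d D) M $$ (x, y) \<noteq> 0"
    then have m: "x mod D < d" "y mod D < d" using e[of x y] by (auto split: if_splits)
    have "z = (((z div D) * d + z mod D) div d) * D + ((z div D) * d + z mod D) mod d" if "z mod D < d" for z
      using that by (simp add: pair_div pair_mod del: div_mult_self3)
    moreover have "(z div D) * d + z mod D < n * d" if "z mod D < d" "z < n * D" for z
      using that by (intro pair_less) (auto simp: less_mult_imp_div_less)
    ultimately show "(\<exists>t\<in>{()}. \<exists>s\<in>{..<n * d}. x = (s div d) * D + s mod d) \<and>
        (\<exists>t\<in>{()}. \<exists>s\<in>{..<n * d}. y = (s div d) * D + s mod d)"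
      using m xy by blast
  next
    have s: "s mod d < D" "s mod d < d" "s div d < n" if "s < n * d" for s
    proof -
      have "d > 0" using that by (auto intro: gr_zeroI)
      then show "s mod d < d" by simp
      then show "s mod d < D" using d by linarith
      show "s div d < n" using that by (simp add: less_mult_imp_div_less)
    qed
    fix s s' assume a: "s \<in> {..<n * d}" "s' \<in> {..<n * d}"
    show "(s div d) * D + s mod d \<in> {..<n * D}" using s a by (auto intro!: pair_less)
    have sD: "(s div d) * D + s mod d < n * D" if "s < n * d" for s using s[OF that] by (auto intro: pair_less)
    show "ampl n d D (pad d D) M $$ ((s div d) * D + s mod d, (s' div d) * D + s' mod d) = (if t = t' then M $$ (s, s') else 0)" for t t' :: unit
      using a s sD by (subst e) (auto simp: pair_div pair_mod simp del: div_mult_self3)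
    show "t = t' \<and> s = s'" if "(s div d) * D + s mod d = (s' div d) * D + s' mod d" for t t' :: unit
      using that s a pair_inj[of "s mod d" D "s' mod d"] by (metis div_mult_mod_eq lessThan_iff old.unit.exhaust)
  qed (use p in auto)
  then show "psd (n * D) (ampl n d D (pad d D) M)" by (simp add: psd_iff_psd_on ampl_def)
qed

lemma cp_map_zero: "cp_map d D (\<lambda>_. 0\<^sub>m D D)"
proof -
  have "psd (n * D) (ampl n d D (\<lambda>_. 0\<^sub>m D D) M)" for n M
  proof -
    have "ampl n d D (\<lambda>_. 0\<^sub>m D D) M = 0\<^sub>m (n * D) (n * D)"
      unfolding ampl_def by (intro eq_matI) (auto intro!: index_zero_mat mod_less_divisor gr_zeroI)
    moreover have "psd_on I (\<lambda>i j. 0)" for I :: "nat set" by (simp add: psd_on_def sesq_def)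
    then have "psd_on {..<n * D} (\<lambda>i j. 0\<^sub>m (n * D) (n * D) $$ (i, j))"
      by (subst psd_on_cong[where B = "\<lambda>_ _. 0"]) auto
    ultimately show ?thesis by (simp add: psd_iff_psd_on)
  qed
  then show ?thesis unfolding cp_map_def lin_map_def by auto
qed

text \<open>A diagonal entry is the sum of \<open>\<mu> j * (cmod (v j x))^2\<close>. If it
  vanishes, every eigenvector with nonzero eigenvalue vanishes at \<open>x\<close>, and so do the
  row and the column.\<close>

lemma psd_on_diag:
  assumes fin: "finite I" and p: "psd_on I A" and x: "x \<in> I"
  shows "0 \<le> A x x" and "A x x = 0 \<Longrightarrow> y \<in> I \<Longrightarrow> A x y = 0 \<and> A y x = 0"
proof -
  obtain \<mu> v where d: "spectral I I \<mu> v A" and pos: "\<And>j. j \<in> I \<Longrightarrow> 0 \<le> \<mu> j"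
    using psd_on_spectral[OF fin p] by blast
  have e: "A x y = (\<Sum>j\<in>I. of_real (\<mu> j) * v j x * cnj (v j y))" if "x \<in> I" "y \<in> I" for x y
    using d that unfolding spectral_def by blast
  have "A x x = (\<Sum>j\<in>I. of_real (\<mu> j * (cmod (v j x))\<^sup>2))"
    unfolding e[OF x x] by (intro sum.cong refl) (simp add: mult.assoc complex_norm_square del: of_real_power)
  then have xx: "A x x = of_real (\<Sum>j\<in>I. \<mu> j * (cmod (v j x))\<^sup>2)" by simp
  have n: "0 \<le> (\<Sum>j\<in>I. \<mu> j * (cmod (v j x))\<^sup>2)" using pos by (intro sum_nonneg) simp
  show "0 \<le> A x x" unfolding xx using n by (simp add: less_eq_complex_def)
  assume 0: "A x x = 0" and y: "y \<in> I"
  then have "\<forall>j\<in>I. \<mu> j * (cmod (v j x))\<^sup>2 = 0"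
    using pos fin unfolding xx of_real_eq_0_iff by (subst (asm) sum_nonneg_eq_0_iff) auto
  then have "\<forall>j\<in>I. \<mu> j = 0 \<or> v j x = 0" by auto
  then show "A x y = 0 \<and> A y x = 0" unfolding e[OF x y] e[OF y x] by (auto intro!: sum.neutral)
qed

lemma cond_ent_restrict:
  assumes fin: "finite L'" "finite M" and sub: "L \<subseteq> L'" and p: "psd_on (L \<times> M) B"
    and z: "\<And>u v. u \<in> L' \<times> M \<Longrightarrow> v \<in> L' \<times> M \<Longrightarrow> fst u \<notin> L \<or> fst v \<notin> L \<Longrightarrow> B u v = 0"
  shows "cond_ent L' M B = cond_ent L M B"
proof -
  have finL: "finite L" using fin sub finite_subset by blast
  have "entropy_on (L' \<times> M) B = (\<Sum>t\<in>{()}. entropy_on (L \<times> M) B)"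
  proof (rule entropy_on_block[where \<phi> = "\<lambda>_ u. u"])
    fix x y assume "x \<in> L' \<times> M" "y \<in> L' \<times> M" "B x y \<noteq> 0"
    moreover from this have "fst x \<in> L \<and> fst y \<in> L" using z[of x y] by blast
    ultimately show "(\<exists>t\<in>{()}. \<exists>s\<in>L \<times> M. x = s) \<and> (\<exists>t\<in>{()}. \<exists>s\<in>L \<times> M. y = s)"
      by auto
  qed (use fin finL sub p in auto)
  moreover have "entropy_on M (ptrace L' B) = entropy_on M (ptrace L B)"
  proof (rule entropy_on_cong)
    fix m m' assume "m \<in> M" "m' \<in> M"
    then show "ptrace L' B m m' = ptrace L B m m'"
      unfolding ptrace_def using fin sub z by (intro sum.mono_neutral_right) auto
  qed
  ultimately show ?thesis unfolding cond_ent_def by simp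
qed

lemma psd_on_restrict:
  fixes d D :: nat
  assumes "d \<le> D" "finite M" "psd_on ({..<D} \<times> M) F"
  shows "psd_on ({..<d} \<times> M) F"
  by (rule psd_on_reindex[where g = "\<lambda>u. u", OF _ _ assms(3)]) (use assms in auto)

text \<open>Of an extension of a padded output it is only known that its marginal on
  \<open>B'\<close> vanishes on the padding. Positivity then makes the diagonal entries zero there,
  and with them whole rows and columns, so the extension lives on the original space.\<close>

lemma cmi_at_restrict:
  assumes d: "d \<le> D" and p: "\<And>x a. x < nX \<Longrightarrow> a < nA \<Longrightarrow> psd_on ({..<D} \<times> {..<dE}) (F a x)"
    and z: "\<And>x a b. x < nX \<Longrightarrow> a < nA \<Longrightarrow> b < D \<Longrightarrow> d \<le> b \<Longrightarrow> (\<Sum>e<dE. F a x (b, e) (b, e)) = 0"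
    and q: "\<And>x. x < nX \<Longrightarrow> 0 \<le> q x"
  shows "cmi_at nA nX D dE q F = cmi_at nA nX d dE q F"
proof -
  have sub: "{..<d} \<subseteq> {..<D}" using d by auto
  note p' = psd_on_restrict[OF d finite_lessThan p]
  have z': "F a x u v = 0"
    if xa: "x < nX" "a < nA" and uv: "u \<in> {..<D} \<times> {..<dE}" "v \<in> {..<D} \<times> {..<dE}" "fst u \<notin> {..<d} \<or> fst v \<notin> {..<d}"
    for a x u v
  proof -
    have dz: "F a x (b, e) (b, e) = 0" if be: "b < D" "d \<le> b" "e < dE" for b e
    proof -
      have "\<forall>e\<in>{..<dE}. F a x (b, e) (b, e) = 0"
        using z[OF xa be(1,2)] psd_on_diag(1)[OF _ p[OF xa]] be
        by (subst (asm) sum_nonneg_eq_0_iff) auto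
      then show ?thesis using be by simp
    qed
    show ?thesis
      using uv dz psd_on_diag(2)[OF _ p[OF xa] uv(1), of v] psd_on_diag(2)[OF _ p[OF xa] uv(2), of u]
      by (cases u; cases v) (auto simp: not_less)
  qed
  have 1: "cond_ent {..<D} {..<dE} (F a x) = cond_ent {..<d} {..<dE} (F a x)" if "x < nX" "a < nA" for a x
    by (rule cond_ent_restrict) (use sub p'[OF that] z'[OF that] in auto)
  have 2: "cond_ent {..<D} {..<dE} (\<lambda>u v. \<Sum>x<nX. \<Sum>a<nA. of_real (q x) * F a x u v)
      = cond_ent {..<d} {..<dE} (\<lambda>u v. \<Sum>x<nX. \<Sum>a<nA. of_real (q x) * F a x u v)"
  proof (rule cond_ent_restrict)
    show "psd_on ({..<d} \<times> {..<dE}) (\<lambda>u v. \<Sum>x<nX. \<Sum>a<nA. of_real (q x) * F a x u v)"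
      using p' q by (intro psd_on_sum psd_on_scale) auto
  qed (use sub z' in \<open>auto intro!: sum.neutral\<close>)
  show "cmi_at nA nX D dE q F = cmi_at nA nX d dE q F"
    unfolding cmi_at_def 2 using 1 by simp
qed

text \<open>Data processing for the classical system \<open>X A\<close>: coarse-graining it decreases the
  conditional mutual information, by superadditivity of \<open>cond_ent\<close>.\<close>
lemma cmi_at_coarse_grain:
  assumes F: "\<And>x a. x < nX \<Longrightarrow> a < nA \<Longrightarrow> psd_on ({..<d} \<times> {..<dE}) (F a x)"
    and q: "\<And>xf. xf < nXf \<Longrightarrow> 0 \<le> q xf" and r: "0 < r"
    and px: "\<And>xf x. xf < nXf \<Longrightarrow> x < nX \<Longrightarrow> 0 \<le> px x xf"
    and pa: "\<And>xf x a af. xf < nXf \<Longrightarrow> x < nX \<Longrightarrow> a < nA \<Longrightarrow> af < nAf \<Longrightarrow> 0 \<le> pa af xf x a"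
    and pa1: "\<And>xf x a. xf < nXf \<Longrightarrow> x < nX \<Longrightarrow> a < nA \<Longrightarrow> (\<Sum>af<nAf. pa af xf x a) = 1"
  shows "r * cmi_at nAf nXf d dE q (\<lambda>af xf u v. \<Sum>x<nX. \<Sum>a<nA. of_real (pa af xf x a * px x xf / r) * F a x u v)
    \<le> cmi_at nA nX d dE (\<lambda>x. \<Sum>xf<nXf. px x xf * q xf) F"
proof -
  let ?c = "cond_ent {..<d} {..<dE}"
  define G where "G af xf u v = (\<Sum>x<nX. \<Sum>a<nA. complex_of_real (pa af xf x a * px x xf / r) * F a x u v)" for af xf u v
  define T where "T u v = (\<Sum>x<nX. \<Sum>a<nA. complex_of_real (\<Sum>xf<nXf. px x xf * q xf) * F a x u v)" for u v
  \<comment> \<open>Summing \<open>pa\<close> over \<open>af\<close> gives 1, so the coarse-grained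
    total is the fine-grained one divided by \<open>r\<close>. Being stated for real
    \<open>h\<close>, this applies to the conditional entropies and, through real and imaginary
    parts, to the operators.\<close>
  have marg: "(\<Sum>xf<nXf. \<Sum>af<nAf. q xf * (\<Sum>x<nX. \<Sum>a<nA. (pa af xf x a * px x xf / r) * h a x))
    = (\<Sum>x<nX. \<Sum>a<nA. (\<Sum>xf<nXf. px x xf * q xf) / r * h a x)" for h :: "nat \<Rightarrow> nat \<Rightarrow> real"
  proof -
    let ?T = "\<lambda>xf x a. px x xf * q xf / r * h a x"
    have "(\<Sum>xf<nXf. \<Sum>af<nAf. q xf * (\<Sum>x<nX. \<Sum>a<nA. (pa af xf x a * px x xf / r) * h a x))
      = (\<Sum>xf<nXf. \<Sum>af<nAf. \<Sum>x<nX. \<Sum>a<nA. pa af xf x a * (?T xf x a))"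
      by (simp add: sum_distrib_left mult_ac)
    also have "\<dots> = (\<Sum>xf<nXf. \<Sum>x<nX. \<Sum>af<nAf. \<Sum>a<nA. pa af xf x a * (?T xf x a))"
      by (subst (2) sum.swap) (rule refl)
    also have "\<dots> = (\<Sum>x<nX. \<Sum>xf<nXf. \<Sum>af<nAf. \<Sum>a<nA. pa af xf x a * (?T xf x a))"
      by (rule sum.swap)
    also have "\<dots> = (\<Sum>x<nX. \<Sum>xf<nXf. \<Sum>a<nA. \<Sum>af<nAf. pa af xf x a * (?T xf x a))"
      by (subst (3) sum.swap) (rule refl)
    also have "\<dots> = (\<Sum>x<nX. \<Sum>xf<nXf. \<Sum>a<nA. ?T xf x a)"
      using pa1 by (intro sum.cong refl) (subst sum_distrib_right[symmetric], simp)
    also have "\<dots> = (\<Sum>x<nX. \<Sum>a<nA. \<Sum>xf<nXf. ?T xf x a)"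
      by (subst (2) sum.swap) (rule refl)
    finally show ?thesis by (simp add: sum_distrib_right sum_divide_distrib)
  qed
  have cmarg: "(\<Sum>xf<nXf. \<Sum>af<nAf. of_real (q xf) * G af xf u v) = of_real (1 / r) * T u v" for u v
  proof -
    have "(\<Sum>xf<nXf. \<Sum>af<nAf. q xf * Re (G af xf u v)) = 1 / r * Re (T u v)"
      using marg[of "\<lambda>a x. Re (F a x u v)"] unfolding G_def T_def by (simp add: sum_distrib_left)
    moreover have "(\<Sum>xf<nXf. \<Sum>af<nAf. q xf * Im (G af xf u v)) = 1 / r * Im (T u v)"
      using marg[of "\<lambda>a x. Im (F a x u v)"] unfolding G_def T_def by (simp add: sum_distrib_left)
    ultimately show ?thesis by (simp add: complex_eq_iff)
  qed
  have qq: "0 \<le> (\<Sum>xf<nXf. px x xf * q xf)" if "x < nX" for x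
    using px q that by (intro sum_nonneg) auto
  have pT: "psd_on ({..<d} \<times> {..<dE}) T"
    unfolding T_def[abs_def] using F qq by (intro psd_on_sum psd_on_scale) auto
  have tot: "?c (\<lambda>u v. \<Sum>xf<nXf. \<Sum>af<nAf. of_real (q xf) * G af xf u v) = 1 / r * ?c T"
    unfolding cmarg by (rule cond_ent_scale[OF _ _ pT]) (use r in auto)
  \<comment> \<open>The two sides share the term \<open>?c T\<close> and differ only in what is
    subtracted from it; each \<open>G af xf\<close> is a nonnegative combination of the operators
    \<open>F a x\<close>.\<close>
  have "(\<Sum>x<nX. \<Sum>a<nA. (pa af xf x a * px x xf / r) * ?c (F a x)) \<le> ?c (G af xf)"
    if "xf < nXf" "af < nAf" for af xf
    unfolding G_def[abs_def] using F pa px r that by (intro superadditive_pairs) auto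
  then have "(\<Sum>xf<nXf. \<Sum>af<nAf. q xf * (\<Sum>x<nX. \<Sum>a<nA. (pa af xf x a * px x xf / r) * ?c (F a x)))
      \<le> (\<Sum>xf<nXf. \<Sum>af<nAf. q xf * ?c (G af xf))"
    using q by (intro sum_mono mult_left_mono) auto
  then have "(\<Sum>x<nX. \<Sum>a<nA. (\<Sum>xf<nXf. px x xf * q xf) / r * ?c (F a x)) \<le> (\<Sum>xf<nXf. \<Sum>af<nAf. q xf * ?c (G af xf))"
    unfolding marg .
  moreover have "(\<Sum>x<nX. \<Sum>a<nA. (\<Sum>xf<nXf. px x xf * q xf) / r * ?c (F a x))
      = (\<Sum>x<nX. \<Sum>a<nA. (\<Sum>xf<nXf. px x xf * q xf) * ?c (F a x)) / r"
    by (simp only: times_divide_eq_left sum_divide_distrib[symmetric])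
  ultimately have "(\<Sum>x<nX. \<Sum>a<nA. (\<Sum>xf<nXf. px x xf * q xf) * ?c (F a x)) / r \<le> (\<Sum>xf<nXf. \<Sum>af<nAf. q xf * ?c (G af xf))"
    by (simp only:)
  then have "(\<Sum>x<nX. \<Sum>a<nA. (\<Sum>xf<nXf. px x xf * q xf) * ?c (F a x)) \<le> r * (\<Sum>xf<nXf. \<Sum>af<nAf. q xf * ?c (G af xf))"
    unfolding pos_divide_le_eq[OF r] by (subst mult.commute)
  moreover have "r * cmi_at nAf nXf d dE q G = ?c T - r * (\<Sum>xf<nXf. \<Sum>af<nAf. q xf * ?c (G af xf))"
    unfolding cmi_at_def tot using r by (simp add: right_diff_distrib)
  moreover have "cmi_at nA nX d dE (\<lambda>x. \<Sum>xf<nXf. px x xf * q xf) F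
      = ?c T - (\<Sum>x<nX. \<Sum>a<nA. (\<Sum>xf<nXf. px x xf * q xf) * ?c (F a x))"
    unfolding cmi_at_def T_def[abs_def] ..
  ultimately show ?thesis unfolding G_def[abs_def] by linarith
qed

section \<open>Conditional assemblages after one-way LOCC\<close>

locale one_way_locc =
  fixes nA nX dB :: nat and \<rho> :: "nat \<Rightarrow> nat \<Rightarrow> complex mat"
    and nZ dBf :: nat and Kz :: "nat \<Rightarrow> complex mat \<Rightarrow> complex mat" and nXf nAf :: nat
    and px :: "nat \<Rightarrow> nat \<Rightarrow> nat \<Rightarrow> real" and paf :: "nat \<Rightarrow> nat \<Rightarrow> nat \<Rightarrow> nat \<Rightarrow> nat \<Rightarrow> real"
  assumes as: "assemblage nA nX dB \<rho>" and Kz: "instrument nZ dB dBf Kz" and nXf: "0 < nXf"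
    and px0: "\<And>xf z x. xf < nXf \<Longrightarrow> z < nZ \<Longrightarrow> x < nX \<Longrightarrow> 0 \<le> px x xf z"
    and px1: "\<And>xf z. xf < nXf \<Longrightarrow> z < nZ \<Longrightarrow> (\<Sum>x<nX. px x xf z) = 1"
    and pa0: "\<And>xf x a z af. xf < nXf \<Longrightarrow> x < nX \<Longrightarrow> a < nA \<Longrightarrow> z < nZ \<Longrightarrow> af < nAf \<Longrightarrow> 0 \<le> paf af xf x a z"
    and pa1: "\<And>xf x a z. xf < nXf \<Longrightarrow> x < nX \<Longrightarrow> a < nA \<Longrightarrow> z < nZ \<Longrightarrow> (\<Sum>af<nAf. paf af xf x a z) = 1"
begin

definition \<rho>B :: "complex mat" where
  "\<rho>B = msum dB nA (\<lambda>a. \<rho> a 0)"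

definition pz :: "nat \<Rightarrow> real" where
  "pz z = Re (mtrace (Kz z \<rho>B))"

definition coef :: "nat \<Rightarrow> nat \<Rightarrow> nat \<Rightarrow> nat \<Rightarrow> nat \<Rightarrow> real" where
  "coef z af xf x a = paf af xf x a z * px x xf z / pz z"

definition \<rho>z :: "nat \<Rightarrow> nat \<Rightarrow> nat \<Rightarrow> complex mat" where
  "\<rho>z z af xf = msum dBf nX (\<lambda>x. msum dBf nA (\<lambda>a. of_real (coef z af xf x a) \<cdot>\<^sub>m Kz z (\<rho> a x)))"

lemma nX: "0 < nX"
  using as unfolding assemblage_def by blast

lemma \<rho>_psd: "a < nA \<Longrightarrow> x < nX \<Longrightarrow> psd dB (\<rho> a x)"
  using as unfolding assemblage_def by blast

lemma \<rho>B_density: "density dB \<rho>B"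
  and \<rho>_sum: "x < nX \<Longrightarrow> msum dB nA (\<lambda>a. \<rho> a x) = \<rho>B"
  using as nX unfolding assemblage_def \<rho>B_def by auto



lemma Kz_psd: "z < nZ \<Longrightarrow> psd dB M \<Longrightarrow> psd dBf (Kz z M)"
  using Kz psd_cp_map[of dB dBf "Kz z" M] unfolding instrument_def by blast

lemma Kz_carrier: "z < nZ \<Longrightarrow> a < nA \<Longrightarrow> x < nX \<Longrightarrow> Kz z (\<rho> a x) \<in> carrier_mat dBf dBf"
  using Kz_psd \<rho>_psd psd_carrier by blast

lemma Kz_sum: "z < nZ \<Longrightarrow> x < nX \<Longrightarrow> msum dBf nA (\<lambda>a. Kz z (\<rho> a x)) = Kz z \<rho>B"
  using lin_msum[OF instrument_lin[OF Kz], of z nA "\<lambda>a. \<rho> a x"] assemblage_carrier[OF as] \<rho>_sum by simp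

lemma coef_nonneg:
  "z < nZ \<Longrightarrow> 0 < pz z \<Longrightarrow> af < nAf \<Longrightarrow> xf < nXf \<Longrightarrow> x < nX \<Longrightarrow> a < nA \<Longrightarrow> 0 \<le> coef z af xf x a"
  unfolding coef_def using px0 pa0 by simp

lemma coef_sum:
  assumes "z < nZ" "xf < nXf" "x < nX" "a < nA"
  shows "(\<Sum>af<nAf. coef z af xf x a) = px x xf z / pz z"
proof -
  have "(\<Sum>af<nAf. coef z af xf x a) = (\<Sum>af<nAf. paf af xf x a z) * (px x xf z / pz z)"
    unfolding coef_def sum_distrib_right by simp
  then show ?thesis using pa1[OF assms(2-4,1)] by simp
qed

text \<open>No-signalling from \<open>x\<close> to the sum over \<open>a\<close> is inherited by
  \<open>xf\<close> and the sum over \<open>af\<close>: first the output channel sums to 1, then the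
  input channel. With \<open>h\<close> abstract this serves the conditional assemblages and their
  extensions alike.\<close>

lemma sum_coef:
  fixes h :: "nat \<Rightarrow> nat \<Rightarrow> complex"
  assumes z: "z < nZ" and xf: "xf < nXf" and h: "\<And>x. x < nX \<Longrightarrow> (\<Sum>a<nA. h a x) = c"
  shows "(\<Sum>af<nAf. \<Sum>x<nX. \<Sum>a<nA. of_real (coef z af xf x a) * h a x) = c / of_real (pz z)"
proof -
  have "(\<Sum>af<nAf. \<Sum>x<nX. \<Sum>a<nA. of_real (coef z af xf x a) * h a x)
      = (\<Sum>x<nX. \<Sum>af<nAf. \<Sum>a<nA. of_real (coef z af xf x a) * h a x)" by (rule sum.swap)
  also have "\<dots> = (\<Sum>x<nX. \<Sum>a<nA. \<Sum>af<nAf. of_real (coef z af xf x a) * h a x)"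
    by (subst (2) sum.swap) (rule refl)
  also have "\<dots> = (\<Sum>x<nX. \<Sum>a<nA. of_real (px x xf z / pz z) * h a x)"
    using coef_sum[OF z xf] by (intro sum.cong refl) (simp add: sum_distrib_right[symmetric] of_real_sum[symmetric] del: of_real_sum of_real_divide)
  also have "\<dots> = (\<Sum>x<nX. of_real (px x xf z / pz z) * c)"
    using h by (intro sum.cong refl) (subst sum_distrib_left[symmetric], simp)
  also have "\<dots> = of_real ((\<Sum>x<nX. px x xf z) / pz z) * c"
    by (simp add: sum_distrib_right sum_divide_distrib)
  finally show ?thesis unfolding px1[OF xf z] by simp
qed

lemma \<rho>z_entry:
  assumes "z < nZ" "i < dBf" "j < dBf"
  shows "\<rho>z z af xf $$ (i, j) = (\<Sum>x<nX. \<Sum>a<nA. of_real (coef z af xf x a) * Kz z (\<rho> a x) $$ (i, j))"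
proof -
  have "dim_row (Kz z (\<rho> a x)) = dBf" "dim_col (Kz z (\<rho> a x)) = dBf" if "a < nA" "x < nX" for a x
    using Kz_carrier[OF assms(1) that] by auto
  then show ?thesis using assms unfolding \<rho>z_def by (auto simp: msum_def intro!: sum.cong)
qed

lemma \<rho>z_carrier: "\<rho>z z af xf \<in> carrier_mat dBf dBf"
  by (simp add: \<rho>z_def)

lemma assemblage_\<rho>z:
  assumes z: "z < nZ" and p: "0 < pz z"
  shows "assemblage nAf nXf dBf (\<rho>z z)"
  unfolding assemblage_def
proof (intro conjI allI impI exI nXf)
  fix af xf assume f: "af < nAf" "xf < nXf"
  have K: "psd_on {..<dBf} (\<lambda>i j. Kz z (\<rho> a x) $$ (i, j))" if "a < nA" "x < nX" for a x
    using Kz_psd[OF z \<rho>_psd[OF that]] by (simp add: psd_iff_psd_on)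
  have "psd_on {..<dBf} (\<lambda>i j. \<Sum>x<nX. \<Sum>a<nA. of_real (coef z af xf x a) * Kz z (\<rho> a x) $$ (i, j))"
    using K coef_nonneg[OF z p f] by (intro psd_on_sum psd_on_scale) auto
  moreover have "psd_on {..<dBf} (\<lambda>i j. \<rho>z z af xf $$ (i, j)) =
      psd_on {..<dBf} (\<lambda>i j. \<Sum>x<nX. \<Sum>a<nA. of_real (coef z af xf x a) * Kz z (\<rho> a x) $$ (i, j))"
    by (rule psd_on_cong) (simp add: \<rho>z_entry[OF z])
  ultimately show "psd dBf (\<rho>z z af xf)" by (simp add: psd_iff_psd_on \<rho>z_carrier)
next
  let ?s = "of_real (1 / pz z) \<cdot>\<^sub>m Kz z \<rho>B"
  have KB: "psd dBf (Kz z \<rho>B)" using Kz_psd[OF z] \<rho>B_density unfolding density_def by blast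
  note KBc = psd_carrier[OF KB]
  have "psd dBf (of_real (1 / pz z) \<cdot>\<^sub>m Kz z \<rho>B + of_real 0 \<cdot>\<^sub>m Kz z \<rho>B)"
    using p by (intro psd_combination[OF KB KB]) auto
  moreover have "of_real (1 / pz z) \<cdot>\<^sub>m Kz z \<rho>B + of_real 0 \<cdot>\<^sub>m Kz z \<rho>B = ?s"
    using KBc by (intro eq_matI) auto
  ultimately have "psd dBf ?s" by simp
  moreover have "mtrace ?s = 1"
  proof -
    \<comment> \<open>Positivity makes the trace real, so the real part in \<open>pz\<close> loses
      nothing.\<close>
    have "0 \<le> Kz z \<rho>B $$ (i, i)" if "i < dBf" for i
      using KB that psd_on_diag(1)[of "{..<dBf}" "\<lambda>i j. Kz z \<rho>B $$ (i, j)" i] by (simp add: psd_iff_psd_on)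
    then have "0 \<le> mtrace (Kz z \<rho>B)" unfolding mtrace_def using KBc by (intro sum_nonneg) auto
    then have "mtrace (Kz z \<rho>B) = of_real (pz z)"
      unfolding pz_def by (simp add: less_eq_complex_def complex_eq_iff)
    moreover have "mtrace ?s = of_real (1 / pz z) * mtrace (Kz z \<rho>B)"
      unfolding mtrace_def using KBc by (simp add: sum_distrib_left del: of_real_divide)
    ultimately show ?thesis using p by simp
  qed
  ultimately show "density dBf ?s" unfolding density_def by blast
  fix xf assume xf: "xf < nXf"
  show "msum dBf nAf (\<lambda>af. \<rho>z z af xf) = ?s"
  proof (rule eq_matI)
    fix i j assume "i < dim_row ?s" "j < dim_col ?s"
    then have ij: "i < dBf" "j < dBf" using KBc by auto
    have h: "(\<Sum>a<nA. Kz z (\<rho> a x) $$ (i, j)) = Kz z \<rho>B $$ (i, j)" if "x < nX" for x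
      unfolding Kz_sum[OF z that, symmetric] using ij by (simp add: msum_def)
    show "msum dBf nAf (\<lambda>af. \<rho>z z af xf) $$ (i, j) = ?s $$ (i, j)"
      using ij KBc sum_coef[OF z xf h] by (simp add: msum_def \<rho>z_entry[OF z])
  qed (use KBc in \<open>auto simp: msum_def\<close>)
qed

end

section \<open>The combined strategy\<close>

locale one_way_locc_strategies = one_way_locc +
  fixes nY d :: "nat \<Rightarrow> nat" and K :: "nat \<Rightarrow> nat \<Rightarrow> complex mat \<Rightarrow> complex mat" and q :: "nat \<Rightarrow> nat \<Rightarrow> nat \<Rightarrow> real"
  assumes K: "\<And>z. z < nZ \<Longrightarrow> instrument (nY z) dBf (d z) (K z)"
    and q: "\<And>z. z < nZ \<Longrightarrow> cond_dist nXf (nY z) (q z)"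
begin

text \<open>Strategies with fewer than \<open>N\<close> outcomes or output dimension below \<open>D\<close> are padded by zero;
  outcome \<open>y\<close> of the strategy for \<open>z\<close> becomes outcome \<open>z * N + y\<close> of the combined one.\<close>

definition N :: nat where "N = (\<Sum>z<nZ. nY z)"

definition D :: nat where "D = (\<Sum>z<nZ. d z)"

definition KK :: "nat \<Rightarrow> complex mat \<Rightarrow> complex mat" where
  "KK y = (if y mod N < nY (y div N)
     then (\<lambda>M. pad (d (y div N)) D (K (y div N) (y mod N) (Kz (y div N) M))) else (\<lambda>_. 0\<^sub>m D D))"

text \<open>On genuine outcomes \<open>x\<close> is drawn by the LOCC channel after the strategy for
  \<open>z\<close> has drawn \<open>xf\<close>. Padding outcomes still require some distribution on
  inputs; the point mass at 0 is available since \<open>nX\<close> is positive.\<close>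

definition PP :: "nat \<Rightarrow> nat \<Rightarrow> real" where
  "PP x y = (if y mod N < nY (y div N) then \<Sum>xf<nXf. px x xf (y div N) * q (y div N) xf (y mod N)
     else if x = 0 then 1 else 0)"

lemma nY_le: "z < nZ \<Longrightarrow> nY z \<le> N" and d_le: "z < nZ \<Longrightarrow> d z \<le> D"
  unfolding N_def D_def by (auto intro: member_le_sum)

lemma KK_pair: "z < nZ \<Longrightarrow> y < nY z \<Longrightarrow> KK (z * N + y) = (\<lambda>M. pad (d z) D (K z y (Kz z M)))"
  and PP_pair: "z < nZ \<Longrightarrow> y < nY z \<Longrightarrow> PP x (z * N + y) = (\<Sum>xf<nXf. px x xf z * q z xf y)"
  using nY_le[of z] by (simp_all add: KK_def PP_def pair_div pair_mod del: div_mult_self3)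

lemma KK_pair0: "z < nZ \<Longrightarrow> y < N \<Longrightarrow> \<not> y < nY z \<Longrightarrow> KK (z * N + y) = (\<lambda>_. 0\<^sub>m D D)"
  by (simp add: KK_def pair_div pair_mod del: div_mult_self3)

lemma instrument_KK: "instrument (nZ * N) dB D KK"
  unfolding instrument_def
proof (intro conjI allI impI ballI)
  fix i assume "i < nZ * N"
  then obtain z y where zy: "z < nZ" "y < N" "i = z * N + y" using pair_split by blast
  show "cp_map dB D (KK i)"
  proof (cases "y < nY z")
    case True
    have "cp_map dB dBf (Kz z)" using Kz zy(1) unfolding instrument_def by blast
    moreover have "cp_map dBf (d z) (K z y)" using K[OF zy(1)] True unfolding instrument_def by blast
    ultimately have "cp_map dB (d z) (\<lambda>M. K z y (Kz z M))" by (rule cp_map_comp)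
    then show ?thesis unfolding zy(3) KK_pair[OF zy(1) True]
      by (rule cp_map_comp[OF _ cp_map_pad[OF d_le[OF zy(1)]]])
  next
    case False
    then show ?thesis unfolding zy(3) KK_pair0[OF zy(1,2) False] by (simp add: cp_map_zero)
  qed
next
  fix M :: "complex mat" assume M: "M \<in> carrier_mat dB dB"
  have KzM: "Kz z M \<in> carrier_mat dBf dBf" if "z < nZ" for z
    using instrument_carrier[OF Kz that M] .
  have KKc: "KK (z * N + y) M \<in> carrier_mat D D" if "z < nZ" "y < N" for z y
    using that by (cases "y < nY z") (simp_all add: KK_pair KK_pair0)
  have "mtrace (msum D (nZ * N) (\<lambda>y. KK y M)) = (\<Sum>i<nZ * N. mtrace (KK i M))"
  proof (rule mtrace_msum)
    fix i assume "i < nZ * N"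
    then show "KK i M \<in> carrier_mat D D" using pair_split[of i nZ N] KKc by blast
  qed
  also have "\<dots> = (\<Sum>z<nZ. \<Sum>y<N. mtrace (KK (z * N + y) M))" by (rule sum_pair)
  also have "\<dots> = (\<Sum>z<nZ. mtrace (Kz z M))"
  proof (intro sum.cong refl)
    fix z assume "z \<in> {..<nZ}"
    then have z: "z < nZ" by simp
    have Kc: "K z y (Kz z M) \<in> carrier_mat (d z) (d z)" if "y < nY z" for y
      using instrument_carrier[OF K[OF z] that KzM[OF z]] .
    have "(\<Sum>y<N. mtrace (KK (z * N + y) M)) = (\<Sum>y<nY z. mtrace (K z y (Kz z M)))"
    proof (rule sum.mono_neutral_cong_right)
      show "\<forall>y\<in>{..<N} - {..<nY z}. mtrace (KK (z * N + y) M) = 0"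
        using z by (simp add: KK_pair0 mtrace_def)
      show "mtrace (KK (z * N + y) M) = mtrace (K z y (Kz z M))" if "y \<in> {..<nY z}" for y
        using z that Kc by (simp add: KK_pair mtrace_pad d_le)
    qed (use nY_le[OF z] in auto)
    also have "\<dots> = mtrace (msum (d z) (nY z) (\<lambda>y. K z y (Kz z M)))"
      by (rule mtrace_msum[symmetric]) (rule Kc)
    also have "\<dots> = mtrace (Kz z M)" using K[OF z] KzM[OF z] unfolding instrument_def by blast
    finally show "(\<Sum>y<N. mtrace (KK (z * N + y) M)) = mtrace (Kz z M)" .
  qed
  also have "\<dots> = mtrace (msum dBf nZ (\<lambda>z. Kz z M))" by (rule mtrace_msum[symmetric]) (rule KzM)
  also have "\<dots> = mtrace M" using Kz M unfolding instrument_def by blast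
  finally show "mtrace (msum D (nZ * N) (\<lambda>y. KK y M)) = mtrace M" .
qed

lemma q_nonneg: "z < nZ \<Longrightarrow> y < nY z \<Longrightarrow> xf < nXf \<Longrightarrow> 0 \<le> q z xf y"
  and q_sum: "z < nZ \<Longrightarrow> y < nY z \<Longrightarrow> (\<Sum>xf<nXf. q z xf y) = 1"
  using q unfolding cond_dist_def by auto

lemma cond_dist_PP: "cond_dist nX (nZ * N) PP"
  unfolding cond_dist_def
proof (intro allI impI)
  fix i assume "i < nZ * N"
  then obtain z y where zy: "z < nZ" "y < N" "i = z * N + y" using pair_split by blast
  show "(\<forall>x<nX. 0 \<le> PP x i) \<and> (\<Sum>x<nX. PP x i) = 1"
  proof (cases "y < nY z")
    case True
    have "(\<Sum>x<nX. \<Sum>xf<nXf. px x xf z * q z xf y) = (\<Sum>xf<nXf. \<Sum>x<nX. px x xf z * q z xf y)" by (rule sum.swap)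
    also have "\<dots> = (\<Sum>xf<nXf. q z xf y)"
      using px1 zy(1) by (intro sum.cong refl) (simp add: sum_distrib_right[symmetric])
    finally show ?thesis
      unfolding zy(3) PP_pair[OF zy(1) True] using q_sum[OF zy(1) True] q_nonneg[OF zy(1) True] px0 zy(1)
      by (auto intro!: sum_nonneg)
  next
    case False
    then have "PP x i = (if x = 0 then 1 else 0)" for x
      using zy by (simp add: PP_def pair_div pair_mod del: div_mult_self3)
    then show ?thesis using nX by simp
  qed
qed

text \<open>An extension for the combined strategy yields extensions for all conditional
  assemblages, on the same system \<open>E\<close>.\<close>
lemma ns_ext_on_conditional:
  assumes ns: "ns_ext_on nA nX (nZ * N) (\<lambda>a x y. KK y (\<rho> a x)) D dE f" and z: "z < nZ" and p: "0 < pz z"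
  shows "ns_ext_on nAf nXf (nY z) (\<lambda>af xf y. K z y (\<rho>z z af xf)) (d z) dE
    (\<lambda>af xf y u v. \<Sum>x<nX. \<Sum>a<nA. of_real (coef z af xf x a) * f a x (z * N + y) u v)"
proof -
  have sub: "u \<in> {..<D} \<times> {..<dE}" if "u \<in> {..<d z} \<times> {..<dE}" for u
    using that d_le[OF z] by auto
  have zy: "z * N + y < nZ * N" if "y < nY z" for y
    using that z nY_le[OF z] by (intro pair_less) auto
  have pf: "psd_on ({..<d z} \<times> {..<dE}) (f a x (z * N + y))" if "a < nA" "x < nX" "y < nY z" for a x y
    by (rule psd_on_restrict[OF d_le[OF z] finite_lessThan ns_ext_on_psd_on[OF ns that(1,2) zy[OF that(3)]]])
  show ?thesis
    unfolding ns_ext_on_def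
  proof (intro conjI allI impI ballI)
    show "0 < dE" using ns unfolding ns_ext_on_def by simp
    fix af xf y assume *: "af < nAf" "xf < nXf" "y < nY z"
    show "psd_on ({..<d z} \<times> {..<dE}) (\<lambda>u v. \<Sum>x<nX. \<Sum>a<nA. of_real (coef z af xf x a) * f a x (z * N + y) u v)"
      using pf *(3) coef_nonneg[OF z p *(1,2)] by (intro psd_on_sum psd_on_scale) auto
    fix b b' assume b: "b < d z" "b' < d z"
    then have bD: "b < D" "b' < D" using d_le[OF z] by auto
    have Kc: "K z y (Kz z (\<rho> a x)) \<in> carrier_mat (d z) (d z)" if "a < nA" "x < nX" for a x
      using instrument_carrier[OF K[OF z] *(3) Kz_carrier[OF z that]] .
    have "(\<Sum>e<dE. \<Sum>x<nX. \<Sum>a<nA. of_real (coef z af xf x a) * f a x (z * N + y) (b, e) (b', e))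
       = (\<Sum>x<nX. \<Sum>e<dE. \<Sum>a<nA. of_real (coef z af xf x a) * f a x (z * N + y) (b, e) (b', e))"
      by (rule sum.swap)
    also have "\<dots> = (\<Sum>x<nX. \<Sum>a<nA. of_real (coef z af xf x a) * (\<Sum>e<dE. f a x (z * N + y) (b, e) (b', e)))"
      unfolding sum_distrib_left by (subst (2) sum.swap) (rule refl)
    also have "\<dots> = (\<Sum>x<nX. \<Sum>a<nA. of_real (coef z af xf x a) * K z y (Kz z (\<rho> a x)) $$ (b, b'))"
      using ns_ext_on_ptrace[OF ns _ _ zy[OF *(3)] bD] b bD KK_pair[OF z *(3)]
      by (intro sum.cong refl) (simp add: pad_def)
    also have "\<dots> = K z y (\<rho>z z af xf) $$ (b, b')"
    proof -
      note lin = instrument_lin[OF K[OF z] *(3)]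
      have "K z y (\<rho>z z af xf) = msum (d z) nX (\<lambda>x. K z y (msum dBf nA (\<lambda>a. of_real (coef z af xf x a) \<cdot>\<^sub>m Kz z (\<rho> a x))))"
        unfolding \<rho>z_def by (rule lin_msum[OF lin]) simp
      also have "\<dots> = msum (d z) nX (\<lambda>x. msum (d z) nA (\<lambda>a. of_real (coef z af xf x a) \<cdot>\<^sub>m K z y (Kz z (\<rho> a x))))"
        using lin_comb[OF lin, of nA "\<lambda>a. Kz z (\<rho> a _)"] Kz_carrier[OF z]
        by (intro eq_matI) (auto simp: msum_def[of _ nX] intro!: sum.cong)
      finally show ?thesis
        using b Kc[THEN carrier_matD(1)] Kc[THEN carrier_matD(2)] by (auto simp: msum_def intro!: sum.cong)
    qed
    finally show "(\<Sum>e<dE. \<Sum>x<nX. \<Sum>a<nA. of_real (coef z af xf x a) * f a x (z * N + y) (b, e) (b', e))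
      = K z y (\<rho>z z af xf) $$ (b, b')" .
  next
    fix xf xf' y u v
    assume *: "xf < nXf" "xf' < nXf" "y < nY z" "u \<in> {..<d z} \<times> {..<dE}" "v \<in> {..<d z} \<times> {..<dE}"
    \<comment> \<open>The input 0 serves as reference value for the sum over \<open>a\<close>, which
      by no-signalling is the same for every \<open>x\<close>.\<close>
    have h: "(\<Sum>a<nA. f a x (z * N + y) u v) = (\<Sum>a<nA. f a 0 (z * N + y) u v)" if "x < nX" for x
      using ns_ext_on_no_signalling[OF ns that nX zy[OF *(3)] sub[OF *(4)] sub[OF *(5)]] .
    have "(\<Sum>af<nAf. \<Sum>x<nX. \<Sum>a<nA. of_real (coef z af xf x a) * f a x (z * N + y) u v)
      = (\<Sum>a<nA. f a 0 (z * N + y) u v) / of_real (pz z)" if "xf < nXf" for xf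
      by (rule sum_coef[OF z that]) (rule h)
    then show "(\<Sum>af<nAf. \<Sum>x<nX. \<Sum>a<nA. of_real (coef z af xf x a) * f a x (z * N + y) u v)
      = (\<Sum>af<nAf. \<Sum>x<nX. \<Sum>a<nA. of_real (coef z af xf' x a) * f a x (z * N + y) u v)"
      using *(1,2) by simp
  qed
qed

text \<open>Removal of the padding, followed by coarse-graining with \<open>r = pz z\<close>: the
  factor \<open>pz z\<close> on the left compensates the normalisation contained in
  \<open>coef\<close>.\<close>

lemma cmi_at_conditional:
  assumes ns: "ns_ext_on nA nX (nZ * N) (\<lambda>a x y. KK y (\<rho> a x)) D dE f"
    and z: "z < nZ" and p: "0 < pz z" and y: "y < nY z"
  shows "pz z * cmi_at nAf nXf (d z) dE (\<lambda>xf. q z xf y)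
      (\<lambda>af xf u v. \<Sum>x<nX. \<Sum>a<nA. of_real (coef z af xf x a) * f a x (z * N + y) u v)
    \<le> cmi_at nA nX D dE (\<lambda>x. PP x (z * N + y)) (\<lambda>a x. f a x (z * N + y))"
proof -
  let ?F = "\<lambda>a x. f a x (z * N + y)"
  have zy: "z * N + y < nZ * N" using y z nY_le[OF z] by (intro pair_less) auto
  have pF: "psd_on ({..<D} \<times> {..<dE}) (?F a x)" if "x < nX" "a < nA" for a x
    using ns_ext_on_psd_on[OF ns that(2,1) zy] .
  have zero: "(\<Sum>e<dE. ?F a x (b, e) (b, e)) = 0" if "x < nX" "a < nA" "b < D" "d z \<le> b" for a x b
    using ns_ext_on_ptrace[OF ns that(2,1) zy that(3,3)] that KK_pair[OF z y] by (simp add: pad_def)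
  have PP0: "0 \<le> PP x (z * N + y)" if "x < nX" for x
    using cond_dist_PP zy that unfolding cond_dist_def by blast
  have r: "cmi_at nA nX D dE (\<lambda>x. PP x (z * N + y)) ?F = cmi_at nA nX (d z) dE (\<lambda>x. PP x (z * N + y)) ?F"
    by (rule cmi_at_restrict[OF d_le[OF z] pF zero PP0])
  have pd: "psd_on ({..<d z} \<times> {..<dE}) (?F a x)" if "x < nX" "a < nA" for a x
    by (rule psd_on_restrict[OF d_le[OF z] finite_lessThan pF[OF that]])
  show ?thesis
    unfolding r unfolding PP_pair[OF z y] coef_def
    by (rule cmi_at_coarse_grain[where px = "\<lambda>x xf. px x xf z" and pa = "\<lambda>af xf x a. paf af xf x a z"])
      (use pd q_nonneg[OF z y] p px0 pa0 pa1 z in auto)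
qed

text \<open>A single extension for the combined strategy is compared with all conditional
  assemblages at once. Outcomes in the padding or with \<open>pz z = 0\<close> contribute
  nonnegative terms, so they may be added on the right.\<close>

lemma sum_opt_cmi_le:
  "(\<Sum>z\<in>{z. z < nZ \<and> 0 < pz z}. pz z * opt_cmi nAf nXf (\<rho>z z) (nY z) (d z) (K z) (q z)) \<le> steerability nA nX dB \<rho>"
proof -
  let ?Z = "{z. z < nZ \<and> 0 < pz z}"
  have "(\<Sum>z\<in>?Z. pz z * opt_cmi nAf nXf (\<rho>z z) (nY z) (d z) (K z) (q z)) \<le> opt_cmi nA nX \<rho> (nZ * N) D KK PP"
  proof (rule opt_cmi_greatest[OF as instrument_KK cond_dist_PP])
    fix c assume "c \<in> ext_cmis nA nX \<rho> (nZ * N) D KK PP"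
    then obtain dE f where ns: "ns_ext_on nA nX (nZ * N) (\<lambda>a x y. KK y (\<rho> a x)) D dE f"
      and c: "c = (\<Sum>y<nZ * N. cmi_at nA nX D dE (\<lambda>x. PP x y) (\<lambda>a x. f a x y))"
      by (rule ext_cmisE[OF as instrument_KK cond_dist_PP])
    let ?g = "\<lambda>z y. cmi_at nA nX D dE (\<lambda>x. PP x (z * N + y)) (\<lambda>a x. f a x (z * N + y))"
    have g0: "0 \<le> ?g z y" if "z < nZ" "y < N" for z y
    proof (rule cmi_at_nonneg)
      have zy: "z * N + y < nZ * N" using that by (rule pair_less)
      show "psd_on ({..<D} \<times> {..<dE}) (f a x (z * N + y))" if "x < nX" "a < nA" for x a
        using ns_ext_on_psd_on[OF ns that(2,1) zy] .
      show "0 \<le> PP x (z * N + y)" if "x < nX" for x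
        using cond_dist_PP zy that unfolding cond_dist_def by blast
    qed
    have "(\<Sum>z\<in>?Z. pz z * opt_cmi nAf nXf (\<rho>z z) (nY z) (d z) (K z) (q z)) \<le> (\<Sum>z\<in>?Z. \<Sum>y<N. ?g z y)"
    proof (rule sum_mono)
      fix z assume "z \<in> ?Z"
      then have z: "z < nZ" "0 < pz z" by auto
      let ?G = "\<lambda>af xf y u v. \<Sum>x<nX. \<Sum>a<nA. of_real (coef z af xf x a) * f a x (z * N + y) u v"
      have "opt_cmi nAf nXf (\<rho>z z) (nY z) (d z) (K z) (q z)
          \<le> (\<Sum>y<nY z. cmi_at nAf nXf (d z) dE (\<lambda>xf. q z xf y) (\<lambda>af xf. ?G af xf y))"
        using ext_cmisI[OF assemblage_\<rho>z[OF z] K[OF z(1)] q[OF z(1)] ns_ext_on_conditional[OF ns z]]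
        by (rule opt_cmi_le[OF assemblage_\<rho>z[OF z] K[OF z(1)] q[OF z(1)]])
      then have "pz z * opt_cmi nAf nXf (\<rho>z z) (nY z) (d z) (K z) (q z)
          \<le> (\<Sum>y<nY z. pz z * cmi_at nAf nXf (d z) dE (\<lambda>xf. q z xf y) (\<lambda>af xf. ?G af xf y))"
        using z(2) by (simp add: sum_distrib_left[symmetric])
      also have "\<dots> \<le> (\<Sum>y<nY z. ?g z y)"
        by (intro sum_mono cmi_at_conditional[OF ns z]) simp
      also have "\<dots> \<le> (\<Sum>y<N. ?g z y)"
        using nY_le[OF z(1)] g0[OF z(1)] by (intro sum_mono2) auto
      finally show "pz z * opt_cmi nAf nXf (\<rho>z z) (nY z) (d z) (K z) (q z) \<le> (\<Sum>y<N. ?g z y)" .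
    qed
    also have "\<dots> \<le> (\<Sum>z<nZ. \<Sum>y<N. ?g z y)"
      using g0 by (intro sum_mono2) (auto intro!: sum_nonneg)
    also have "\<dots> = c" unfolding c sum_pair ..
    finally show "(\<Sum>z\<in>?Z. pz z * opt_cmi nAf nXf (\<rho>z z) (nY z) (d z) (K z) (q z)) \<le> c" .
  qed
  also have "\<dots> \<le> steerability nA nX dB \<rho>"
    by (rule opt_cmi_le_steerability[OF as instrument_KK cond_dist_PP])
  finally show ?thesis .
qed

end

context one_way_locc
begin

lemma steerability_monotone:
  "(\<Sum>z\<in>{z. z < nZ \<and> 0 < pz z}. pz z * steerability nAf nXf dBf (\<rho>z z)) \<le> steerability nA nX dB \<rho>"
proof (rule field_le_epsilon)
  fix \<epsilon> :: real assume e: "0 < \<epsilon>"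
  let ?Z = "{z. z < nZ \<and> 0 < pz z}"
  define C where "C = (\<Sum>z\<in>?Z. pz z)"
  have C: "0 \<le> C" unfolding C_def by (intro sum_nonneg) auto
  \<comment> \<open>The denominator \<open>C + 1\<close> is positive and makes
    \<open>C * \<delta> \<le> \<epsilon>\<close> for every nonnegative \<open>C\<close>.\<close>
  define \<delta> where "\<delta> = \<epsilon> / (C + 1)"
  have \<delta>: "0 < \<delta>" "C * \<delta> \<le> \<epsilon>" using C e by (auto simp: \<delta>_def field_simps)
  \<comment> \<open>A strategy is chosen for outcomes of probability zero too, since the combined
    instrument has to preserve the trace on all operators; only the others must be
    near-optimal.\<close>
  let ?P = "\<lambda>z n d K p. z < nZ \<longrightarrow> instrument n dBf d K \<and> cond_dist nXf n p \<and>
    (0 < pz z \<longrightarrow> steerability nAf nXf dBf (\<rho>z z) - \<delta> < opt_cmi nAf nXf (\<rho>z z) n d K p)"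
  have "\<forall>z. \<exists>n d K p. ?P z n d K p"
  proof
    fix z
    show "\<exists>n d K p. ?P z n d K p"
    proof (cases "z < nZ \<and> 0 < pz z")
      case True
      then show ?thesis using steerability_approx[OF assemblage_\<rho>z \<delta>(1), of z] by blast
    next
      case False
      then show ?thesis using instrument_exists[of dBf] cond_dist_exists[OF nXf, of 1] by blast
    qed
  qed
  from choice[OF this] obtain n where "\<forall>z. \<exists>d K p. ?P z (n z) d K p" ..
  from choice[OF this] obtain d where "\<forall>z. \<exists>K p. ?P z (n z) (d z) K p" ..
  from choice[OF this] obtain K where "\<forall>z. \<exists>p. ?P z (n z) (d z) (K z) p" ..
  from choice[OF this] obtain q where s: "\<forall>z. ?P z (n z) (d z) (K z) (q z)" ..
  interpret one_way_locc_strategies nA nX dB \<rho> nZ dBf Kz nXf nAf px paf n d K q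
    by unfold_locales (use s in auto)
  have "(\<Sum>z\<in>?Z. pz z * steerability nAf nXf dBf (\<rho>z z))
      \<le> (\<Sum>z\<in>?Z. pz z * opt_cmi nAf nXf (\<rho>z z) (n z) (d z) (K z) (q z) + pz z * \<delta>)"
  proof (rule sum_mono)
    fix z assume z: "z \<in> ?Z"
    then have "steerability nAf nXf dBf (\<rho>z z) \<le> opt_cmi nAf nXf (\<rho>z z) (n z) (d z) (K z) (q z) + \<delta>"
      using s by force
    then have "pz z * steerability nAf nXf dBf (\<rho>z z) \<le> pz z * (opt_cmi nAf nXf (\<rho>z z) (n z) (d z) (K z) (q z) + \<delta>)"
      using z by (intro mult_left_mono) auto
    then show "pz z * steerability nAf nXf dBf (\<rho>z z) \<le> pz z * opt_cmi nAf nXf (\<rho>z z) (n z) (d z) (K z) (q z) + pz z * \<delta>"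
      by (simp add: distrib_left)
  qed
  also have "\<dots> = (\<Sum>z\<in>?Z. pz z * opt_cmi nAf nXf (\<rho>z z) (n z) (d z) (K z) (q z)) + C * \<delta>"
    by (simp add: sum.distrib sum_distrib_right C_def)
  also have "\<dots> \<le> steerability nA nX dB \<rho> + \<epsilon>" using sum_opt_cmi_le \<delta>(2) by (rule add_mono)
  finally show "(\<Sum>z\<in>?Z. pz z * steerability nAf nXf dBf (\<rho>z z)) \<le> steerability nA nX dB \<rho> + \<epsilon>" .
qed

end

theorem theorem1:
  fixes nA nX dB :: nat and \<rho> :: "nat \<Rightarrow> nat \<Rightarrow> complex mat"
  assumes "assemblage nA nX dB \<rho>"
  shows
  \<comment> \<open>(i) vanishing on unsteerable assemblages\<close>
  "(\<forall>(nL :: nat) (pL :: nat \<Rightarrow> real) (pA :: nat \<Rightarrow> nat \<Rightarrow> nat \<Rightarrow> real) (\<sigma> :: nat \<Rightarrow> complex mat).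
      (\<forall>l<nL. 0 \<le> pL l) \<and> (\<Sum>l<nL. pL l) = 1 \<and>
      (\<forall>x<nX. \<forall>l<nL. (\<forall>a<nA. 0 \<le> pA a x l) \<and> (\<Sum>a<nA. pA a x l) = 1) \<and>
      (\<forall>l<nL. density dB (\<sigma> l)) \<and>
      (\<forall>a<nA. \<forall>x<nX. \<rho> a x = msum dB nL (\<lambda>l. complex_of_real (pL l * pA a x l) \<cdot>\<^sub>m \<sigma> l))
    \<longrightarrow> steerability nA nX dB \<rho> = 0)
  \<and>
  \<comment> \<open>(ii) monotonicity on average under deterministic 1W-LOCC\<close>
  (\<forall>(nZ :: nat) (dBf :: nat) (Kz :: nat \<Rightarrow> complex mat \<Rightarrow> complex mat) (nXf :: nat) (nAf :: nat)
      (px :: nat \<Rightarrow> nat \<Rightarrow> nat \<Rightarrow> real) (paf :: nat \<Rightarrow> nat \<Rightarrow> nat \<Rightarrow> nat \<Rightarrow> nat \<Rightarrow> real).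
      instrument nZ dB dBf Kz \<and> 0 < nXf \<and>
      (\<forall>xf<nXf. \<forall>z<nZ. (\<forall>x<nX. 0 \<le> px x xf z) \<and> (\<Sum>x<nX. px x xf z) = 1) \<and>
      (\<forall>xf<nXf. \<forall>x<nX. \<forall>a<nA. \<forall>z<nZ.
          (\<forall>af<nAf. 0 \<le> paf af xf x a z) \<and> (\<Sum>af<nAf. paf af xf x a z) = 1)
    \<longrightarrow> (let \<rho>B = msum dB nA (\<lambda>a. \<rho> a 0);
             pz = (\<lambda>z. Re (mtrace (Kz z \<rho>B)));
             \<rho>z = (\<lambda>z af xf. msum dBf nX (\<lambda>x. msum dBf nA (\<lambda>a.
                     complex_of_real (paf af xf x a z * px x xf z / pz z) \<cdot>\<^sub>m Kz z (\<rho> a x))))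
         in (\<Sum>z\<in>{z. z < nZ \<and> 0 < pz z}. pz z * steerability nAf nXf dBf (\<rho>z z))
              \<le> steerability nA nX dB \<rho>))
  \<and>
  \<comment> \<open>(iii) convexity\<close>
  (\<forall>(\<sigma> :: nat \<Rightarrow> nat \<Rightarrow> complex mat) (t :: real).
      assemblage nA nX dB \<sigma> \<and> 0 \<le> t \<and> t \<le> 1
    \<longrightarrow> steerability nA nX dB
          (\<lambda>a x. complex_of_real t \<cdot>\<^sub>m \<rho> a x + complex_of_real (1 - t) \<cdot>\<^sub>m \<sigma> a x)
        \<le> t * steerability nA nX dB \<rho> + (1 - t) * steerability nA nX dB \<sigma>)"
proof (intro conjI allI impI)
  fix nL :: nat and pL :: "nat \<Rightarrow> real" and pA :: "nat \<Rightarrow> nat \<Rightarrow> nat \<Rightarrow> real" and \<sigma> :: "nat \<Rightarrow> complex mat"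
  assume "(\<forall>l<nL. 0 \<le> pL l) \<and> (\<Sum>l<nL. pL l) = 1 \<and>
      (\<forall>x<nX. \<forall>l<nL. (\<forall>a<nA. 0 \<le> pA a x l) \<and> (\<Sum>a<nA. pA a x l) = 1) \<and>
      (\<forall>l<nL. density dB (\<sigma> l)) \<and>
      (\<forall>a<nA. \<forall>x<nX. \<rho> a x = msum dB nL (\<lambda>l. complex_of_real (pL l * pA a x l) \<cdot>\<^sub>m \<sigma> l))"
  then show "steerability nA nX dB \<rho> = 0"
    by (intro steerability_unsteerable[OF assms, of nL pL pA \<sigma>]) (auto simp: density_def)
next
  fix nZ dBf :: nat and Kz :: "nat \<Rightarrow> complex mat \<Rightarrow> complex mat" and nXf nAf :: nat
    and px :: "nat \<Rightarrow> nat \<Rightarrow> nat \<Rightarrow> real" and paf :: "nat \<Rightarrow> nat \<Rightarrow> nat \<Rightarrow> nat \<Rightarrow> nat \<Rightarrow> real"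
  assume h: "instrument nZ dB dBf Kz \<and> 0 < nXf \<and>
      (\<forall>xf<nXf. \<forall>z<nZ. (\<forall>x<nX. 0 \<le> px x xf z) \<and> (\<Sum>x<nX. px x xf z) = 1) \<and>
      (\<forall>xf<nXf. \<forall>x<nX. \<forall>a<nA. \<forall>z<nZ.
          (\<forall>af<nAf. 0 \<le> paf af xf x a z) \<and> (\<Sum>af<nAf. paf af xf x a z) = 1)"
  interpret one_way_locc nA nX dB \<rho> nZ dBf Kz nXf nAf px paf
    using assms h by unfold_locales auto
  show "let \<rho>B = msum dB nA (\<lambda>a. \<rho> a 0);
             pz = (\<lambda>z. Re (mtrace (Kz z \<rho>B)));
             \<rho>z = (\<lambda>z af xf. msum dBf nX (\<lambda>x. msum dBf nA (\<lambda>a.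
                     complex_of_real (paf af xf x a z * px x xf z / pz z) \<cdot>\<^sub>m Kz z (\<rho> a x))))
         in (\<Sum>z\<in>{z. z < nZ \<and> 0 < pz z}. pz z * steerability nAf nXf dBf (\<rho>z z))
              \<le> steerability nA nX dB \<rho>"
    using steerability_monotone unfolding pz_def \<rho>z_def[abs_def] coef_def \<rho>B_def Let_def .
next
  fix \<sigma> :: "nat \<Rightarrow> nat \<Rightarrow> complex mat" and t :: real
  assume "assemblage nA nX dB \<sigma> \<and> 0 \<le> t \<and> t \<le> 1"
  then show "steerability nA nX dB (\<lambda>a x. complex_of_real t \<cdot>\<^sub>m \<rho> a x + complex_of_real (1 - t) \<cdot>\<^sub>m \<sigma> a x)
        \<le> t * steerability nA nX dB \<rho> + (1 - t) * steerability nA nX dB \<sigma>"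
    using steerability_convex[OF assms] by blast
qed

end
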